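(* Let $\hat T$ be an expanding map of the unit interval $[0,1]$ with properties (a) and (b) of the context. Suppose $H$ is a hole satisfying condition (A1) of the context. Then there exists a nontrivial absolutely continuous conditionally invariant measure for $T$ whose density is bounded above. If $\alpha=1$, the density is of bounded variation. Suppose in addition that $T$ satisfies the following transitivity property: for each interval $I_j$ there exists an integer $n_j$ such that $$I_j\cup T I_{j,1}\cup T^2I_{j,2}\cup T^3I_{j,3}\cup\dots\cup T^{n_j}I_{j,n_j}=I.$$ Then the conditionally invariant density is bounded away from zero on $I$.
   Context: $m$ denotes Lebesgue measure on $[0,1]$. **The map.** $\hat T$ is a piecewise monotone map of $[0,1]$ into itself with finitely many intervals of monotonicity $\hat I_1,\dots,\hat I_{\hat K}$ such that (a) $\hat T$ is $C^{1+\alpha}$ on each $\hat I_j$, for a fixed $\alpha>0$; in particular there is $\hat C>0$ with $|\hat T'(x)-\hat T'(y)|\le\hat C|x-y|^\alpha$ whenever $x,y$ lie in the same $\hat I_j$ ($\alpha=1$ is understood to mean that $\hat T$ is $C^2$ on each $\hat I_j$); (b) $|\hat T'|\ge\mu>2$. **The hole.** $H\subset[0,1]$ is a finite union of open intervals $H_1,\dots,H_L$, and $I=[0,1]\setminus H$. For $n\ge0$, $I^n=\bigcap_{i=0}^n\hat T^{-i}I$ and $T^n=\hat T^n|_{I^n}$; in particular $T=\hat T|_{I\cap\hat T^{-1}I}$. $\{I_1,\dots,I_K\}$ is the partition of $I$ into intervals of monotonicity, i.e. the maximal intervals of the sets $\hat I_k\cap I$. $I_{j,n}=I_j\cap I^n$.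 **Conditionally invariant measures.** A Borel probability measure $\nu$ on $I$ is conditionally invariant for $T$ if $\nu(T^{-1}A)=\lambda\,\nu(A)$ for all Borel $A\subset I$, where $\lambda=\nu(T^{-1}I)$ is its eigenvalue. It is nontrivial if $\lambda>0$, and absolutely continuous if it is absolutely continuous with respect to $m$; its density is then its density with respect to $m$. **Condition (A1).** Let $d$ be the minimum length of the $I_j$, and let $\tilde C=\exp\!\big(\frac{\hat C}{\mu(\mu^\alpha-1)}\big)-1$. For $\delta>0$ let $C=\tilde C(2\delta)^\alpha$. Choose and fix $\delta$ with $0<\delta\le d$ small enough that $\frac{2^\alpha(1+C)}{\mu^\alpha}<1$, and let $a=\max\left\{\sqrt{2/\mu},\ \frac{2^\alpha(1+C)}{\mu^\alpha}\right\}$. In the case $\alpha=1$, simply take $\delta=d$ (the condition $\frac{2^\alpha(1+C)}{\mu^\alpha}<1$ is not required) and $a=\max\{\sqrt{2/\mu},\,2/\mu\}=\sqrt{2/\mu}$. Condition (A1) is $$m(H)\le\frac{(1-a)^2\,\mu\,\delta^2\left(1-\sqrt{2/\mu}\right)}{1+C}.$$ *)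

theory Defs
  imports "HOL-Probability.Probability"
begin

text \<open>
  A map of \<open>[0,1]\<close> is a function \<open>That :: real \<Rightarrow> real\<close> whose values off \<open>{0..1}\<close> are
  irrelevant. Its intervals of monotonicity \<open>Ihat 1, \<dots>, Ihat Khat\<close> partition \<open>{0..1}\<close> and may
  each be open, closed or half-open.
\<close>

definition piecewise_monotone_map ::
    "(real \<Rightarrow> real) \<Rightarrow> nat \<Rightarrow> (nat \<Rightarrow> real set) \<Rightarrow> bool" where
  "piecewise_monotone_map That Khat Ihat \<longleftrightarrow>
     That ` {0..1} \<subseteq> {0..1} \<and>
     (\<Union>j\<in>{1..Khat}. Ihat j) = {0..1} \<and>
     disjoint_family_on Ihat {1..Khat} \<and>
     (\<forall>j\<in>{1..Khat}. is_interval (Ihat j) \<and> interior (Ihat j) \<noteq> {} \<and>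
        (mono_on (Ihat j) That \<or> antimono_on (Ihat j) That))"

text \<open>
  \<open>dT\<close> is the derivative of \<open>That\<close> on each interval of monotonicity, one-sided at an endpoint
  that belongs to the interval. The constants \<open>\<mu>\<close> and \<open>Chat\<close> are explicit because the smallness
  condition on the hole refers to them.
\<close>

definition expanding_map ::
    "(real \<Rightarrow> real) \<Rightarrow> (real \<Rightarrow> real) \<Rightarrow> nat \<Rightarrow> (nat \<Rightarrow> real set) \<Rightarrow> real \<Rightarrow> real \<Rightarrow> real \<Rightarrow> bool" where
  "expanding_map That dT Khat Ihat \<alpha> Chat \<mu> \<longleftrightarrow>
     piecewise_monotone_map That Khat Ihat \<and>
     \<alpha> > 0 \<and> Chat > 0 \<and> \<mu> > 2 \<and>
     (\<forall>j\<in>{1..Khat}.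
        (\<forall>x\<in>Ihat j. (That has_real_derivative dT x) (at x within Ihat j)) \<and>
        (\<forall>x\<in>Ihat j. \<forall>y\<in>Ihat j. \<bar>dT x - dT y\<bar> \<le> Chat * \<bar>x - y\<bar> powr \<alpha>) \<and>
        (\<alpha> = 1 \<longrightarrow> (\<exists>ddT. (\<forall>x\<in>Ihat j. (dT has_real_derivative ddT x) (at x within Ihat j)) \<and>
                          continuous_on (Ihat j) ddT)) \<and>
        (\<forall>x\<in>Ihat j. \<bar>dT x\<bar> \<ge> \<mu>))"

text \<open>
  Open means open in the space \<open>[0,1]\<close>, so a component \<open>[0,\<epsilon>)\<close> or \<open>(1-\<epsilon>,1]\<close> is admitted. The hole
  is proper: otherwise \<open>I\<close> is empty and the minimum length of the \<open>I\<^sub>j\<close> does not exist.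
\<close>

definition is_hole :: "real set \<Rightarrow> bool" where
  "is_hole H \<longleftrightarrow>
     (\<exists>L. \<exists>Hs :: nat \<Rightarrow> real set.
        H = (\<Union>l\<in>{1..L}. Hs l) \<and>
        (\<forall>l\<in>{1..L}. is_interval (Hs l) \<and> openin (top_of_set {0..1}) (Hs l))) \<and>
     H \<noteq> {0..1}"

definition hole_complement :: "real set \<Rightarrow> real set" where
  "hole_complement H = {0..1} - H"

definition surviving :: "(real \<Rightarrow> real) \<Rightarrow> real set \<Rightarrow> nat \<Rightarrow> real set" where
  "surviving That H n = (\<Inter>i\<le>n. (That ^^ i) -` hole_complement H)"

text \<open>The preimage and the iterated image under the map with hole, \<open>T\<^sup>n\<close> being the restriction of
  \<open>That ^^ n\<close> to \<open>surviving That H n\<close>.\<close>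

definition hole_vimage :: "(real \<Rightarrow> real) \<Rightarrow> real set \<Rightarrow> real set \<Rightarrow> real set" where
  "hole_vimage That H A = surviving That H 1 \<inter> That -` A"

definition hole_image :: "(real \<Rightarrow> real) \<Rightarrow> real set \<Rightarrow> nat \<Rightarrow> real set \<Rightarrow> real set" where
  "hole_image That H n J = (That ^^ n) ` (J \<inter> surviving That H n)"

text \<open>The set \<open>{I\<^sub>1, \<dots>, I\<^sub>K}\<close>. The maximal intervals contained in a set of reals are its connected
  components; an isolated point of \<open>Ihat k \<inter> I\<close> counts as an interval of length zero.\<close>

definition hole_partition :: "nat \<Rightarrow> (nat \<Rightarrow> real set) \<Rightarrow> real set \<Rightarrow> real set set" where
  "hole_partition Khat Ihat H = (\<Union>k\<in>{1..Khat}. components (Ihat k \<inter> hole_complement H))"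

definition min_length :: "nat \<Rightarrow> (nat \<Rightarrow> real set) \<Rightarrow> real set \<Rightarrow> real" where
  "min_length Khat Ihat H = Min (measure lborel ` hole_partition Khat Ihat H)"

definition condition_A1 ::
    "nat \<Rightarrow> (nat \<Rightarrow> real set) \<Rightarrow> real set \<Rightarrow> real \<Rightarrow> real \<Rightarrow> real \<Rightarrow> real \<Rightarrow> bool" where
  "condition_A1 Khat Ihat H \<alpha> Chat \<mu> \<delta> \<longleftrightarrow>
     (let d = min_length Khat Ihat H;
          Ctilde = exp (Chat / (\<mu> * (\<mu> powr \<alpha> - 1))) - 1;
          C = Ctilde * (2 * \<delta>) powr \<alpha>;
          r = 2 powr \<alpha> * (1 + C) / \<mu> powr \<alpha>;
          a = (if \<alpha> = 1 then max (sqrt (2 / \<mu>)) (2 / \<mu>) else max (sqrt (2 / \<mu>)) r)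
      in 0 < \<delta> \<and> (if \<alpha> = 1 then \<delta> = d else \<delta> \<le> d \<and> r < 1) \<and>
         measure lborel H \<le> (1 - a)\<^sup>2 * \<mu> * \<delta>\<^sup>2 * (1 - sqrt (2 / \<mu>)) / (1 + C))"

definition eigenvalue :: "(real \<Rightarrow> real) \<Rightarrow> real set \<Rightarrow> real measure \<Rightarrow> real" where
  "eigenvalue That H \<nu> = measure \<nu> (hole_vimage That H (hole_complement H))"

definition conditionally_invariant :: "(real \<Rightarrow> real) \<Rightarrow> real set \<Rightarrow> real measure \<Rightarrow> bool" where
  "conditionally_invariant That H \<nu> \<longleftrightarrow>
     prob_space \<nu> \<and> sets \<nu> = sets (restrict_space borel (hole_complement H)) \<and>
     (\<forall>A\<in>sets borel. A \<subseteq> hole_complement H \<longrightarrow>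
        measure \<nu> (hole_vimage That H A) = eigenvalue That H \<nu> * measure \<nu> A)"

definition is_density_on :: "real set \<Rightarrow> real measure \<Rightarrow> (real \<Rightarrow> real) \<Rightarrow> bool" where
  "is_density_on S \<nu> \<rho> \<longleftrightarrow>
     \<rho> \<in> borel_measurable (restrict_space borel S) \<and> (\<forall>x\<in>S. \<rho> x \<ge> 0) \<and>
     \<nu> = density (restrict_space lborel S) (\<lambda>x. ennreal (\<rho> x))"

definition bounded_variation_on :: "real set \<Rightarrow> (real \<Rightarrow> real) \<Rightarrow> bool" where
  "bounded_variation_on S f \<longleftrightarrow>
     (\<exists>V. \<forall>n. \<forall>x :: nat \<Rightarrow> real. (\<forall>i\<le>n. x i \<in> S) \<and> (\<forall>i<n. x i \<le> x (Suc i)) \<longrightarrow>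
        (\<Sum>i<n. \<bar>f (x (Suc i)) - f (x i)\<bar>) \<le> V)"

definition transitivity_property ::
    "(real \<Rightarrow> real) \<Rightarrow> nat \<Rightarrow> (nat \<Rightarrow> real set) \<Rightarrow> real set \<Rightarrow> bool" where
  "transitivity_property That Khat Ihat H \<longleftrightarrow>
     (\<forall>J\<in>hole_partition Khat Ihat H. \<exists>n. J \<union> (\<Union>i\<in>{1..n}. hole_image That H i J) = hole_complement H)"

end

theory Submission
  imports Defs "HOL-Complex_Analysis.Great_Picard"
begin

text \<open>
  Let \<open>L\<close> be the transfer operator of the map with hole: it discards the mass that a density on
  \<open>[0,1]\<close> has in the hole and pushes the rest forward. The density is a weak limit of weighted
  averages of the iterates \<open>L\<^sup>n 1\<close>, and the whole argument rests on one estimate: the supremum of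
  \<open>L\<^sup>n 1\<close> is at most a constant \<open>M_star\<close> times its mass \<open>m\<^sub>n\<close>, uniformly in \<open>n\<close>.

  To obtain it, write \<open>L\<^sup>n 1\<close> as a finite sum of pieces, each living on an open interval of length
  at most \<open>2\<delta>\<close> with a logarithm that is Hoelder for a constant \<open>A\<close> which \<open>L\<close> reproduces, and let
  \<open>M\<close> be the sum of the suprema of the pieces. All partition intervals are at least \<open>\<delta>\<close> long, so a
  piece is cut into at most two extreme parts and otherwise full partition intervals. The image of
  an extreme part has at most \<open>1/\<mu>\<close> times the old supremum. The image of a full partition interval
  is longer than \<open>\<delta>\<close> and can be chopped into pieces between \<open>\<delta>\<close> and \<open>2\<delta>\<close>, where the supremum is
  at most \<open>1 + C\<close> times the mean. A long image of an extreme part is chopped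
  in the same way. Hence \<open>M' \<le> (2/\<mu>) M + ((1 + C)/\<delta>) m'\<close>, where \<open>m'\<close> is the new
  mass (\<open>push_standard\<close>). Put \<open>s = sqrt (2/\<mu>)\<close>. While \<open>M \<le> M_star m\<close>, condition (A1) lets at most
  the fraction \<open>(1 - s)\<^sup>2\<close> of the mass fall into the hole, so \<open>m' \<ge> s m\<close>, and the inequality for
  \<open>M'\<close> reproduces \<open>M' \<le> M_star m'\<close> because \<open>s\<^sup>2/s + (1 - s) = 1\<close> (\<open>iterated_densities\<close>).

  The estimate gives \<open>m\<^sub>n\<^sub>+\<^sub>k \<le> M_star m\<^sub>n m\<^sub>k\<close>, so \<open>m\<^sub>n\<close> has an exponential rate \<open>R\<close>, and the sums of
  \<open>m\<^sub>n / R\<^sup>n\<close> diverge while the next term becomes negligible against them along a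
  subsequence. The averages
  with weights \<open>R\<^sup>-\<^sup>n\<close> are therefore almost eigenvectors of \<open>L\<close> for \<open>R\<close>
  (\<open>almost_invariant_densities\<close>). Being uniformly bounded they have a weak limit with bounded
  density, which is an exact eigenvector. For \<open>\<alpha> = 1\<close> every piece is Lipschitz with a constant
  proportional to its supremum, so \<open>M\<close> also controls the variation, and Helly selection makes the
  limit a function of bounded variation (\<open>standard_subsequence\<close>).

  For the lower bound, \<open>M \<le> M_star m\<close> forces a fixed share of the mass to sit on pieces that are
  at least as long as a prescribed length below \<open>1 / M_star\<close>. A pigeonhole argument over a finite grid
  then leaves one interval of nearly that length on which the limit is bounded below. Such an interval
  exceeds the threshold \<open>m(H) / (1 - s\<^sup>2)\<close> beyond which expansion outweighs the loss to the hole
  and one cut in two, so its images grow until they cover a partition interval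
  (\<open>low_branch_exists\<close>); transitivity carries the bound from there to all of \<open>I\<close>.
\<close>

section \<open>Integrals, weighted averages and compactness\<close>

lemma set_integrable_of_integrable:
  fixes h :: "real \<Rightarrow> real"
  assumes "integrable lborel h" "A \<in> sets borel"
  shows "set_integrable lborel A h"
  using assms unfolding set_integrable_def by (intro integrable_mult_indicator) auto

text \<open>
  Change of variables read backwards: the integrand \<open>g\<close> on \<open>S\<close> is given and \<open>f\<close> on the image is
  recovered from it, which is how the transfer operator acts.
\<close>

lemma set_integral_image_C1:
  fixes T dT f g :: "real \<Rightarrow> real"
  assumes S: "S \<in> sets borel" and TS: "T ` S \<in> sets borel"
    and der: "\<And>x. x \<in> S \<Longrightarrow> (T has_real_derivative dT x) (at x)"
    and inj: "inj_on T S"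
    and f: "set_integrable lborel (T ` S) f"
    and g: "set_borel_measurable borel S g"
    and eq: "\<And>x. x \<in> S \<Longrightarrow> g x = \<bar>dT x\<bar> * f (T x)"
  shows "(LINT x:S|lborel. g x) = (LINT z:T ` S|lborel. f z)"
proof -
  have fl: "f absolutely_integrable_on (T ` S)"
    using f unfolding set_integrable_def by (rule integrable_completion[THEN iffD2, rotated]) (use f in \<open>auto simp: set_integrable_def\<close>)
  have "(\<lambda>x. \<bar>dT x\<bar> * f (T x)) absolutely_integrable_on S \<and>
        integral S (\<lambda>x. \<bar>dT x\<bar> * f (T x)) = integral (T ` S) f"
    by (subst has_absolute_integral_change_of_variables_1')
      (use S der inj fl in \<open>auto intro: has_field_derivative_at_within\<close>)
  hence 1: "g absolutely_integrable_on S" "integral S g = integral (T ` S) f"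
    using eq by (auto cong: set_integrable_cong Henstock_Kurzweil_Integration.integral_cong)
  have m: "(\<lambda>x. indicator S x *\<^sub>R g x) \<in> borel_measurable lborel"
    using g by (simp add: set_borel_measurable_def)
  have "set_integrable lborel S g"
    using 1(1) m unfolding set_integrable_def by (simp add: integrable_completion)
  thus ?thesis
    using set_borel_integral_eq_integral(2)[of S g] set_borel_integral_eq_integral(2)[OF f] 1(2) by simp
qed

text \<open>
  The rate is \<open>R = inf (M * m n)\<^sup>1\<^sup>/\<^sup>n\<close>. Submultiplicativity of \<open>M * m n\<close> gives \<open>m n / R ^ n \<ge> 1/M\<close>,
  so the partial sums \<open>S\<close> diverge. If the next term were at least \<open>e * S\<close> from some point on, \<open>S\<close>
  and with it \<open>m n / R ^ n\<close> would grow like \<open>(1 + e) ^ n\<close>, against the choice of \<open>R\<close>.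
\<close>

lemma almost_submultiplicative_averages:
  fixes m :: "nat \<Rightarrow> real" and M s :: real
  assumes M: "M > 0" and s: "s > 0" and pos: "\<And>n. m n > 0"
    and sub: "\<And>n k. m (n + k) \<le> M * m n * m k" and low: "\<And>n. s ^ n \<le> M * m n"
  shows "\<exists>R>0. \<forall>e>0. \<exists>N. let S = (\<Sum>n<N. m n / R ^ n) in
           S > 0 \<and> 1 \<le> e * S \<and> m N / R ^ N \<le> e * S"
proof -
  define c where "c = (\<lambda>n. M * m n)"
  have cpos: "c n > 0" for n using M pos by (simp add: c_def)
  define R where "R = (INF n\<in>{1..}. root n (c n))"
  have s_le: "s \<le> root n (c n)" if "n \<ge> 1" for n
  proof -
    have "s = root n (s ^ n)" using that s by (simp add: real_root_power_cancel)
    also have "\<dots> \<le> root n (c n)" using low[of n] that by (simp add: c_def)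
    finally show ?thesis .
  qed
  have bdd: "bdd_below ((\<lambda>n. root n (c n)) ` {1..})"
    using s_le by (intro bdd_belowI[of _ s]) auto
  have Rpos: "R > 0"
    using s_le s unfolding R_def by (intro less_le_trans[OF s] cINF_greatest) auto
  have Rle: "R ^ n \<le> c n" if "n \<ge> 1" for n
  proof -
    have "R \<le> root n (c n)" unfolding R_def using bdd that by (intro cINF_lower) auto
    hence "R ^ n \<le> root n (c n) ^ n" using Rpos by (intro power_mono) auto
    also have "\<dots> = c n" using that cpos[of n] by (simp add: real_root_pow_pos2)
    finally show ?thesis .
  qed
  define v where "v = (\<lambda>n. m n / R ^ n)"
  define S where "S = (\<lambda>N. \<Sum>n<N. v n)"
  have vpos: "v n > 0" for n using pos Rpos by (simp add: v_def)
  have vge: "v n \<ge> 1 / M" if "n \<ge> 1" for n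
    using Rle[OF that] Rpos M by (simp add: v_def c_def field_simps)
  have "\<exists>N. S N > 0 \<and> 1 \<le> e * S N \<and> v N \<le> e * S N" if e: "e > 0" for e
  proof (rule ccontr)
    assume contra: "\<not> ?thesis"
    \<comment> \<open>from \<open>N1\<close> on the sums are so large that only the last of the three conditions can fail\<close>
    obtain N1 :: nat where N1: "N1 \<ge> 1" "real N1 \<ge> M / e + 1"
      using real_arch_simple[of "M / e + 1"] by (metis add.commute le_add_same_cancel1 linorder_le_cases
          of_nat_1 of_nat_mono order_trans)
    have SN1: "S N \<ge> (real N - 1) / M" if "N \<ge> 1" for N
      using that
    proof (induction N rule: dec_induct)
      case base thus ?case using vpos[of 0] by (simp add: S_def)
    next
      case (step n)
      thus ?case using vge[of n] by (simp add: S_def add_divide_distrib diff_divide_distrib)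
    qed
    have big: "S N > 0 \<and> 1 \<le> e * S N" if "N \<ge> N1" for N
    proof -
      have "M / e \<le> real N - 1" using N1 that by simp
      hence "1 / e \<le> (real N - 1) / M" using e M by (simp add: field_simps)
      also have "\<dots> \<le> S N" using SN1 N1 that by simp
      finally have "1 / e \<le> S N" .
      thus ?thesis using e by (simp add: field_simps) (smt (verit) divide_pos_pos mult_pos_pos zero_less_mult_iff)
    qed
    have grow: "S (N1 + j) \<ge> (1 + e) ^ j * S N1" for j
    proof (induction j)
      case (Suc j)
      have "v (N1 + j) > e * S (N1 + j)" using contra big[of "N1 + j"] by force
      hence "S (N1 + Suc j) \<ge> (1 + e) * S (N1 + j)" by (simp add: S_def algebra_simps)
      moreover have "(1 + e) * S (N1 + j) \<ge> (1 + e) * ((1 + e) ^ j * S N1)"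
        using Suc e by (intro mult_left_mono) auto
      ultimately show ?case by (simp add: mult_ac)
    qed simp
    define \<kappa> where "\<kappa> = e * S N1 / (1 + e) ^ N1"
    have kpos: "\<kappa> > 0" using e big[of N1] by (simp add: \<kappa>_def)
    have vgrow: "v N \<ge> \<kappa> * (1 + e) ^ N" if N: "N \<ge> N1" for N
    proof -
      obtain j where j: "N = N1 + j" using le_Suc_ex[OF N] by blast
      have "v N > e * S N" using contra big[OF N] by force
      moreover have "e * S N \<ge> e * ((1 + e) ^ j * S N1)" using grow[of j] e j by simp
      moreover have "e * ((1 + e) ^ j * S N1) = \<kappa> * (1 + e) ^ N"
        using e by (simp add: \<kappa>_def j power_add)
      ultimately show ?thesis by simp
    qed
    have "R < R * (1 + e)" using Rpos e by (simp add: algebra_simps)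
    then obtain k where k: "k \<ge> 1" "root k (c k) < R * (1 + e)"
      using cINF_less_iff[of "{1..}" "\<lambda>n. root n (c n)"] bdd unfolding R_def by fastforce
    define \<theta> where "\<theta> = c k / (R * (1 + e)) ^ k"
    have "root k (c k) ^ k < (R * (1 + e)) ^ k"
      using k cpos[of k] by (intro power_strict_mono) auto
    hence "c k < (R * (1 + e)) ^ k" using k cpos[of k] by (simp add: real_root_pow_pos2)
    hence th: "0 < \<theta>" "\<theta> < 1" using cpos[of k] Rpos e by (auto simp: \<theta>_def)
    have mj: "m (j * k) \<le> m 0 * c k ^ j" for j
    proof (induction j)
      case (Suc j)
      have "m (Suc j * k) \<le> M * m (j * k) * m k" using sub[of "j * k" k] by (simp add: add.commute)
      also have "\<dots> = m (j * k) * c k" by (simp add: c_def)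
      also have "\<dots> \<le> (m 0 * c k ^ j) * c k" using Suc cpos[of k] by (intro mult_right_mono) auto
      finally show ?case by (simp add: mult_ac)
    qed simp
    have "\<kappa> \<le> m 0 * \<theta> ^ j" if "j \<ge> N1" for j
    proof -
      have jk: "j * k \<ge> N1" using that k(1) by (metis le_trans mult.right_neutral mult_le_mono2)
      have "\<kappa> * (1 + e) ^ (j * k) \<le> m (j * k) / R ^ (j * k)"
        using vgrow[OF jk] by (simp add: v_def)
      also have "\<dots> \<le> m 0 * c k ^ j / R ^ (j * k)" using mj Rpos by (intro divide_right_mono) auto
      finally have "\<kappa> * (1 + e) ^ (j * k) \<le> m 0 * c k ^ j / R ^ (j * k)" .
      hence "\<kappa> \<le> (m 0 * c k ^ j / R ^ (j * k)) / (1 + e) ^ (j * k)"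
        using e by (subst pos_le_divide_eq) auto
      hence "\<kappa> \<le> m 0 * c k ^ j / (R ^ (j * k) * (1 + e) ^ (j * k))"
        by (simp only: divide_divide_eq_left)
      also have "\<dots> = m 0 * \<theta> ^ j"
        by (simp add: \<theta>_def power_divide power_mult_distrib mult.commute[of j k] power_mult)
      finally show ?thesis .
    qed
    moreover have "(\<lambda>j. m 0 * \<theta> ^ j) \<longlonglongrightarrow> m 0 * 0"
      using th by (intro tendsto_intros LIMSEQ_power_zero) auto
    ultimately have "\<kappa> \<le> 0"
      by (intro tendsto_lowerbound[of "\<lambda>j. m 0 * \<theta> ^ j" _ sequentially]) (auto simp: eventually_sequentially)
    thus False using kpos by simp
  qed
  thus ?thesis using Rpos unfolding S_def v_def Let_def by blast
qed

text \<open>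
  Helly selection without one-sided continuity, which the monotone parts of a piecewise density need
  not have: converge at all rationals, take right limits, and squeeze at the points of continuity.
\<close>

lemma mono_subsequence_convergent:
  fixes p :: "nat \<Rightarrow> real \<Rightarrow> real"
  assumes mono: "\<And>n. mono (p n)" and bd: "\<And>n x. 0 \<le> p n x \<and> p n x \<le> K"
  obtains r q where "strict_mono (r :: nat \<Rightarrow> nat)" "mono q"
    "countable {x. \<not> (\<lambda>n. p (r n) x) \<longlonglongrightarrow> q x}"
proof -
  obtain r where r: "strict_mono (r :: nat \<Rightarrow> nat)"
    and conv: "\<And>x. x \<in> \<rat> \<Longrightarrow> \<exists>l. (\<lambda>n. p (r n) x) \<longlonglongrightarrow> l"
    using function_convergent_subsequence[of "\<rat>" p K] bd countable_rat by (auto simp: abs_le_iff)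
  define L where "L x = lim (\<lambda>n. p (r n) x)" for x
  have L: "(\<lambda>n. p (r n) x) \<longlonglongrightarrow> L x" if "x \<in> \<rat>" for x
    using conv[OF that] unfolding L_def by (metis convergent_def convergent_LIMSEQ_iff)
  have L0: "L x \<ge> 0" if "x \<in> \<rat>" for x
    using L[OF that] bd by (intro tendsto_lowerbound[OF L[OF that]]) auto
  define q where "q x = (INF y\<in>{y\<in>\<rat>. x < y}. L y)" for x
  have ne: "{y\<in>\<rat>. (x::real) < y} \<noteq> {}" for x
    using Rats_dense_in_real[of x "x + 1"] by auto
  have bdd: "bdd_below (L ` {y\<in>\<rat>. x < y})" for x
    using L0 by (intro bdd_belowI[of _ 0]) auto
  have qL: "q x \<le> L y" if "x < y" "y \<in> \<rat>" for x y
    unfolding q_def using bdd that by (intro cINF_lower) auto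
  have mq: "mono q"
    unfolding q_def by (intro monoI cINF_superset_mono ne bdd) auto
  have lim: "(\<lambda>n. p (r n) x) \<longlonglongrightarrow> q x" if c: "isCont q x" for x
  proof (rule LIMSEQ_I)
    fix e :: real assume e: "e > 0"
    obtain y where y: "y \<in> \<rat>" "x < y" "L y < q x + e"
      using cINF_less_iff[OF ne bdd, of x "q x + e"] e unfolding q_def by auto
    obtain d where d: "d > 0" "\<And>z. \<bar>z - x\<bar> < d \<Longrightarrow> \<bar>q z - q x\<bar> < e"
      using c e unfolding continuous_at_real_range by (metis real_norm_def)
    obtain z where z: "z \<in> \<rat>" "x - d/2 < z" "z < x" using Rats_dense_in_real[of "x - d/2" x] d by auto
    have "q x - e < q (x - d/2)" using d(2)[of "x - d/2"] d(1) by auto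
    also have "\<dots> \<le> L z" using qL z by auto
    finally have Lz: "q x - e < L z" .
    have "\<forall>\<^sub>F n in sequentially. p (r n) y < q x + e" using order_tendstoD(2)[OF L[OF y(1)] y(3)] .
    moreover have "\<forall>\<^sub>F n in sequentially. p (r n) z > q x - e" using order_tendstoD(1)[OF L[OF z(1)] Lz] .
    ultimately have "\<forall>\<^sub>F n in sequentially. norm (p (r n) x - q x) < e"
    proof eventually_elim
      case (elim n)
      moreover have "p (r n) z \<le> p (r n) x" "p (r n) x \<le> p (r n) y"
        using monoD[OF mono, of z x "r n"] monoD[OF mono, of x y "r n"] y z by auto
      ultimately show ?case by auto
    qed
    thus "\<exists>no. \<forall>n\<ge>no. norm (p (r n) x - q x) < e" by (simp add: eventually_sequentially)
  qed
  have "countable {x. \<not> (\<lambda>n. p (r n) x) \<longlonglongrightarrow> q x}"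
    using lim by (intro countable_subset[OF _ mono_ctble_discont[OF mq]]) auto
  thus ?thesis using that r mq by blast
qed

text \<open>
  Weak sequential compactness of the order interval between \<open>0\<close> and \<open>M\<close>. Uniform boundedness turns
  convergence on rational half-lines into convergence on all half-lines, and the Borel sets with a
  convergent integral form a Dynkin system, countable unions being covered by Tannery's theorem.
  The limits form a measure dominated by \<open>M\<close> times Lebesgue measure; its Radon-Nikodym derivative is
  the limit density.
\<close>

lemma bounded_densities_subsequence:
  fixes h :: "nat \<Rightarrow> real \<Rightarrow> real" and M :: real
  assumes meas: "\<And>n. h n \<in> borel_measurable borel"
    and bd: "\<And>n x. 0 \<le> h n x \<and> h n x \<le> M * indicator {0..1} x"
  obtains r \<rho> where "strict_mono (r :: nat \<Rightarrow> nat)" "\<rho> \<in> borel_measurable borel"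
    "\<And>x. 0 \<le> \<rho> x \<and> \<rho> x \<le> M * indicator {0..1} x"
    "\<And>A. A \<in> sets borel \<Longrightarrow> (\<lambda>n. LINT x:A|lborel. h (r n) x) \<longlonglongrightarrow> (LINT x:A|lborel. \<rho> x)"
proof -
  have M0: "M \<ge> 0" using bd[of 0 0] by simp
  have ind: "integrable lborel (\<lambda>x::real. M * indicator {0..1} x :: real)"
    by (intro integrable_mult_right integrable_real_indicator) auto
  have int: "integrable lborel (h n)" for n
    using meas bd by (intro Bochner_Integration.integrable_bound[OF ind]) (auto simp: abs_of_nonneg M0)
  note sint = set_integrable_of_integrable[OF int]
  define F where "F n A = (LINT x:A|lborel. h n x)" for n A
  define u where "u A = M * measure lborel (A \<inter> {0..1})" for A :: "real set"
  have F0: "0 \<le> F n A" for n A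
    unfolding F_def set_lebesgue_integral_def using bd by (intro integral_nonneg_AE) (auto simp: indicator_def)
  have Fu: "F n A \<le> u A" if A: "A \<in> sets borel" for n A
  proof -
    have "F n A \<le> (LINT x:A|lborel. M * indicator {0..1} x)"
      unfolding F_def using bd A by (intro set_integral_mono sint set_integrable_of_integrable[OF ind]) auto
    also have "\<dots> = (LINT x|lborel. M * indicator (A \<inter> {0..1}) x)"
      unfolding set_lebesgue_integral_def by (intro Bochner_Integration.integral_cong) (auto simp: indicator_def)
    finally show ?thesis by (simp add: u_def)
  qed
  have un: "norm (F n A) \<le> u UNIV" if "A \<in> sets borel" for n A
  proof -
    have "u A \<le> u UNIV" unfolding u_def using M0 that
      by (intro mult_left_mono measure_mono_fmeasurable) (auto simp: fmeasurable_def)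
    thus ?thesis using F0[of n A] Fu[OF that, of n] by simp
  qed
  have diff: "F n (A \<union> B) = F n A + F n B" if "A \<in> sets borel" "B \<in> sets borel" "A \<inter> B = {}" for n A B
    unfolding F_def using that by (intro set_integral_Un sint) auto
  obtain r where r: "strict_mono (r :: nat \<Rightarrow> nat)"
    and rat: "\<And>x. x \<in> \<rat> \<Longrightarrow> \<exists>l. (\<lambda>n. F (r n) {..x}) \<longlonglongrightarrow> l"
    using function_convergent_subsequence[of "\<rat>" "\<lambda>n x. F n {..x}" "u UNIV"] un countable_rat by auto
  define P where "P A \<longleftrightarrow> convergent (\<lambda>n. F (r n) A)" for A
  have basic: "P {..x}" for x
    unfolding P_def
  proof (rule real_Cauchy_convergent, rule metric_CauchyI)
    fix e :: real assume e: "e > 0"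
    \<comment> \<open>moving the end of a half-line by \<open>t\<close> changes the integrals by at most \<open>e / 4\<close>\<close>
    define t where "t = e / (4 * (M + 1))"
    have t: "t > 0" using e M0 by (simp add: t_def)
    obtain y where y: "y \<in> \<rat>" "x < y" "y < x + t" using Rats_dense_in_real[of x "x + t"] t by auto
    have near: "\<bar>F n {..x} - F n {..y}\<bar> \<le> e / 4" for n
    proof -
      have "F n {..y} = F n {..x} + F n {x<..y}" using y by (subst diff[symmetric]) (auto intro!: arg_cong[of _ _ "F n"])
      moreover have "F n {x<..y} \<le> u {x<..y}" by (intro Fu) auto
      moreover have "measure lborel ({x<..y} \<inter> {0..1}) \<le> measure lborel {x<..y}"
        using y by (intro measure_mono_fmeasurable) (auto simp: fmeasurable_def)
      hence "u {x<..y} \<le> M * (y - x)" using y M0 unfolding u_def by (intro mult_left_mono) auto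
      moreover have "M * (y - x) \<le> M * t" using y M0 by (intro mult_left_mono) auto
      moreover have "M * t \<le> e / 4" using M0 e unfolding t_def by (simp add: field_simps)
      ultimately show ?thesis using F0[of n "{x<..y}"] by auto
    qed
    have "Cauchy (\<lambda>n. F (r n) {..y})" using rat[OF y(1)] LIMSEQ_imp_Cauchy by auto
    then obtain N where N: "\<And>m n. m \<ge> N \<Longrightarrow> n \<ge> N \<Longrightarrow> dist (F (r m) {..y}) (F (r n) {..y}) < e / 4"
      using e unfolding Cauchy_def by (metis zero_less_divide_iff zero_less_numeral)
    have "dist (F (r m) {..x}) (F (r n) {..x}) < e" if "m \<ge> N" "n \<ge> N" for m n
      using N[OF that] near[of "r m"] near[of "r n"] e unfolding dist_real_def by linarith
    thus "\<exists>N. \<forall>m\<ge>N. \<forall>n\<ge>N. dist (F (r m) {..x}) (F (r n) {..x}) < e" by blast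
  qed
  have Uni: "P UNIV"
  proof -
    have "F n UNIV = F n {..1}" for n
      unfolding F_def set_lebesgue_integral_def using bd
      by (intro Bochner_Integration.integral_cong refl)
        (smt (verit, best) indicator_simps(1,2) atLeastAtMost_iff atMost_iff UNIV_I mult_zero_right scaleR_simps(1) mult_cancel_right1 real_scaleR_def)
    thus ?thesis using basic[of 1] by (simp add: P_def)
  qed
  \<comment> \<open>\<open>u\<close> is the dominating series for Tannery's theorem\<close>
  have Fsums: "(\<lambda>i. F n (A i)) sums F n (\<Union>i. A i)" and usum: "summable (\<lambda>i. u (A i))"
    if A: "disjoint_family A" "range A \<subseteq> sets borel" for A :: "nat \<Rightarrow> _" and n
  proof -
    have Am: "A i \<in> sets borel" for i using A(2) by auto
    have sums: "(\<lambda>i. LINT x:A i|lborel. f x) sums (LINT x:(\<Union>i. A i)|lborel. f x)"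
      if f: "integrable lborel f" "\<And>x. f x \<ge> 0" for f :: "real \<Rightarrow> real"
    proof -
      have "(\<Sum>i<n. LINT x:A i|lborel. f x) = (LINT x:(\<Union>i<n. A i)|lborel. f x)" for n
        using A Am f by (intro set_integral_finite_Union[symmetric] set_integrable_of_integrable)
          (auto simp: disjoint_family_on_def)
      moreover have "(\<lambda>n. LINT x:(\<Union>i<n. A i)|lborel. f x) \<longlonglongrightarrow> (LINT x:(\<Union>n. \<Union>i<n. A i)|lborel. f x)"
        using Am f by (intro set_integral_cont_up set_integrable_of_integrable) (auto simp: incseq_def, force)
      moreover have "(\<Union>n. \<Union>i<n. A i) = (\<Union>i. A i)" by auto
      ultimately show ?thesis by (simp add: sums_def)
    qed
    show "(\<lambda>i. F n (A i)) sums F n (\<Union>i. A i)" unfolding F_def using sums[OF int] bd by auto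
    have "(\<lambda>i. LINT x:A i|lborel. M * indicator {0..1} x) sums (LINT x:(\<Union>i. A i)|lborel. M * indicator {0..1} x)"
      using M0 by (intro sums[OF ind]) auto
    moreover have "(LINT x:B|lborel. M * indicator {0..1} x) = u B" if "B \<in> sets borel" for B
    proof -
      have "(LINT x:B|lborel. M * indicator {0..1} x) = (LINT x|lborel. M * indicator (B \<inter> {0..1}) x)"
        unfolding set_lebesgue_integral_def by (intro Bochner_Integration.integral_cong) (auto simp: indicator_def)
      thus ?thesis by (simp add: u_def)
    qed
    ultimately show "summable (\<lambda>i. u (A i))" using Am by (simp only: sums_iff)
  qed
  define G where "G A = lim (\<lambda>n. F (r n) A)" for A
  have PG: "(\<lambda>n. F (r n) A) \<longlonglongrightarrow> G A" if "P A" for A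
    using that by (simp add: P_def G_def convergent_LIMSEQ_iff)
  have unions: "P (\<Union>i. A i) \<and> (\<lambda>i. G (A i)) sums G (\<Union>i. A i)"
    if A: "disjoint_family A" "range A \<subseteq> sets borel" "\<And>i. P (A i)" for A :: "nat \<Rightarrow> _"
  proof -
    have "norm (F (r n) (A k)) \<le> u (A k)" for n k using Fu[of "A k" "r n"] F0[of "r n" "A k"] A(2) by auto
    hence ev: "\<forall>\<^sub>F (k, n) in sequentially \<times>\<^sub>F sequentially. norm (F (r n) (A k)) \<le> u (A k)"
      by (intro always_eventually) auto
    have "\<forall>\<^sub>F n in sequentially. summable (\<lambda>k. norm (F (r n) (A k)))"
      "summable (\<lambda>i. norm (G (A i)))" "((\<lambda>n. \<Sum>i. F (r n) (A i)) \<longlonglongrightarrow> (\<Sum>i. G (A i)))"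
      using tannerys_theorem[of "\<lambda>i n. F (r n) (A i)" "\<lambda>i. G (A i)" sequentially "\<lambda>i. u (A i)"]
        PG[OF A(3)] usum[OF A(1,2)] ev by auto
    moreover have "(\<Sum>i. F (r n) (A i)) = F (r n) (\<Union>i. A i)" for n
      using Fsums[OF A(1,2)] by (simp add: sums_iff)
    ultimately have *: "(\<lambda>n. F (r n) (\<Union>i. A i)) \<longlonglongrightarrow> (\<Sum>i. G (A i))" "summable (\<lambda>i. G (A i))"
      by (auto intro: summable_norm_cancel)
    thus ?thesis using limI[OF *(1)] by (auto simp: P_def G_def convergent_def sums_iff)
  qed
  have bor: "sets borel = sigma_sets UNIV (range (atMost :: real \<Rightarrow> _))"
    by (subst borel_eq_atMost) (simp add: sets_measure_of)
  have P: "P A" if "A \<in> sets borel" for A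
  proof -
    have "Int_stable (range (atMost :: real \<Rightarrow> _))" by (auto simp: Int_stable_def)
    moreover have "range (atMost :: real \<Rightarrow> _) \<subseteq> Pow UNIV" by auto
    moreover have "A \<in> sigma_sets UNIV (range atMost)" using that bor by simp
    ultimately show ?thesis
    proof (induction rule: sigma_sets_induct_disjoint)
      case (basic A) thus ?case using \<open>\<And>x. P {..x}\<close> by auto
    next
      case empty show ?case by (simp add: P_def F_def set_lebesgue_integral_def convergent_const)
    next
      case (compl A)
      have "F n (UNIV - A) = F n UNIV - F n A" for n
        using compl(1) diff[of A "UNIV - A" n] by (simp add: bor[symmetric] Un_Diff)
      thus ?case using compl(2) Uni by (simp add: P_def convergent_diff)
    next
      case (union A)
      thus ?case using unions[of A] by (simp add: bor[symmetric])
    qed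
  qed
  have G0: "0 \<le> G A" and Gu: "G A \<le> u A" if "A \<in> sets borel" for A
    using tendsto_lowerbound[OF PG[OF P[OF that]], of 0] tendsto_upperbound[OF PG[OF P[OF that]], of "u A"]
      F0 Fu[OF that] by auto
  define N where "N = measure_of UNIV (sets borel) (\<lambda>A. ennreal (G A))"
  have sN[simp]: "sets N = sets borel" "space N = UNIV"
    using sets.sigma_sets_eq[of "borel :: real measure"] by (auto simp: N_def sets_measure_of_conv)
  have eN: "emeasure N A = ennreal (G A)" if "A \<in> sets borel" for A
    unfolding N_def
  proof (rule emeasure_measure_of_sigma)
    show "sigma_algebra UNIV (sets borel :: real set set)" using sets.sigma_algebra_axioms[of "borel :: real measure"] by simp
    show "positive (sets borel) (\<lambda>A. ennreal (G A))" by (auto simp: positive_def G_def F_def set_lebesgue_integral_def)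
    show "countably_additive (sets borel) (\<lambda>A. ennreal (G A))"
    proof (rule countably_additiveI)
      fix A :: "nat \<Rightarrow> real set" assume A: "range A \<subseteq> sets borel" "disjoint_family A" "(\<Union>i. A i) \<in> sets borel"
      have "(\<lambda>i. G (A i)) sums G (\<Union>i. A i)" using unions[OF A(2,1)] P A by auto
      thus "(\<Sum>i. ennreal (G (A i))) = ennreal (G (\<Union>i. A i))"
        using A G0 by (subst suminf_ennreal2) (auto simp: sums_iff)
    qed
  qed (use that in auto)
  have "absolutely_continuous lborel N"
  proof (unfold absolutely_continuous_def, rule subsetI)
    fix A :: "real set" assume A: "A \<in> null_sets lborel"
    have "emeasure lborel (A \<inter> {0..1}) = 0" using A by (intro null_setsD1 null_set_Int2) auto
    hence "u A = 0" by (simp add: u_def measure_def)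
    hence "G A = 0" using G0[of A] Gu[of A] A by auto
    thus "A \<in> null_sets N" using A eN[of A] by (auto simp: null_sets_def)
  qed
  then obtain f where f: "f \<in> borel_measurable lborel" "density lborel f = N"
    using sigma_finite_measure.Radon_Nikodym[OF sigma_finite_lborel, of N] by auto
  have fN: "(\<integral>\<^sup>+x\<in>A. f x \<partial>lborel) = ennreal (G A)" if "A \<in> sets borel" for A
    using emeasure_density[OF f(1), of A] eN[OF that] f(2) that by simp
  have "AE x in lborel. f x \<noteq> \<infinity>"
    using fN[of UNIV] f by (intro nn_integral_noteq_infinite) auto
  define g where "g x = enn2real (f x)" for x
  have fg: "AE x in lborel. f x = ennreal (g x)"
    using \<open>AE x in lborel. f x \<noteq> \<infinity>\<close> by (auto simp: g_def less_top elim!: eventually_mono)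
  have gm[measurable]: "g \<in> borel_measurable borel" using f(1) unfolding g_def by simp
  have g0: "g x \<ge> 0" for x by (simp add: g_def)
  have gN: "(\<integral>\<^sup>+x. ennreal (indicator A x * g x) \<partial>lborel) = ennreal (G A)" if "A \<in> sets borel" for A
    by (subst fN[OF that, symmetric], rule nn_integral_cong_AE) (use fg in \<open>auto elim!: eventually_mono split: split_indicator\<close>)
  have gi: "integrable lborel g"
    using gN[of UNIV] g0 by (intro integrableI_nonneg) auto
  have gI: "(LINT x:A|lborel. g x) = G A" if "A \<in> sets borel" for A
    unfolding set_lebesgue_integral_def using gN[OF that] G0[OF that] g0 that
    by (subst integral_eq_nn_integral) auto
  have bound: "AE x in lborel. g x \<in> {0..M}"
  proof (rule sigma_finite_measure.averaging_theorem[OF sigma_finite_lborel gi])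
    fix A :: "real set" assume A: "A \<in> sets lborel" "measure lborel A > 0"
    have fin: "A \<in> fmeasurable lborel"
      using A by (intro fmeasurableI) (auto simp: measure_def top.not_eq_extremum enn2real_positive_iff)
    have "measure lborel (A \<inter> {0..1}) \<le> measure lborel A"
      using fin by (intro measure_mono_fmeasurable) auto
    hence "u A \<le> M * measure lborel A" unfolding u_def using M0 by (intro mult_left_mono) auto
    thus "(1 / measure lborel A) *\<^sub>R (LINT x:A|lborel. g x) \<in> {0..M}"
      using gI[of A] G0[of A] Gu[of A] A by (simp add: divide_simps mult.commute)
  qed auto
  have supp: "AE x in lborel. x \<notin> {0..1} \<longrightarrow> g x = 0"
  proof -
    have "u (-{0..1}) = 0" by (simp add: u_def)
    hence "G (-{0..1}) = 0" using Gu[of "-{0..1}"] G0[of "-{0..1}"] by auto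
    hence "AE x in lborel. ennreal (indicator (-{0..1}) x * g x) = 0"
      using gN[of "-{0..1}"] by (subst nn_integral_0_iff_AE[symmetric]) auto
    thus ?thesis using g0 by (auto elim!: eventually_mono simp: ennreal_eq_0_iff indicator_def split: if_splits)
       (smt (verit, ccfv_threshold) g0)+
  qed
  define \<rho> where "\<rho> x = min M (g x) * indicator {0..1} x" for x
  have ae: "AE x in lborel. \<rho> x = g x"
    using bound supp by eventually_elim (auto simp: \<rho>_def indicator_def)
  have \<rho>m[measurable]: "\<rho> \<in> borel_measurable borel" unfolding \<rho>_def by measurable
  have \<rho>b: "0 \<le> \<rho> x \<and> \<rho> x \<le> M * indicator {0..1} x" for x
    using g0[of x] M0 by (auto simp: \<rho>_def indicator_def)
  have "(LINT x:A|lborel. \<rho> x) = G A" if "A \<in> sets borel" for A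
    unfolding gI[OF that, symmetric] using ae that by (intro set_lebesgue_integral_cong_AE) auto
  thus ?thesis using that[OF r \<rho>m \<rho>b] PG[OF P] by (simp add: F_def)
qed

section \<open>Expanding branches and distortion\<close>

lemma open_connected_bounded_real:
  fixes S :: "real set"
  assumes "open S" "connected S" "bounded S" "S \<noteq> {}"
  obtains c d where "S = {c<..<d}" "c < d"
proof -
  have bb: "bdd_above S" "bdd_below S"
    using assms(3) by (auto simp: bounded_imp_bdd_above bounded_imp_bdd_below)
  have "S = {Inf S<..<Sup S}"
  proof (intro set_eqI iffI)
    fix x assume x: "x \<in> S"
    then obtain e where e: "e > 0" "ball x e \<subseteq> S" using assms(1) open_contains_ball by blast
    have "x - e/2 \<in> S" "x + e/2 \<in> S" using e by (auto simp: subset_iff dist_real_def)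
    hence "Inf S \<le> x - e/2" "x + e/2 \<le> Sup S" using bb by (auto intro: cInf_lower cSup_upper)
    thus "x \<in> {Inf S<..<Sup S}" using e by auto
  next
    fix x assume "x \<in> {Inf S<..<Sup S}"
    then obtain y z where "y \<in> S" "y < x" "z \<in> S" "x < z"
      using bb assms(4) by (auto simp: less_cSup_iff cInf_less_iff)
    thus "x \<in> S" using connectedD_interval[OF assms(2), of y z x] by simp
  qed
  thus ?thesis using that[of "Inf S" "Sup S"] assms(4) by (metis greaterThanLessThan_empty_iff2 linorder_not_le
        greaterThanLessThan_empty)
qed

lemma set_integral_restrict:
  fixes g :: "real \<Rightarrow> real"
  shows "(LINT x:A|lborel. indicator J x * g x) = (LINT x:A \<inter> J|lborel. g x)"
  unfolding set_lebesgue_integral_def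
  by (intro Bochner_Integration.integral_cong) (auto simp: indicator_def)

lemma set_integral_finite_difference:
  fixes g :: "real \<Rightarrow> real"
  assumes "finite (A - B)" "finite (B - A)"
  shows "(LINT x:A|lborel. g x) = (LINT x:B|lborel. g x)"
  unfolding set_lebesgue_integral_def
  by (rule integral_discrete_difference[where X = "(A - B) \<union> (B - A)"])
    (use assms in \<open>auto simp: countable_finite split: split_indicator\<close>)

text \<open>
  \<open>Q\<close> consists of the interiors of the partition intervals of \<open>I\<close>: endpoints carry no mass, and on open
  intervals the derivative is two-sided.
\<close>

locale holed_map =
  fixes T dT :: "real \<Rightarrow> real" and I :: "real set" and Q :: "real set set"
    and \<alpha> Ch \<mu> \<delta> :: real
  assumes alpha_pos: "\<alpha> > 0" and Ch_pos: "Ch > 0" and mu_gt: "\<mu> > 2" and delta_pos: "\<delta> > 0"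
    and Q_finite: "finite Q" and Q_nonempty: "Q \<noteq> {}" and Q_disjoint: "disjoint Q"
    and Q_interval: "\<And>q. q \<in> Q \<Longrightarrow> \<exists>a b. q = {a<..<b} \<and> \<delta> \<le> b - a"
    and Q_subset: "\<Union>Q \<subseteq> I" and I_minus_Q: "finite (I - \<Union>Q)" and I_subset: "I \<subseteq> {0..1}"
    and T_range: "\<And>x. x \<in> I \<Longrightarrow> T x \<in> {0..1}"
    and T_deriv: "\<And>q x. q \<in> Q \<Longrightarrow> x \<in> q \<Longrightarrow> (T has_real_derivative dT x) (at x)"
    and T_expanding: "\<And>q x. q \<in> Q \<Longrightarrow> x \<in> q \<Longrightarrow> \<bar>dT x\<bar> \<ge> \<mu>"
    and dT_Hoelder: "\<And>q x y. q \<in> Q \<Longrightarrow> x \<in> q \<Longrightarrow> y \<in> q \<Longrightarrow> \<bar>dT x - dT y\<bar> \<le> Ch * \<bar>x - y\<bar> powr \<alpha>"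
begin

text \<open>
  The Hoelder constant of logarithms of densities that is reproduced by the transfer operator, see
  \<open>A_fixpoint\<close>.
\<close>

definition A where "A = Ch / (\<mu> * (\<mu> powr \<alpha> - 1))"

definition C where "C = (exp A - 1) * (2 * \<delta>) powr \<alpha>"

lemma mu_powr: "\<mu> powr \<alpha> > 1"
  using mu_gt alpha_pos by (simp add: gr_one_powr)

lemma A_pos: "A > 0"
  using mu_powr mu_gt Ch_pos by (simp add: A_def)

lemma A_fixpoint: "(A + Ch / \<mu>) / \<mu> powr \<alpha> = A"
proof -
  have "A + Ch / \<mu> = A * \<mu> powr \<alpha>"
  proof -
    have "Ch = A * (\<mu> * (\<mu> powr \<alpha> - 1))" using mu_powr mu_gt unfolding A_def by auto
    hence "Ch / \<mu> = A * (\<mu> powr \<alpha> - 1)" using mu_gt by (auto simp: field_simps)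
    thus ?thesis by (simp add: algebra_simps)
  qed
  moreover have "\<mu> powr \<alpha> \<noteq> 0" using mu_powr by linarith
  ultimately show ?thesis by (metis nonzero_mult_div_cancel_right)
qed

lemma C_nonneg: "C \<ge> 0"
  using A_pos by (simp add: C_def)

lemma Q_open: "q \<in> Q \<Longrightarrow> open q"
  using Q_interval by fastforce

lemma Q_01: "q \<in> Q \<Longrightarrow> q \<subseteq> {0..1}"
  using Q_subset I_subset by blast

lemma T_cont: "q \<in> Q \<Longrightarrow> continuous_on q T"
  using T_deriv by (meson has_field_derivative_at_within has_field_derivative_imp_has_derivative
      has_derivative_continuous_on has_field_derivative_def)

lemma I_borel: "I \<in> sets borel"
proof -
  have "I = \<Union>Q \<union> (I - \<Union>Q)" using Q_subset by auto
  moreover have "\<Union>Q \<in> sets borel" using Q_open by (intro borel_open open_Union) auto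
  moreover have "I - \<Union>Q \<in> sets borel" using I_minus_Q by (intro borel_closed finite_imp_closed)
  ultimately show ?thesis by (metis sets.Un)
qed

lemma branch_vimage_borel:
  assumes "q \<in> Q" "B \<in> sets borel" shows "q \<inter> T -` B \<in> sets borel"
proof -
  have "T \<in> borel_measurable (restrict_space borel q)"
    by (intro borel_measurable_continuous_on_restrict T_cont assms)
  hence "T -` B \<inter> space (restrict_space borel q) \<in> sets (restrict_space borel q)"
    using assms(2) by (rule measurable_sets)
  thus ?thesis using Q_open[OF assms(1)]
    by (auto simp: sets_restrict_space_iff space_restrict_space Int_commute)
qed

lemma vimage_borel:
  assumes "B \<in> sets borel" shows "I \<inter> T -` B \<in> sets borel"
proof -
  have "I \<inter> T -` B = (\<Union>q\<in>Q. q \<inter> T -` B) \<union> ((I - \<Union>Q) \<inter> T -` B)" using Q_subset by auto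
  moreover have "(\<Union>q\<in>Q. q \<inter> T -` B) \<in> sets borel"
    using Q_finite branch_vimage_borel assms by (intro sets.finite_UN) auto
  moreover have "(I - \<Union>Q) \<inter> T -` B \<in> sets borel"
    using I_minus_Q by (intro borel_closed finite_imp_closed) auto
  ultimately show ?thesis by (metis sets.Un)
qed

lemma T_mvt:
  assumes "q \<in> Q" "x \<in> q" "y \<in> q"
  obtains \<xi> where "\<xi> \<in> q" "T y - T x = dT \<xi> * (y - x)"
proof -
  have *: "\<exists>\<xi>. \<xi> \<in> q \<and> T y - T x = dT \<xi> * (y - x)" if xy: "x < y" "x \<in> q" "y \<in> q" for x y
  proof -
    have sub: "{x..y} \<subseteq> q" using Q_interval[OF assms(1)] xy by auto
    have "\<exists>z>x. z < y \<and> T y - T x = (y - x) * dT z"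
      using sub by (intro MVT2 xy T_deriv[OF assms(1)]) auto
    thus ?thesis using sub by (metis atLeastAtMost_iff less_imp_le mult.commute subsetD)
  qed
  consider "x < y" | "x = y" | "y < x" by linarith
  thus ?thesis
  proof cases
    case 1 thus ?thesis using *[OF 1 assms(2,3)] that by blast
  next
    case 2 thus ?thesis using that[of x] assms by simp
  next
    case 3
    then obtain \<xi> where "\<xi> \<in> q" "T x - T y = dT \<xi> * (x - y)" using *[OF 3 assms(3,2)] by blast
    thus ?thesis using that[of \<xi>] by (simp add: algebra_simps)
  qed
qed

lemma T_expands: "q \<in> Q \<Longrightarrow> x \<in> q \<Longrightarrow> y \<in> q \<Longrightarrow> \<mu> * \<bar>x - y\<bar> \<le> \<bar>T x - T y\<bar>"
proof -
  assume q: "q \<in> Q" "x \<in> q" "y \<in> q"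
  obtain \<xi> where "\<xi> \<in> q" "T x - T y = dT \<xi> * (x - y)" using T_mvt[OF q(1,3,2)] .
  thus ?thesis using T_expanding[OF q(1)] by (simp add: abs_mult mult_right_mono)
qed

lemma T_inj: "q \<in> Q \<Longrightarrow> inj_on T q"
  using T_expands mu_gt by (intro inj_onI) (smt (verit) mult_pos_pos)

text \<open>
  A continuous injection is open, so the image of an open interval inside a branch is again an open
  interval; the expansion bound is applied to points close to the two ends.
\<close>

lemma T_image_interval:
  assumes q: "q \<in> Q" and ab: "{a<..<b} \<subseteq> q" "a < b"
  obtains c d where "T ` {a<..<b} = {c<..<d}" "0 \<le> c" "c < d" "d \<le> 1" "\<mu> * (b - a) \<le> d - c"
proof -
  let ?J = "{a<..<b}"
  have cont: "continuous_on ?J T" using T_cont[OF q] ab(1) by (rule continuous_on_subset)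
  have inj: "inj_on T ?J" using T_inj[OF q] ab(1) by (rule inj_on_subset)
  have sub: "T ` ?J \<subseteq> {0..1}" using ab(1) q Q_subset T_range by blast
  obtain c d where cd: "T ` ?J = {c<..<d}" "c < d"
  proof (rule open_connected_bounded_real[of "T ` ?J"])
    show "open (T ` ?J)" using cont inj by (intro invariance_of_domain) auto
    show "connected (T ` ?J)" using cont by (intro connected_continuous_image) auto
    show "bounded (T ` ?J)" using sub by (rule bounded_subset[OF bounded_closed_interval])
    show "T ` ?J \<noteq> {}" using ab by auto
  qed
  have "{c<..<d} \<subseteq> {0..1}" using sub cd by auto
  hence "0 \<le> c" "d \<le> 1" using cd(2) by (auto simp: greaterThanLessThan_subseteq_atLeastAtMost_iff)
  moreover have "\<mu> * (b - a) \<le> d - c"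
  proof (rule ccontr)
    assume n: "\<not> ?thesis"
    \<comment> \<open>two points at distance \<open>e\<close> from the ends would have images too far apart\<close>
    define k where "k = (d - c) / \<mu>"
    define e where "e = (b - a - k) / 3"
    have e: "e > 0" using n mu_gt by (simp add: e_def k_def field_simps)
    have "k > 0" using cd(2) mu_gt by (simp add: k_def)
    hence "e < (b - a) / 2" using ab(2) unfolding e_def by (simp add: field_simps)
    hence x: "a + e \<in> ?J" "b - e \<in> ?J" using e by auto
    have "\<mu> * \<bar>(b - e) - (a + e)\<bar> \<le> \<bar>T (b - e) - T (a + e)\<bar>"
      using x ab by (intro T_expands[OF q]) auto
    moreover have "T (b - e) \<in> {c<..<d}" "T (a + e) \<in> {c<..<d}" using x cd(1) by blast+
    hence "\<bar>T (b - e) - T (a + e)\<bar> \<le> d - c" by auto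
    ultimately have "\<mu> * \<bar>(b - e) - (a + e)\<bar> \<le> d - c" by linarith
    hence "\<bar>(b - e) - (a + e)\<bar> \<le> k" using mu_gt by (simp add: k_def field_simps)
    hence "b - a - 2 * e \<le> k" by linarith
    thus False using e unfolding e_def by (simp add: field_simps)
  qed
  ultimately show ?thesis using that cd by blast
qed

text \<open>
  Hoelder continuity of \<open>ln g\<close> with constant \<open>A\<close>, multiplied out so that \<open>g\<close> may vanish.
\<close>

definition regular :: "real set \<Rightarrow> (real \<Rightarrow> real) \<Rightarrow> bool" where
  "regular J g \<longleftrightarrow> (\<forall>x\<in>J. \<forall>y\<in>J. 0 \<le> g x \<and> g x \<le> g y * exp (A * \<bar>x - y\<bar> powr \<alpha>))"

lemma regular_subset: "regular J g \<Longrightarrow> K \<subseteq> J \<Longrightarrow> regular K g"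
  unfolding regular_def by blast

lemma regular_continuous:
  assumes "regular J g" shows "continuous_on J g"
  unfolding continuous_on_def
proof (intro ballI)
  fix y assume y: "y \<in> J"
  have p: "((\<lambda>x. \<bar>x - y\<bar> powr \<alpha>) \<longlongrightarrow> 0) (at y within J)"
    by (rule tendsto_zero_powrI[where b = \<alpha>])
      (use alpha_pos in \<open>auto intro!: tendsto_eq_intros simp: tendsto_rabs_zero_iff\<close>)
  show "(g \<longlongrightarrow> g y) (at y within J)"
  proof (rule tendsto_sandwich)
    show "\<forall>\<^sub>F x in at y within J. g y * exp (- (A * \<bar>x - y\<bar> powr \<alpha>)) \<le> g x"
      using assms y unfolding regular_def eventually_at_filter
      by (intro always_eventually) (simp add: exp_minus field_simps abs_minus_commute[of _ y])
    show "\<forall>\<^sub>F x in at y within J. g x \<le> g y * exp (A * \<bar>x - y\<bar> powr \<alpha>)"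
      using assms y unfolding regular_def eventually_at_filter by (intro always_eventually) simp
    show "((\<lambda>x. g y * exp (- (A * \<bar>x - y\<bar> powr \<alpha>))) \<longlongrightarrow> g y) (at y within J)"
      by (rule tendsto_eq_intros p refl)+ simp
    show "((\<lambda>x. g y * exp (A * \<bar>x - y\<bar> powr \<alpha>)) \<longlongrightarrow> g y) (at y within J)"
      by (rule tendsto_eq_intros p refl)+ simp
  qed
qed

lemma regular_measurable:
  assumes "regular {a<..<b} g"
  shows "(\<lambda>x. indicator {a<..<b} x * g x) \<in> borel_measurable borel"
  using borel_measurable_continuous_on_indicator[OF _ regular_continuous[OF assms]] by simp

lemma regular_integrable:
  assumes "regular {a<..<b} g" "\<And>x. x \<in> {a<..<b} \<Longrightarrow> g x \<le> \<sigma>"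
  shows "set_integrable lborel {a<..<b} g"
  unfolding set_integrable_def
proof (rule Bochner_Integration.integrable_bound)
  show "integrable lborel (\<lambda>x. \<sigma> * indicator {a<..<b} x)"
    by (intro integrable_mult_right integrable_real_indicator) (use emeasure_bounded_finite[of "{a<..<b}"] in simp_all)
  show "(\<lambda>x. indicator {a<..<b} x *\<^sub>R g x) \<in> borel_measurable lborel"
    using regular_measurable[OF assms(1)] by simp
  show "AE x in lborel. norm (indicator {a<..<b} x *\<^sub>R g x) \<le> norm (\<sigma> * indicator {a<..<b} x)"
  proof (rule AE_I2)
    fix x show "norm (indicator {a<..<b} x *\<^sub>R g x) \<le> norm (\<sigma> * indicator {a<..<b} x)"
      using assms unfolding regular_def by (force simp: indicator_def)
  qed
qed

text \<open>
  Convexity of \<open>exp\<close> on \<open>[0, A]\<close>; this is where \<open>C\<close> gets the form \<open>(exp A - 1) * (2 * \<delta>) powr \<alpha>\<close>.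
\<close>

lemma exp_distortion:
  assumes "0 \<le> t" "t \<le> 2 * \<delta>" "2 * \<delta> \<le> 1"
  shows "exp (A * t powr \<alpha>) \<le> 1 + C"
proof -
  define u where "u = t powr \<alpha>"
  have u: "0 \<le> u" "u \<le> (2 * \<delta>) powr \<alpha>"
    using assms alpha_pos by (auto simp: u_def intro: powr_mono2)
  have u1: "u \<le> 1" using u(2) assms alpha_pos delta_pos powr_le1[of \<alpha> "2 * \<delta>"] by simp
  have "exp ((1 - u) *\<^sub>R 0 + u *\<^sub>R A) \<le> (1 - u) * exp 0 + u * exp A"
    using exp_convex u u1 by (intro convex_onD[of UNIV]) auto
  hence "exp (A * u) \<le> 1 + u * (exp A - 1)" by (simp add: algebra_simps)
  also have "\<dots> \<le> 1 + C" using u(2) A_pos unfolding C_def by (simp add: mult.commute)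
  finally show ?thesis by (simp add: u_def)
qed

text \<open>
  A branch has length at least \<open>\<delta>\<close> and an image of length at most \<open>1\<close>.
\<close>

lemma delta_small: "\<mu> * \<delta> \<le> 1" "2 * \<delta> \<le> 1"
proof -
  obtain q where q: "q \<in> Q" using Q_nonempty by auto
  then obtain a b where ab: "q = {a<..<b}" "\<delta> \<le> b - a" using Q_interval by blast
  obtain c d where "0 \<le> c" "d \<le> 1" "\<mu> * (b - a) \<le> d - c"
    by (rule T_image_interval[OF q, of a b]) (use ab delta_pos in auto)
  moreover have "\<mu> * \<delta> \<le> \<mu> * (b - a)" using ab mu_gt by simp
  ultimately show "\<mu> * \<delta> \<le> 1" by linarith
  moreover have "2 * \<delta> \<le> \<mu> * \<delta>" using mu_gt delta_pos by simp
  ultimately show "2 * \<delta> \<le> 1" by linarith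
qed

lemma regular_comparable:
  assumes "regular {a<..<b} g" "b - a \<le> 2 * \<delta>" "x \<in> {a<..<b}" "y \<in> {a<..<b}"
  shows "g x \<le> (1 + C) * g y"
proof -
  have "g x \<le> g y * exp (A * \<bar>x - y\<bar> powr \<alpha>)" "0 \<le> g y" using assms unfolding regular_def by auto
  moreover have "exp (A * \<bar>x - y\<bar> powr \<alpha>) \<le> 1 + C"
    using assms delta_small by (intro exp_distortion) auto
  ultimately show ?thesis by (smt (verit) mult_left_mono mult.commute)
qed

text \<open>
  On an interval of length at most \<open>2 * \<delta>\<close> all values of a regular function agree up to the factor
  \<open>1 + C\<close>, hence agree with the mean up to that factor.
\<close>

lemma regular_sup_le_mean:
  assumes r: "regular {a<..<b} g" "b - a \<le> 2 * \<delta>" and x: "x \<in> {a<..<b}"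
  shows "g x * (b - a) \<le> (1 + C) * (LINT y:{a<..<b}|lborel. g y)"
    and "(LINT y:{a<..<b}|lborel. g y) \<le> (1 + C) * g x * (b - a)"
proof -
  have int: "set_integrable lborel {a<..<b} g"
    using regular_comparable[OF r _ x] by (intro regular_integrable[OF r(1), of "(1 + C) * g x"])
  have c: "(LINT y:{a<..<b}|lborel. k) = k * (b - a)" "set_integrable lborel {a<..<b} (\<lambda>_. k)" for k :: real
    using x unfolding set_lebesgue_integral_def set_integrable_def by (auto simp: measure_lborel_Ioo)
  have "(LINT y:{a<..<b}|lborel. g x) \<le> (LINT y:{a<..<b}|lborel. (1 + C) * g y)"
    using regular_comparable[OF r x] by (intro set_integral_mono c int set_integrable_mult_right)
  thus "g x * (b - a) \<le> (1 + C) * (LINT y:{a<..<b}|lborel. g y)" by (simp add: c)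
  have "(LINT y:{a<..<b}|lborel. g y) \<le> (LINT y:{a<..<b}|lborel. (1 + C) * g x)"
    using regular_comparable[OF r _ x] by (intro set_integral_mono c int)
  thus "(LINT y:{a<..<b}|lborel. g y) \<le> (1 + C) * g x * (b - a)" by (simp only: c(1))
qed

text \<open>
  The transfer operator of a single branch preserves regularity with the same constant: passing to
  the image adds \<open>Ch / \<mu>\<close> from the variation of the derivative, and then distances have grown by
  \<open>\<mu>\<close>, so the constant becomes \<open>(A + Ch / \<mu>) / \<mu> powr \<alpha> = A\<close>.
\<close>

lemma regular_push:
  assumes q: "q \<in> Q" and J: "J = {a<..<b}" "J \<subseteq> q" "a < b" and r: "regular J g"
    and bd: "\<And>x. x \<in> J \<Longrightarrow> g x \<le> \<sigma>"
  obtains g' where "regular (T ` J) g'" "\<And>z. z \<in> T ` J \<Longrightarrow> g' z \<le> \<sigma> / \<mu>"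
    "\<And>B. B \<in> sets borel \<Longrightarrow> (LINT z:B \<inter> T ` J|lborel. g' z) = (LINT x:J \<inter> T -` B|lborel. g x)"
proof -
  have inj: "inj_on T J" using T_inj[OF q] J(2) by (rule inj_on_subset)
  define g' where "g' z = g (the_inv_into J T z) / \<bar>dT (the_inv_into J T z)\<bar>" for z
  have g': "g' (T x) = g x / \<bar>dT x\<bar>" if "x \<in> J" for x
    using the_inv_into_f_f[OF inj that] by (simp add: g'_def)
  have dTp: "\<bar>dT x\<bar> \<ge> \<mu>" if "x \<in> J" for x using T_expanding[OF q] J(2) that by auto
  have g0: "0 \<le> g x" if "x \<in> J" for x using r that unfolding regular_def by auto
  have reg: "regular (T ` J) g'"
    unfolding regular_def
  proof (safe)
    fix x y assume xy: "x \<in> J" "y \<in> J"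
    show "0 \<le> g' (T x)" using g0 xy g' by simp
    define u where "u = \<bar>x - y\<bar> powr \<alpha>"
    have u0: "u \<ge> 0" by (simp add: u_def)
    have d0: "\<bar>dT x\<bar> > 0" "\<bar>dT y\<bar> > 0" using dTp[of x] dTp[of y] xy mu_gt by auto
    have "\<bar>dT y\<bar> \<le> \<bar>dT x\<bar> + Ch * u"
      using dT_Hoelder[OF q, of x y] xy J(2) unfolding u_def by fastforce
    also have "Ch * u = \<mu> * (Ch / \<mu> * u)" using mu_gt by simp
    also have "\<dots> \<le> \<bar>dT x\<bar> * (Ch / \<mu> * u)"
      using dTp[of x] xy u0 mu_gt Ch_pos by (intro mult_right_mono) auto
    also have "\<bar>dT x\<bar> + \<dots> = \<bar>dT x\<bar> * (1 + Ch / \<mu> * u)" by (simp add: algebra_simps)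
    also have "\<dots> \<le> \<bar>dT x\<bar> * exp (Ch / \<mu> * u)"
      by (intro mult_left_mono exp_ge_add_one_self) auto
    finally have dy: "\<bar>dT y\<bar> \<le> \<bar>dT x\<bar> * exp (Ch / \<mu> * u)" by simp
    have gx: "g x \<le> g y * exp (A * u)" using r xy unfolding regular_def u_def by auto
    have "g x * \<bar>dT y\<bar> \<le> (g y * exp (A * u)) * (\<bar>dT x\<bar> * exp (Ch / \<mu> * u))"
      using gx dy g0[OF xy(2)] by (intro mult_mono) auto
    also have "\<dots> = g y * \<bar>dT x\<bar> * exp ((A + Ch / \<mu>) * u)" by (simp add: exp_add algebra_simps)
    finally have 1: "g x * \<bar>dT y\<bar> \<le> g y * \<bar>dT x\<bar> * exp ((A + Ch / \<mu>) * u)" .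
    have "\<bar>x - y\<bar> \<le> \<bar>T x - T y\<bar> / \<mu>"
      using T_expands[OF q, of x y] xy J(2) mu_gt by (auto simp: field_simps subset_iff)
    hence "u \<le> (\<bar>T x - T y\<bar> / \<mu>) powr \<alpha>" unfolding u_def using alpha_pos by (intro powr_mono2) auto
    also have "\<dots> = \<bar>T x - T y\<bar> powr \<alpha> / \<mu> powr \<alpha>" using mu_gt by (simp add: powr_divide)
    finally have "(A + Ch / \<mu>) * u \<le> (A + Ch / \<mu>) * (\<bar>T x - T y\<bar> powr \<alpha> / \<mu> powr \<alpha>)"
      using A_pos Ch_pos mu_gt by (intro mult_left_mono) auto
    also have "\<dots> = A * \<bar>T x - T y\<bar> powr \<alpha>" using A_fixpoint by (metis times_divide_eq_left times_divide_eq_right)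
    finally have "g y * \<bar>dT x\<bar> * exp ((A + Ch / \<mu>) * u) \<le> g y * \<bar>dT x\<bar> * exp (A * \<bar>T x - T y\<bar> powr \<alpha>)"
      using g0[OF xy(2)] by (intro mult_left_mono) auto
    with 1 have "g x * \<bar>dT y\<bar> \<le> g y * \<bar>dT x\<bar> * exp (A * \<bar>T x - T y\<bar> powr \<alpha>)" by linarith
    thus "g' (T x) \<le> g' (T y) * exp (A * \<bar>T x - T y\<bar> powr \<alpha>)"
      using d0 xy by (simp add: g' field_simps)
  qed
  have bd': "g' z \<le> \<sigma> / \<mu>" if z: "z \<in> T ` J" for z
  proof -
    obtain x where x: "x \<in> J" "z = T x" using z by auto
    have "g x / \<bar>dT x\<bar> \<le> \<sigma> / \<mu>"
      using dTp[OF x(1)] bd[OF x(1)] g0[OF x(1)] mu_gt by (intro frac_le) auto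
    thus ?thesis using g'[OF x(1)] x by simp
  qed
  obtain c d where cd: "T ` J = {c<..<d}" using T_image_interval[OF q] J by metis
  have "(LINT z:B \<inter> T ` J|lborel. g' z) = (LINT x:J \<inter> T -` B|lborel. g x)" if B: "B \<in> sets borel" for B
  proof -
    let ?S = "J \<inter> T -` B"
    have TS: "T ` ?S = B \<inter> T ` J" by auto
    have "?S = J \<inter> (q \<inter> T -` B)" using J by auto
    hence S: "?S \<in> sets borel" using branch_vimage_borel[OF q B] J(1) by simp
    have gi: "set_integrable lborel J g" using regular_integrable[of a b g \<sigma>] r bd J by simp
    have "(LINT x:?S|lborel. g x) = (LINT z:T ` ?S|lborel. g' z)"
    proof (rule set_integral_image_C1[where dT = dT])
      show "?S \<in> sets borel" by (rule S)
      show "T ` ?S \<in> sets borel" unfolding TS cd using B by simp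
      show "(T has_real_derivative dT x) (at x)" if "x \<in> ?S" for x using that J by (intro T_deriv[OF q]) auto
      show "inj_on T ?S" using inj by (rule inj_on_subset) auto
      have "set_integrable lborel (T ` J) g'" using regular_integrable[of c d g' "\<sigma> / \<mu>"] reg bd' cd by simp
      thus "set_integrable lborel (T ` ?S) g'" unfolding TS cd by (rule set_integrable_subset) (use B in auto)
      have "set_integrable lborel ?S g" using gi by (rule set_integrable_subset) (use S in auto)
      thus "set_borel_measurable borel ?S g" by (auto simp: set_integrable_def set_borel_measurable_def)
      show "g x = \<bar>dT x\<bar> * g' (T x)" if "x \<in> ?S" for x using that g'[of x] dTp[of x] mu_gt by auto
    qed
    thus ?thesis by (simp add: TS)
  qed
  thus ?thesis using that reg bd' by blast
qed

definition piece :: "real \<Rightarrow> real \<Rightarrow> (real \<Rightarrow> real) \<Rightarrow> real \<Rightarrow> bool" where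
  "piece a b g \<sigma> \<longleftrightarrow> 0 \<le> a \<and> a < b \<and> b \<le> 1 \<and> b - a \<le> 2 * \<delta> \<and> regular {a<..<b} g \<and>
     (\<forall>x\<in>{a<..<b}. g x \<le> \<sigma>)"

text \<open>
  Finite sums of pieces. The second argument is the sum of the bounds \<open>\<sigma>\<close> of the pieces, which depends
  on the decomposition and can exceed the supremum of the sum.
\<close>

inductive standard :: "(real \<Rightarrow> real) \<Rightarrow> real \<Rightarrow> bool" where
  zero: "standard (\<lambda>x. 0) 0"
| add: "piece a b g \<sigma> \<Longrightarrow> standard h M \<Longrightarrow> standard (\<lambda>x. indicator {a<..<b} x * g x + h x) (\<sigma> + M)"

lemma piece_sup_nonneg: "piece a b g \<sigma> \<Longrightarrow> 0 \<le> \<sigma>"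
  using dense[of a b] unfolding piece_def regular_def by (metis greaterThanLessThan_iff order_trans)

lemma standard_bounds:
  "standard h M \<Longrightarrow> 0 \<le> M \<and> (\<forall>x. 0 \<le> h x \<and> h x \<le> M * indicator {0..1} x) \<and> h \<in> borel_measurable borel"
proof (induction rule: standard.induct)
  case (add a b g \<sigma> h M)
  have s: "0 \<le> \<sigma>" by (rule piece_sup_nonneg[OF add(1)])
  have "0 \<le> indicator {a<..<b} x * g x \<and> indicator {a<..<b} x * g x \<le> \<sigma> * indicator {0..1} x" for x
    using add(1) s unfolding piece_def regular_def by (auto simp: indicator_def)
  moreover have "(\<lambda>x. indicator {a<..<b} x * g x) \<in> borel_measurable borel"
    using add(1) regular_measurable unfolding piece_def by blast
  ultimately show ?case using add(3) s
    by (auto simp: distrib_right intro!: add_mono add_nonneg_nonneg borel_measurable_add)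
qed auto

lemma standard_integrable: assumes "standard h M" shows "integrable lborel h"
proof (rule Bochner_Integration.integrable_bound)
  show "integrable lborel (\<lambda>x. M * indicator {0..1::real} x)"
    by (intro integrable_mult_right integrable_real_indicator) auto
qed (use standard_bounds[OF assms] in \<open>auto simp: abs_of_nonneg\<close>)

lemma standard_add: "standard h M \<Longrightarrow> standard k N \<Longrightarrow> standard (\<lambda>x. h x + k x) (M + N)"
proof (induction rule: standard.induct)
  case (add a b g \<sigma> h M)
  have "standard (\<lambda>x. indicator {a<..<b} x * g x + (h x + k x)) (\<sigma> + (M + N))"
    using add by (intro standard.add) auto
  thus ?case by (simp add: add.assoc)
qed simp

lemma standard_scale: assumes c: "c \<ge> 0" shows "standard h M \<Longrightarrow> standard (\<lambda>x. c * h x) (c * M)"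
proof (induction rule: standard.induct)
  case (add a b g \<sigma> h M)
  have "piece a b (\<lambda>x. c * g x) (c * \<sigma>)"
    using add(1) c unfolding piece_def regular_def by (auto simp: mult.assoc intro!: mult_left_mono)
  hence "standard (\<lambda>x. indicator {a<..<b} x * (c * g x) + c * h x) (c * \<sigma> + c * M)"
    using add by (intro standard.add) auto
  thus ?case by (simp add: algebra_simps)
qed (use standard.zero in simp)

lemma standard_sum:
  assumes "finite F" "\<And>i. i \<in> F \<Longrightarrow> standard (h i) (M i)"
  shows "standard (\<lambda>x. \<Sum>i\<in>F. h i x) (\<Sum>i\<in>F. M i)"
  using assms by (induction rule: finite_induct) (auto intro: standard.zero standard_add)

text \<open>
  Two ways to turn a regular function on an interval into a standard density. A short interval is kept
  as one piece, at the price of its supremum. A long one is divided into \<open>\<lfloor>(d - c) / \<delta>\<rfloor>\<close> equal parts, whose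
  lengths lie between \<open>\<delta>\<close> and \<open>2 * \<delta>\<close>, and then the price is the mass, since suprema are comparable
  with means.
\<close>

lemma standard_chop:
  assumes cd: "0 \<le> c" "c < d" "d \<le> 1" and r: "regular {c<..<d} g"
    and bd: "\<And>x. x \<in> {c<..<d} \<Longrightarrow> g x \<le> \<sigma>"
  obtains h M where "standard h M"
    "\<And>B. (LINT x:B|lborel. h x) = (LINT x:B \<inter> {c<..<d}|lborel. g x)"
    "M \<le> (if d - c < \<delta> then \<sigma> else (1 + C) / \<delta> * (LINT x:{c<..<d}|lborel. g x))"
proof (cases "d - c < \<delta>")
  case True
  hence "piece c d g \<sigma>" using cd r bd delta_pos unfolding piece_def by auto
  hence "standard (\<lambda>x. indicator {c<..<d} x * g x + 0) (\<sigma> + 0)" by (intro standard.add standard.zero)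
  thus ?thesis using True by (intro that[of "\<lambda>x. indicator {c<..<d} x * g x" \<sigma>]) (auto simp: set_integral_restrict)
next
  case False
  define L where "L = d - c"
  define n where "n = nat \<lfloor>L / \<delta>\<rfloor>"
  have L: "L \<ge> \<delta>" "L > 0" using False delta_pos by (auto simp: L_def)
  have n1: "n \<ge> 1" using L delta_pos by (simp add: n_def le_nat_iff le_floor_iff)
  have nr: "real n \<le> L / \<delta>" "L / \<delta> < real n + 1"
    using L delta_pos unfolding n_def by (auto simp: of_nat_nat)
  define l where "l = L / real n"
  have l: "\<delta> \<le> l" "l \<le> 2 * \<delta>" "l > 0"
  proof -
    show "\<delta> \<le> l" using nr n1 delta_pos by (simp add: l_def field_simps)
    have "L / \<delta> \<le> 2 * real n" using nr n1 by linarith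
    thus "l \<le> 2 * \<delta>" using n1 delta_pos by (simp add: l_def field_simps)
    show "l > 0" using L n1 by (simp add: l_def)
  qed
  define p where "p i = c + real i * l" for i :: nat
  have pn: "p n = d" using n1 by (simp add: p_def l_def L_def)
  have pS: "p (Suc i) = p i + l" for i by (simp add: p_def algebra_simps)
  have pmono: "p i \<le> p j" if "i \<le> j" for i j using that l by (simp add: p_def)
  have gi: "set_integrable lborel {c<..<d} g" by (rule regular_integrable[OF r bd])
  have gi': "set_integrable lborel B g" if "B \<subseteq> {c<..<d}" "B \<in> sets borel" for B
    using set_integrable_subset[OF gi] that by simp
  have "\<exists>h. standard h ((1 + C) / \<delta> * (LINT x:{c<..<p i}|lborel. g x)) \<and>
            (\<forall>x. x \<notin> p ` {..i} \<longrightarrow> h x = indicator {c<..<p i} x * g x)" if "i \<le> n" for i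
    using that
  proof (induction i)
    case 0
    thus ?case using standard.zero by (intro exI[of _ "\<lambda>x. 0"]) (auto simp: p_def set_lebesgue_integral_def)
  next
    case (Suc i)
    then obtain h where h: "standard h ((1 + C) / \<delta> * (LINT x:{c<..<p i}|lborel. g x))"
      "\<And>x. x \<notin> p ` {..i} \<Longrightarrow> h x = indicator {c<..<p i} x * g x" by auto
    let ?J = "{p i<..<p (Suc i)}"
    have ci: "c \<le> p i" "p (Suc i) \<le> d" "p i < p (Suc i)"
      using pmono[of 0 i] pmono[of "Suc i" n] Suc.prems pn l by (auto simp: p_def algebra_simps)
    have rJ: "regular ?J g" using r by (rule regular_subset) (use ci in auto)
    let ?s = "(1 + C) / \<delta> * (LINT x:?J|lborel. g x)"
    have "g x \<le> ?s" if x: "x \<in> ?J" for x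
    proof -
      have "0 \<le> g x" using rJ x unfolding regular_def by auto
      hence "g x * \<delta> \<le> g x * (p (Suc i) - p i)" using l pS by (intro mult_left_mono) auto
      also have "\<dots> \<le> (1 + C) * (LINT x:?J|lborel. g x)"
        using l pS x by (intro regular_sup_le_mean[OF rJ]) auto
      finally show ?thesis using delta_pos by (simp add: field_simps)
    qed
    hence "piece (p i) (p (Suc i)) g ?s" using ci cd l pS rJ unfolding piece_def by auto
    hence "standard (\<lambda>x. indicator ?J x * g x + h x) (?s + (1 + C) / \<delta> * (LINT x:{c<..<p i}|lborel. g x))"
      using h by (intro standard.add) auto
    moreover have "?s + (1 + C) / \<delta> * (LINT x:{c<..<p i}|lborel. g x)
        = (1 + C) / \<delta> * (LINT x:{c<..<p (Suc i)}|lborel. g x)"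
    proof -
      have "(LINT x:{c<..<p (Suc i)}|lborel. g x) = (LINT x:?J \<union> {c<..<p i}|lborel. g x)"
      proof (rule set_integral_finite_difference)
        have "{c<..<p (Suc i)} - (?J \<union> {c<..<p i}) \<subseteq> {p i}" by auto
        thus "finite ({c<..<p (Suc i)} - (?J \<union> {c<..<p i}))" by (rule finite_subset) auto
        have "(?J \<union> {c<..<p i}) - {c<..<p (Suc i)} = {}" using ci by auto
        thus "finite ((?J \<union> {c<..<p i}) - {c<..<p (Suc i)})" by (metis finite.emptyI)
      qed
      also have "\<dots> = (LINT x:?J|lborel. g x) + (LINT x:{c<..<p i}|lborel. g x)"
        using ci by (intro set_integral_Un gi') auto
      finally show ?thesis by (simp add: algebra_simps)
    qed
    moreover have "indicator ?J x * g x + h x = indicator {c<..<p (Suc i)} x * g x" if "x \<notin> p ` {..Suc i}" for x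
    proof -
      have "x \<noteq> p i" "x \<notin> p ` {..i}" using that by (auto simp: image_iff)
      moreover from this have "h x = indicator {c<..<p i} x * g x" by (intro h(2))
      ultimately show ?thesis using ci by (auto simp: indicator_def)
    qed
    ultimately show ?case by (intro exI[of _ "\<lambda>x. indicator ?J x * g x + h x"]) auto
  qed
  from this[of n] obtain h where h: "standard h ((1 + C) / \<delta> * (LINT x:{c<..<d}|lborel. g x))"
      "\<And>x. x \<notin> p ` {..n} \<Longrightarrow> h x = indicator {c<..<d} x * g x" using pn by auto
  have "(LINT x:B|lborel. h x) = (LINT x:B \<inter> {c<..<d}|lborel. g x)" for B
  proof -
    have "(LINT x:B|lborel. h x) = (LINT x:B|lborel. indicator {c<..<d} x * g x)"
      unfolding set_lebesgue_integral_def
      by (rule integral_discrete_difference[where X = "p ` {..n}"]) (auto simp: h(2) countable_finite)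
    thus ?thesis by (simp add: set_integral_restrict)
  qed
  thus ?thesis using that[OF h(1)] False by auto
qed

end

section \<open>The growth lemma for standard densities\<close>

lemma set_integral_finite_sum:
  fixes f :: "'i \<Rightarrow> real \<Rightarrow> real"
  assumes "\<And>i. i \<in> F \<Longrightarrow> set_integrable M A (f i)"
  shows "(LINT x:A|M. \<Sum>i\<in>F. f i x) = (\<Sum>i\<in>F. LINT x:A|M. f i x)"
  using assms unfolding set_lebesgue_integral_def set_integrable_def
  by (subst Bochner_Integration.integral_sum[symmetric]) (simp_all add: sum_distrib_left)

context holed_map
begin

text \<open>
  A branch that meets \<open>{a<..<b}\<close> without lying in it contains one of the two endpoints.
\<close>

lemma straddling_branches:
  assumes "a < b"
  shows "card {q \<in> Q. q \<inter> {a<..<b} \<noteq> {} \<and> \<not> q \<subseteq> {a<..<b}} \<le> 2"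
proof -
  let ?S = "\<lambda>x. {q \<in> Q. x \<in> q}"
  have one: "card (?S x) \<le> Suc 0" for x
  proof -
    have "q = q'" if "q \<in> ?S x" "q' \<in> ?S x" for q q'
      using disjointD[OF Q_disjoint, of q q'] that by auto
    thus ?thesis using Q_finite by (subst card_le_Suc0_iff_eq) auto
  qed
  have "{q \<in> Q. q \<inter> {a<..<b} \<noteq> {} \<and> \<not> q \<subseteq> {a<..<b}} \<subseteq> ?S a \<union> ?S b"
  proof
    fix q assume q: "q \<in> {q \<in> Q. q \<inter> {a<..<b} \<noteq> {} \<and> \<not> q \<subseteq> {a<..<b}}"
    then obtain l r where lr: "q = {l<..<r}" using Q_interval by blast
    obtain w where w: "w \<in> q" "a < w" "w < b" using q by auto
    obtain x where x: "x \<in> q" "x \<le> a \<or> b \<le> x" using q by force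
    show "q \<in> ?S a \<union> ?S b" using x(2)
    proof
      assume "x \<le> a" thus ?thesis using x w q lr by auto
    next
      assume "b \<le> x" thus ?thesis using x w q lr by auto
    qed
  qed
  hence "card {q \<in> Q. q \<inter> {a<..<b} \<noteq> {} \<and> \<not> q \<subseteq> {a<..<b}} \<le> card (?S a \<union> ?S b)"
    using Q_finite by (intro card_mono) auto
  also have "\<dots> \<le> card (?S a) + card (?S b)" by (rule card_Un_le)
  also have "\<dots> \<le> 2" using one[of a] one[of b] by simp
  finally show ?thesis .
qed

text \<open>
  A branch contained in the piece has a long image, so the supremum term occurs only for the at most
  two branches that stick out.
\<close>

lemma push_piece_branch:
  assumes p: "piece a b g \<sigma>" and q: "q \<in> Q"
  shows "\<exists>h M. standard h M \<and>
    (\<forall>B\<in>sets borel. (LINT x:B|lborel. h x) = (LINT x:(q \<inter> T -` B) \<inter> {a<..<b}|lborel. g x)) \<and>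
    M \<le> (if q \<inter> {a<..<b} \<noteq> {} \<and> \<not> q \<subseteq> {a<..<b} then \<sigma> / \<mu> else 0)
        + (1 + C) / \<delta> * (LINT x:q \<inter> {a<..<b}|lborel. g x)"
proof (cases "q \<inter> {a<..<b} = {}")
  case True
  hence "q \<inter> X \<inter> {a<..<b} = {}" for X by auto
  thus ?thesis using True standard.zero by (intro exI[of _ "\<lambda>_. 0"] exI[of _ 0]) (simp add: set_lebesgue_integral_def)
next
  case False
  obtain l r where lr: "q = {l<..<r}" "\<delta> \<le> r - l" using Q_interval[OF q] by blast
  define J where "J = q \<inter> {a<..<b}"
  define a' where "a' = max l a"
  define b' where "b' = min r b"
  have J: "J = {a'<..<b'}" "J \<subseteq> q" "J \<subseteq> {a<..<b}" by (auto simp: J_def lr a'_def b'_def)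
  have ab': "a' < b'" using False J by (metis J_def greaterThanLessThan_empty_iff not_le)
  have reg: "regular J g" and bd: "\<And>x. x \<in> J \<Longrightarrow> g x \<le> \<sigma>"
    using p J regular_subset unfolding piece_def by blast+
  obtain g' where g': "regular (T ` J) g'" "\<And>z. z \<in> T ` J \<Longrightarrow> g' z \<le> \<sigma> / \<mu>"
    "\<And>B. B \<in> sets borel \<Longrightarrow> (LINT z:B \<inter> T ` J|lborel. g' z) = (LINT x:J \<inter> T -` B|lborel. g x)"
    using regular_push[OF q J(1,2) ab' reg bd] by blast
  obtain c d where cd: "T ` J = {c<..<d}" "0 \<le> c" "c < d" "d \<le> 1" "\<mu> * (b' - a') \<le> d - c"
    using T_image_interval[OF q, of a' b'] J ab' by metis
  have g'cd: "regular {c<..<d} g'" "\<And>z. z \<in> {c<..<d} \<Longrightarrow> g' z \<le> \<sigma> / \<mu>" using g'(1,2) cd(1) by auto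
  obtain h M where h: "standard h M" "\<And>B. (LINT x:B|lborel. h x) = (LINT x:B \<inter> {c<..<d}|lborel. g' x)"
    "M \<le> (if d - c < \<delta> then \<sigma> / \<mu> else (1 + C) / \<delta> * (LINT x:{c<..<d}|lborel. g' x))"
    using standard_chop[OF cd(2-4) g'cd] by blast
  have "(LINT x:B|lborel. h x) = (LINT x:(q \<inter> T -` B) \<inter> {a<..<b}|lborel. g x)" if "B \<in> sets borel" for B
  proof -
    have "J \<inter> T -` B = (q \<inter> T -` B) \<inter> {a<..<b}" by (auto simp: J_def)
    thus ?thesis using h(2)[of B] g'(3)[OF that] cd(1) by metis
  qed
  moreover have "M \<le> (if q \<inter> {a<..<b} \<noteq> {} \<and> \<not> q \<subseteq> {a<..<b} then \<sigma> / \<mu> else 0)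
        + (1 + C) / \<delta> * (LINT x:J|lborel. g x)"
  proof -
    have 1: "(LINT x:{c<..<d}|lborel. g' x) = (LINT x:J|lborel. g x)" using g'(3)[of UNIV] cd(1) by simp
    have "0 \<le> (LINT x:J|lborel. g x)" using reg unfolding set_lebesgue_integral_def regular_def
      by (intro integral_nonneg_AE) (auto simp: indicator_def)
    hence 2: "0 \<le> (1 + C) / \<delta> * (LINT x:J|lborel. g x)" using C_nonneg delta_pos by simp
    have s: "0 \<le> \<sigma> / \<mu>" using piece_sup_nonneg[OF p] mu_gt by simp
    show ?thesis
    proof (cases "d - c < \<delta>")
      case True
      have "\<not> q \<subseteq> {a<..<b}"
      proof
        assume "q \<subseteq> {a<..<b}"
        hence "{a'<..<b'} = {l<..<r}" using J lr J_def by blast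
        hence "a' = l" "b' = r" using ab' delta_pos lr by (auto simp: greaterThanLessThan_eq_iff)
        hence "\<mu> * \<delta> \<le> \<mu> * (b' - a')" using lr mu_gt by simp
        moreover have "1 * \<delta> \<le> \<mu> * \<delta>" using mu_gt delta_pos by (intro mult_right_mono) auto
        ultimately show False using cd True by linarith
      qed
      thus ?thesis using h(3) True 2 False by simp
    next
      case F: False
      thus ?thesis using h(3) 1 s by auto
    qed
  qed
  ultimately show ?thesis using h(1) unfolding J_def by blast
qed

lemma set_integral_branches:
  assumes "integrable lborel (h :: real \<Rightarrow> real)" "B \<in> sets borel"
  shows "(\<Sum>q\<in>Q. LINT x:q \<inter> T -` B|lborel. h x) = (LINT x:I \<inter> T -` B|lborel. h x)"
proof -
  have "(\<Sum>q\<in>Q. LINT x:q \<inter> T -` B|lborel. h x) = (LINT x:(\<Union>q\<in>Q. q \<inter> T -` B)|lborel. h x)"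
    using Q_finite Q_disjoint branch_vimage_borel assms
    by (intro set_integral_finite_Union[symmetric] set_integrable_of_integrable)
      (auto simp: disjoint_family_on_def disjoint_def)
  also have "\<dots> = (LINT x:I \<inter> T -` B|lborel. h x)"
  proof (rule set_integral_finite_difference)
    have "(\<Union>q\<in>Q. q \<inter> T -` B) - (I \<inter> T -` B) = {}" using Q_subset by auto
    thus "finite ((\<Union>q\<in>Q. q \<inter> T -` B) - (I \<inter> T -` B))" by (metis finite.emptyI)
    show "finite ((I \<inter> T -` B) - (\<Union>q\<in>Q. q \<inter> T -` B))" by (rule finite_subset[OF _ I_minus_Q]) auto
  qed
  finally show ?thesis .
qed

text \<open>
  The transfer operator, as a relation between densities through the masses of Borel sets.
\<close>

definition pushes :: "(real \<Rightarrow> real) \<Rightarrow> (real \<Rightarrow> real) \<Rightarrow> bool" where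
  "pushes h h' \<longleftrightarrow> (\<forall>B\<in>sets borel. (LINT x:B|lborel. h' x) = (LINT x:I \<inter> T -` B|lborel. h x))"

lemma push_piece:
  assumes p: "piece a b g \<sigma>"
  shows "\<exists>h M. standard h M \<and> pushes (\<lambda>x. indicator {a<..<b} x * g x) h \<and>
    M \<le> 2 / \<mu> * \<sigma> + (1 + C) / \<delta> * (LINT x:I|lborel. indicator {a<..<b} x * g x)"
proof -
  let ?f = "\<lambda>x. indicator {a<..<b} x * g x"
  let ?c = "\<lambda>q. if q \<inter> {a<..<b} \<noteq> {} \<and> \<not> q \<subseteq> {a<..<b} then \<sigma> / \<mu> else 0"
  have "standard (\<lambda>x. ?f x + 0) (\<sigma> + 0)" by (intro standard.intros p)
  hence fi: "integrable lborel ?f" using standard_integrable[of ?f] by simp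
  define G where "G q h M \<longleftrightarrow> standard h M \<and>
    (\<forall>B\<in>sets borel. (LINT x:B|lborel. h x) = (LINT x:q \<inter> T -` B|lborel. ?f x)) \<and>
    M \<le> ?c q + (1 + C) / \<delta> * (LINT x:q \<inter> T -` UNIV|lborel. ?f x)" for q h M
  have "\<forall>q\<in>Q. \<exists>h M. G q h M"
    using push_piece_branch[OF p] by (simp add: set_integral_restrict G_def)
  then obtain h M where "\<And>q. q \<in> Q \<Longrightarrow> G q (h q) (M q)" by metis
  hence hM: "\<And>q. q \<in> Q \<Longrightarrow> standard (h q) (M q)"
    "\<And>q B. q \<in> Q \<Longrightarrow> B \<in> sets borel \<Longrightarrow> (LINT x:B|lborel. h q x) = (LINT x:q \<inter> T -` B|lborel. ?f x)"
    "\<And>q. q \<in> Q \<Longrightarrow> M q \<le> ?c q + (1 + C) / \<delta> * (LINT x:q \<inter> T -` UNIV|lborel. ?f x)"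
    unfolding G_def by blast+
  have "standard (\<lambda>x. \<Sum>q\<in>Q. h q x) (\<Sum>q\<in>Q. M q)" using Q_finite hM(1) by (rule standard_sum)
  moreover have "pushes ?f (\<lambda>x. \<Sum>q\<in>Q. h q x)"
    unfolding pushes_def
  proof
    fix B :: "real set" assume B: "B \<in> sets borel"
    have "(LINT x:B|lborel. \<Sum>q\<in>Q. h q x) = (\<Sum>q\<in>Q. LINT x:B|lborel. h q x)"
      using B hM(1) by (intro set_integral_finite_sum set_integrable_of_integrable standard_integrable)
    also have "\<dots> = (\<Sum>q\<in>Q. LINT x:q \<inter> T -` B|lborel. ?f x)" using hM(2)[OF _ B] by simp
    also have "\<dots> = (LINT x:I \<inter> T -` B|lborel. ?f x)" by (rule set_integral_branches[OF fi B])
    finally show "(LINT x:B|lborel. \<Sum>q\<in>Q. h q x) = \<dots>" .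
  qed
  moreover have "(\<Sum>q\<in>Q. M q) \<le> 2 / \<mu> * \<sigma> + (1 + C) / \<delta> * (LINT x:I|lborel. ?f x)"
  proof -
    have s: "0 \<le> \<sigma> / \<mu>" using piece_sup_nonneg[OF p] mu_gt by simp
    have "(\<Sum>q\<in>Q. M q) \<le> (\<Sum>q\<in>Q. ?c q + (1 + C) / \<delta> * (LINT x:q \<inter> T -` UNIV|lborel. ?f x))"
      by (intro sum_mono hM(3))
    also have "\<dots> = (\<Sum>q\<in>Q. ?c q) + (1 + C) / \<delta> * (\<Sum>q\<in>Q. LINT x:q \<inter> T -` UNIV|lborel. ?f x)"
      by (simp add: sum.distrib sum_distrib_left)
    also have "(\<Sum>q\<in>Q. LINT x:q \<inter> T -` UNIV|lborel. ?f x) = (LINT x:I|lborel. ?f x)"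
      using set_integral_branches[OF fi, of UNIV] by simp
    also have "(\<Sum>q\<in>Q. ?c q) = real (card {q \<in> Q. q \<inter> {a<..<b} \<noteq> {} \<and> \<not> q \<subseteq> {a<..<b}}) * (\<sigma> / \<mu>)"
      using Q_finite by (simp add: sum.If_cases Int_def)
    also have "\<dots> \<le> 2 * (\<sigma> / \<mu>)"
      using straddling_branches[of a b] p s unfolding piece_def by (intro mult_right_mono) auto
    finally show ?thesis by simp
  qed
  ultimately show ?thesis by blast
qed

text \<open>
  The growth lemma. The coefficient \<open>2 / \<mu>\<close> is free of the distortion constant because it compares
  suprema with suprema; distortion enters only where suprema are bought with mass.
\<close>

lemma push_standard:
  "standard h M \<Longrightarrow> \<exists>h' M'. standard h' M' \<and> pushes h h' \<and>
     M' \<le> 2 / \<mu> * M + (1 + C) / \<delta> * (LINT x:I|lborel. h x)"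
proof (induction rule: standard.induct)
  case zero
  show ?case using standard.zero by (intro exI[of _ "\<lambda>_. 0"] exI[of _ 0]) (simp add: pushes_def)
next
  case (add a b g \<sigma> h M)
  let ?f = "\<lambda>x. indicator {a<..<b} x * g x"
  obtain h1 M1 where h1: "standard h1 M1" "pushes ?f h1"
      "M1 \<le> 2 / \<mu> * \<sigma> + (1 + C) / \<delta> * (LINT x:I|lborel. ?f x)"
    using push_piece[OF add(1)] by blast
  obtain h2 M2 where h2: "standard h2 M2" "pushes h h2"
      "M2 \<le> 2 / \<mu> * M + (1 + C) / \<delta> * (LINT x:I|lborel. h x)"
    using add(3) by blast
  have "standard (\<lambda>x. ?f x + 0) (\<sigma> + 0)" by (intro standard.intros add)
  hence fi: "integrable lborel ?f" using standard_integrable[of ?f] by simp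
  have hi: "integrable lborel h" using add(2) by (rule standard_integrable)
  have split: "(LINT x:B|lborel. ?f x + h x) = (LINT x:B|lborel. ?f x) + (LINT x:B|lborel. h x)"
    if "B \<in> sets borel" for B
    using that fi hi by (intro set_integral_add set_integrable_of_integrable)
  have "pushes (\<lambda>x. ?f x + h x) (\<lambda>x. h1 x + h2 x)"
    unfolding pushes_def
  proof
    fix B :: "real set" assume B: "B \<in> sets borel"
    have "(LINT x:B|lborel. h1 x + h2 x) = (LINT x:B|lborel. h1 x) + (LINT x:B|lborel. h2 x)"
      using B h1(1) h2(1) by (intro set_integral_add set_integrable_of_integrable standard_integrable)
    also have "\<dots> = (LINT x:I \<inter> T -` B|lborel. ?f x) + (LINT x:I \<inter> T -` B|lborel. h x)"
      using h1(2) h2(2) B by (simp add: pushes_def)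
    also have "\<dots> = (LINT x:I \<inter> T -` B|lborel. ?f x + h x)" using split[OF vimage_borel[OF B]] by simp
    finally show "(LINT x:B|lborel. h1 x + h2 x) = \<dots>" .
  qed
  moreover have "M1 + M2 \<le> 2 / \<mu> * (\<sigma> + M) + (1 + C) / \<delta> * (LINT x:I|lborel. ?f x + h x)"
    unfolding split[OF I_borel] using h1(3) h2(3) by (simp add: distrib_left)
  ultimately show ?case using standard_add[OF h1(1) h2(1)] by blast
qed

end

text \<open>
  Condition (A1) with \<open>a\<close> replaced by its lower bound \<open>sqrt (2 / \<mu>)\<close>.
\<close>

locale small_hole = holed_map +
  assumes hole_small: "measure lborel ({0..1} - I)
    \<le> (1 - sqrt (2 / \<mu>))\<^sup>2 * \<mu> * \<delta>\<^sup>2 * (1 - sqrt (2 / \<mu>)) / (1 + C)"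
begin

definition s where "s = sqrt (2 / \<mu>)"

definition M_star where "M_star = (1 + C) / (\<delta> * (1 - s))"

lemma s: "0 < s" "s < 1" "2 / \<mu> = s\<^sup>2"
  using mu_gt by (auto simp: s_def)

lemma M_star_ge_1: "M_star \<ge> 1"
proof -
  have "\<delta> * (1 - s) \<le> 1 * 1" using s delta_small(2) delta_pos by (intro mult_mono) auto
  hence "\<delta> * (1 - s) \<le> 1 + C" using C_nonneg by linarith
  thus ?thesis using s delta_pos by (simp add: M_star_def)
qed

text \<open>
  The smallness of the hole is used only through this inequality: if the supremum of a density is
  at most \<open>M_star\<close> times its mass, the hole takes at most the fraction \<open>(1 - s)\<^sup>2\<close>.
\<close>

lemma hole_M_star: "measure lborel ({0..1} - I) * M_star \<le> (1 - s)\<^sup>2"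
proof -
  let ?H = "measure lborel ({0..1} - I)"
  have "?H * (1 + C) \<le> (1 - s)\<^sup>2 * (\<mu> * \<delta>) * (\<delta> * (1 - s))"
    using hole_small C_nonneg by (simp add: s_def[symmetric] pos_le_divide_eq power2_eq_square mult_ac)
  also have "\<dots> \<le> (1 - s)\<^sup>2 * 1 * (\<delta> * (1 - s))"
    using delta_small(1) delta_pos mu_gt s by (intro mult_right_mono mult_left_mono) auto
  finally have "?H * (1 + C) / (\<delta> * (1 - s)) \<le> (1 - s)\<^sup>2"
    using s delta_pos by (subst pos_divide_le_eq) auto
  thus ?thesis by (simp add: M_star_def)
qed

lemma standard_set_integral_le:
  assumes "standard h M" "B \<in> sets borel"
  shows "(LINT x:B|lborel. h x) \<le> M * measure lborel (B \<inter> {0..1})"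
    and "0 \<le> (LINT x:B|lborel. h x)"
proof -
  have i: "integrable lborel (\<lambda>x. M * indicator {0..1::real} x)"
    by (intro integrable_mult_right integrable_real_indicator) auto
  have "(LINT x:B|lborel. h x) \<le> (LINT x:B|lborel. M * indicator {0..1} x)"
    using standard_bounds[OF assms(1)]
    by (intro set_integral_mono set_integrable_of_integrable standard_integrable[OF assms(1)] i assms) auto
  also have "\<dots> = (LINT x|lborel. M * indicator (B \<inter> {0..1}) x)"
    unfolding set_lebesgue_integral_def by (intro Bochner_Integration.integral_cong) (auto simp: indicator_def)
  finally show "(LINT x:B|lborel. h x) \<le> M * measure lborel (B \<inter> {0..1})" by simp
  show "0 \<le> (LINT x:B|lborel. h x)"
    unfolding set_lebesgue_integral_def using standard_bounds[OF assms(1)]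
    by (intro integral_nonneg_AE) (auto simp: indicator_def)
qed

text \<open>
  The surviving fraction is at least \<open>1 - (1 - s)\<^sup>2 = s * (2 - s) \<ge> s\<close>.
\<close>

lemma push_mass:
  assumes h: "standard h M" "M \<le> M_star * (LINT x|lborel. h x)" and p: "pushes h h'"
  shows "s * (LINT x|lborel. h x) \<le> (LINT x|lborel. h' x)"
    and "(LINT x:I|lborel. h x) = (LINT x|lborel. h' x)"
proof -
  let ?m = "LINT x|lborel. h x"
  have U: "(LINT x:UNIV|lborel. f x) = (LINT x|lborel. f x)" for f :: "real \<Rightarrow> real"
    by (simp add: set_lebesgue_integral_def)
  show eq: "(LINT x:I|lborel. h x) = (LINT x|lborel. h' x)"
    using p U[of h'] unfolding pushes_def by (auto dest: bspec[of _ _ UNIV])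
  have hi: "integrable lborel h" by (rule standard_integrable[OF h(1)])
  have m0: "?m \<ge> 0" using standard_set_integral_le(2)[OF h(1), of UNIV] U by simp
  have "?m = (LINT x:I \<union> - I|lborel. h x)" using U[of h] by simp
  also have "\<dots> = (LINT x:I|lborel. h x) + (LINT x:- I|lborel. h x)"
    using I_borel by (intro set_integral_Un set_integrable_of_integrable hi) auto
  also have "(LINT x:- I|lborel. h x) \<le> M * measure lborel ({0..1} - I)"
    using standard_set_integral_le(1)[OF h(1), of "- I"] I_borel by (simp add: Diff_eq Int_commute)
  also have "\<dots> \<le> (M_star * ?m) * measure lborel ({0..1} - I)"
    using h(2) by (intro mult_right_mono) auto
  also have "\<dots> = ?m * (measure lborel ({0..1} - I) * M_star)" by simp
  also have "\<dots> \<le> ?m * (1 - s)\<^sup>2" using hole_M_star m0 by (intro mult_left_mono)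
  finally have "?m * (1 - (1 - s)\<^sup>2) \<le> (LINT x:I|lborel. h x)" by (simp add: algebra_simps)
  moreover have "1 - (1 - s)\<^sup>2 \<ge> s"
  proof -
    have "1 - (1 - s)\<^sup>2 - s = s * (1 - s)" by (simp add: power2_eq_square algebra_simps)
    moreover have "s * (1 - s) \<ge> 0" using s by simp
    ultimately show ?thesis by linarith
  qed
  hence "?m * s \<le> ?m * (1 - (1 - s)\<^sup>2)" using m0 by (rule mult_left_mono)
  ultimately show "s * ?m \<le> (LINT x|lborel. h' x)" using eq by (simp add: mult.commute)
qed

text \<open>
  The bound \<open>M n \<le> M_star * m n\<close> and the bound \<open>m (n + 1) \<ge> s * m n\<close> support each other in the
  induction: the first limits the loss into the hole, and by the second \<open>s\<^sup>2 * M n\<close> is at most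
  \<open>s * M_star * m (n + 1)\<close>, while \<open>(1 + C) / \<delta> = (1 - s) * M_star\<close>.
\<close>

lemma iterated_densities:
  obtains h M where
    "\<And>n::nat. standard (h n) (M n)" "\<And>n. M n \<le> M_star * (LINT x|lborel. h n x)"
    "\<And>n. pushes (h n) (h (Suc n))"
    "\<And>B. B \<in> sets borel \<Longrightarrow> (LINT x:B|lborel. h 0 x) = measure lborel (B \<inter> {0..1})"
proof -
  let ?int = "\<lambda>h :: real \<Rightarrow> real. LINT x|lborel. h x"
  define P where "P n hM \<longleftrightarrow> standard (fst hM) (snd hM) \<and> snd hM \<le> M_star * ?int (fst hM) \<and>
     (n = (0::nat) \<longrightarrow> (\<forall>B\<in>sets borel. (LINT x:B|lborel. fst hM x) = measure lborel (B \<inter> {0..1})))" for n hM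
  have "\<exists>hM. P 0 hM"
  proof -
    have "regular {0<..<1} (\<lambda>_. 1)" using A_pos by (simp add: regular_def)
    then obtain h M where h: "standard h M" "\<And>B. (LINT x:B|lborel. h x) = (LINT x:B \<inter> {0<..<1}|lborel. 1)"
      "M \<le> (if 1 - 0 < \<delta> then 1 else (1 + C) / \<delta> * (LINT x:{0<..<1::real}|lborel. 1))"
      using standard_chop[of 0 1 "\<lambda>_. 1" 1] by (auto)
    have hB: "(LINT x:B|lborel. h x) = measure lborel (B \<inter> {0..1})" if "B \<in> sets borel" for B
    proof -
      have "(LINT x:B \<inter> {0<..<1}|lborel. 1) = (LINT x:B \<inter> {0..1::real}|lborel. 1::real)"
      proof (rule set_integral_finite_difference)
        show "finite (B \<inter> {0<..<1} - B \<inter> {0..1})" by (rule finite_subset[of _ "{}"]) auto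
        show "finite (B \<inter> {0..1} - B \<inter> {0<..<1})" by (rule finite_subset[of _ "{0, 1}"]) auto
      qed
      also have "\<dots> = measure lborel (B \<inter> {0..1})" using that by (simp add: set_lebesgue_integral_def)
      finally show ?thesis using h(2) by simp
    qed
    have 1: "?int h = 1" using hB[of UNIV] by (simp add: set_lebesgue_integral_def)
    have "M \<le> (1 + C) / \<delta>" using h(3) delta_small(2) delta_pos by (simp add: set_lebesgue_integral_def)
    also have "\<dots> \<le> M_star" unfolding M_star_def using s delta_pos C_nonneg
      by (intro divide_left_mono) auto
    finally have "P 0 (h, M)" using h(1) hB 1 by (simp add: P_def)
    thus ?thesis by blast
  qed
  moreover have "\<exists>hM'. P (Suc n) hM' \<and> pushes (fst hM) (fst hM')" if "P n hM" for n hM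
  proof -
    obtain h M where hM: "hM = (h, M)" by (cases hM)
    have h: "standard h M" "M \<le> M_star * ?int h" using that by (auto simp: P_def hM)
    obtain h' M' where h': "standard h' M'" "pushes h h'" "M' \<le> 2 / \<mu> * M + (1 + C) / \<delta> * (LINT x:I|lborel. h x)"
      using push_standard[OF h(1)] by blast
    note pm = push_mass[OF h h'(2)]
    have "2 / \<mu> * M \<le> s\<^sup>2 * (M_star * ?int h)" using h(2) s by (simp add: mult_left_mono)
    also have "\<dots> = s * M_star * (s * ?int h)" by (simp add: power2_eq_square)
    also have "\<dots> \<le> s * M_star * ?int h'" using pm(1) s M_star_ge_1 by (intro mult_left_mono) auto
    finally have "M' \<le> s * M_star * ?int h' + (1 + C) / \<delta> * ?int h'" using h'(3) pm(2) by simp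
    moreover have "(1 + C) / \<delta> = (1 - s) * M_star" using s by (simp add: M_star_def)
    ultimately have "M' \<le> M_star * ?int h'" by (simp add: algebra_simps)
    thus ?thesis using h' by (intro exI[of _ "(h', M')"]) (simp add: P_def hM)
  qed
  ultimately obtain f where f: "\<And>n. P n (f n)" "\<And>n. pushes (fst (f n)) (fst (f (Suc n)))"
    using dependent_nat_choice[of P "\<lambda>n hM hM'. pushes (fst hM) (fst hM')"] by metis
  show ?thesis
    by (rule that[of "\<lambda>n. fst (f n)" "\<lambda>n. snd (f n)"]) (use f in \<open>auto simp: P_def\<close>)
qed

text \<open>
  With weights \<open>R\<^sup>-\<^sup>n\<close> the difference between the pushed density and \<open>R\<close> times the density telescopes
  to its first and last terms. Both are small by \<open>almost_submultiplicative_averages\<close>; its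
  hypothesis holds because a density dominated by \<open>M_star * m n\<close> stays dominated by that multiple
  of the iterates of the constant density.
\<close>

lemma almost_invariant_densities:
  "\<exists>R>0. \<forall>e>0. \<exists>u M. standard u M \<and> M \<le> M_star \<and> (LINT x|lborel. u x) = 1 \<and>
     (\<forall>B\<in>sets borel. \<bar>(LINT x:I \<inter> T -` B|lborel. u x) - R * (LINT x:B|lborel. u x)\<bar> \<le> e)"
proof -
  obtain h M where h: "\<And>n::nat. standard (h n) (M n)" "\<And>n. M n \<le> M_star * (LINT x|lborel. h n x)"
    "\<And>n. pushes (h n) (h (Suc n))"
    "\<And>B. B \<in> sets borel \<Longrightarrow> (LINT x:B|lborel. h 0 x) = measure lborel (B \<inter> {0..1})"
    using iterated_densities by blast
  define F where "F n B = (LINT x:B|lborel. h n x)" for n B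
  define m where "m n = F n UNIV" for n
  have mint: "m n = (LINT x|lborel. h n x)" for n by (simp add: m_def F_def set_lebesgue_integral_def)
  have Fpush: "F (Suc n) B = F n (I \<inter> T -` B)" if "B \<in> sets borel" for n B
    using h(3)[of n] that by (simp add: F_def pushes_def)
  have F0: "0 \<le> F n B" if "B \<in> sets borel" for n B using standard_set_integral_le(2)[OF h(1) that] by (simp add: F_def)
  have Fm: "F n B \<le> m n" if "B \<in> sets borel" for n B
  proof -
    have "m n = F n (B \<union> - B)" by (simp add: m_def)
    also have "\<dots> = F n B + F n (- B)" unfolding F_def using that
      by (intro set_integral_Un set_integrable_of_integrable standard_integrable[OF h(1)]) auto
    finally show ?thesis using F0[of "- B" n] that by simp
  qed
  have m0: "m 0 = 1" using h(4)[of UNIV] by (simp add: m_def F_def)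
  have ms: "s * m n \<le> m (Suc n)" for n using push_mass(1)[OF h(1,2,3)] by (simp add: mint)
  have msn: "s ^ n \<le> m n" for n
  proof (induction n)
    case (Suc n)
    have "s ^ Suc n \<le> s * m n" using Suc s by simp
    thus ?case using ms[of n] by linarith
  qed (simp add: m0)
  have mpos: "m n > 0" for n using msn[of n] s by (meson less_le_trans zero_less_power)
  have dom: "F (n + k) B \<le> M_star * m n * F k B" if "B \<in> sets borel" for n k B
    using that
  proof (induction k arbitrary: B)
    case 0
    have "F n B \<le> M n * measure lborel (B \<inter> {0..1})" using standard_set_integral_le(1)[OF h(1) 0] by (simp add: F_def)
    also have "\<dots> \<le> M_star * m n * measure lborel (B \<inter> {0..1})" using h(2)[of n] by (intro mult_right_mono) (auto simp: mint)
    finally show ?case using h(4)[OF 0] by (simp add: F_def)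
  next
    case (Suc k)
    show ?case using Suc.IH[OF vimage_borel[OF Suc.prems]] Fpush[OF Suc.prems] by simp
  qed
  have "\<exists>R>0. \<forall>e>0. \<exists>N. let S = (\<Sum>n<N. m n / R ^ n) in S > 0 \<and> 1 \<le> e * S \<and> m N / R ^ N \<le> e * S"
  proof (rule almost_submultiplicative_averages[where M = M_star and s = s])
    show "m (n + k) \<le> M_star * m n * m k" for n k using dom[of UNIV n k] by (simp add: m_def)
    show "s ^ n \<le> M_star * m n" for n
      using msn[of n] M_star_ge_1 mpos[of n] by (smt (verit) mult_le_cancel_right1)
  qed (use M_star_ge_1 s mpos in auto)
  then obtain R where R: "R > 0"
    "\<And>e. e > 0 \<Longrightarrow> \<exists>N. let S = (\<Sum>n<N. m n / R ^ n) in S > 0 \<and> 1 \<le> e * S \<and> m N / R ^ N \<le> e * S" by blast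
  have "\<exists>u M. standard u M \<and> M \<le> M_star \<and> (LINT x|lborel. u x) = 1 \<and>
     (\<forall>B\<in>sets borel. \<bar>(LINT x:I \<inter> T -` B|lborel. u x) - R * (LINT x:B|lborel. u x)\<bar> \<le> e)" if e: "e > 0" for e
  proof -
    define S where "S N = (\<Sum>n<N. m n / R ^ n)" for N
    obtain N where N: "S N > 0" "1 \<le> e / R * S N" "m N / R ^ N \<le> e / R * S N"
      using R(2)[of "e / R"] R(1) e unfolding S_def Let_def by auto
    define c where "c n = 1 / (R ^ n * S N)" for n
    have c0: "c n \<ge> 0" for n using R(1) N(1) by (simp add: c_def)
    define u where "u x = (\<Sum>n<N. c n * h n x)" for x
    have ci: "set_integrable lborel B (\<lambda>x. c n * h n x)" if "B \<in> sets borel" for n B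
      using that by (intro set_integrable_of_integrable integrable_mult_right standard_integrable[OF h(1)])
    have uB: "(LINT x:B|lborel. u x) = (\<Sum>n<N. c n * F n B)" if "B \<in> sets borel" for B
      unfolding u_def F_def using ci[OF that] by (subst set_integral_finite_sum) auto
    have su: "standard u (\<Sum>n<N. c n * M n)" unfolding u_def using c0 h(1) by (intro standard_sum standard_scale) auto
    have cm: "(\<Sum>n<N. c n * m n) = 1"
    proof -
      have "(\<Sum>n<N. c n * m n) = S N / S N" unfolding S_def[of N] sum_divide_distrib
        by (intro sum.cong refl) (simp add: c_def S_def)
      thus ?thesis using N(1) by simp
    qed
    have "(\<Sum>n<N. c n * M n) \<le> (\<Sum>n<N. c n * (M_star * m n))"
      using h(2) c0 by (intro sum_mono mult_left_mono) (auto simp: mint)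
    also have "\<dots> = M_star * (\<Sum>n<N. c n * m n)" by (simp add: sum_distrib_left mult_ac)
    finally have "(\<Sum>n<N. c n * M n) \<le> M_star" using cm by simp
    moreover note su
    moreover have "(LINT x|lborel. u x) = 1"
      using uB[of UNIV] cm by (simp add: m_def set_lebesgue_integral_def)
    moreover have "\<bar>(LINT x:I \<inter> T -` B|lborel. u x) - R * (LINT x:B|lborel. u x)\<bar> \<le> e" if B: "B \<in> sets borel" for B
    proof -
      define w where "w n = F n B / R ^ n" for n
      have "(LINT x:I \<inter> T -` B|lborel. u x) = (\<Sum>n<N. c n * F (Suc n) B)"
        using uB[OF vimage_borel[OF B]] Fpush[OF B] by simp
      also have "\<dots> = R / S N * (\<Sum>n<N. w (Suc n))"
        unfolding sum_distrib_left using R(1) by (intro sum.cong refl) (simp add: c_def w_def field_simps)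
      finally have 1: "(LINT x:I \<inter> T -` B|lborel. u x) = R / S N * (\<Sum>n<N. w (Suc n))" .
      have 2: "R * (LINT x:B|lborel. u x) = R / S N * (\<Sum>n<N. w n)"
        unfolding uB[OF B] sum_distrib_left using R(1) by (intro sum.cong refl) (simp add: c_def w_def field_simps)
      have "(LINT x:I \<inter> T -` B|lborel. u x) - R * (LINT x:B|lborel. u x) = R / S N * (w N - w 0)"
        unfolding 1 2 by (simp add: sum_lessThan_telescope[symmetric] sum_subtractf algebra_simps)
      moreover have "\<bar>w N - w 0\<bar> \<le> e / R * S N"
      proof -
        have "w N \<le> m N / R ^ N" unfolding w_def using Fm[OF B] R(1) by (intro divide_right_mono) auto
        moreover have "w 0 \<le> 1" unfolding w_def using Fm[OF B, of 0] m0 by simp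
        moreover have "w N \<ge> 0" "w 0 \<ge> 0" unfolding w_def using F0[OF B] R(1) by auto
        ultimately show ?thesis using N by linarith
      qed
      hence "R / S N * \<bar>w N - w 0\<bar> \<le> R / S N * (e / R * S N)" using R(1) N(1) by (intro mult_left_mono) auto
      moreover have "R / S N * (e / R * S N) = e" using R(1) N(1) by simp
      ultimately show ?thesis using R(1) N(1) by (simp add: abs_mult)
    qed
    ultimately show ?thesis by blast
  qed
  thus ?thesis using R(1) by blast
qed

end

section \<open>Variation and long pieces of standard densities\<close>

context holed_map
begin

text \<open>
  For \<open>\<alpha> = 1\<close> a piece is Lipschitz with constant \<open>L = (exp A - 1) * \<sigma>\<close>, so on its interval it is the
  difference of the increasing functions \<open>g x + L * (x - a)\<close> and \<open>L * (x - a)\<close>. To the right of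
  the interval both are continued by the constant \<open>P = exp A * \<sigma>\<close>, which dominates them.
\<close>

lemma standard_difference_of_mono:
  assumes "\<alpha> = 1"
  shows "standard h M \<Longrightarrow> \<exists>p q. mono p \<and> mono q \<and>
    (\<forall>x. 0 \<le> p x \<and> p x \<le> exp A * M \<and> 0 \<le> q x \<and> q x \<le> exp A * M \<and> h x = p x - q x)"
proof (induction rule: standard.induct)
  case zero
  show ?case by (intro exI[of _ "\<lambda>_. 0"]) (auto simp: mono_def)
next
  case (add a b g \<sigma> h M)
  obtain p q where pq: "mono p" "mono q" "\<And>x. 0 \<le> p x \<and> p x \<le> exp A * M"
    "\<And>x. 0 \<le> q x \<and> q x \<le> exp A * M" "\<And>x. h x = p x - q x"
    using add(3) by blast
  have ab: "a < b" "b - a \<le> 1" and r: "regular {a<..<b} g" and gs: "\<And>x. x \<in> {a<..<b} \<Longrightarrow> g x \<le> \<sigma>"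
    using add(1) unfolding piece_def by auto
  have s0: "0 \<le> \<sigma>" by (rule piece_sup_nonneg[OF add(1)])
  define L where "L = (exp A - 1) * \<sigma>"
  have L0: "L \<ge> 0" using s0 A_pos by (simp add: L_def)
  have g0: "g x \<ge> 0" if "x \<in> {a<..<b}" for x using r that unfolding regular_def by auto
  have lip: "g x \<le> g y + L * \<bar>x - y\<bar>" if xy: "x \<in> {a<..<b}" "y \<in> {a<..<b}" for x y
  proof -
    define u where "u = \<bar>x - y\<bar>"
    have u: "0 \<le> u" "u \<le> 1" using xy ab by (auto simp: u_def)
    have "exp ((1 - u) *\<^sub>R 0 + u *\<^sub>R A) \<le> (1 - u) * exp 0 + u * exp A"
      using exp_convex u by (intro convex_onD[of UNIV]) auto
    hence e: "exp (A * u) \<le> 1 + u * (exp A - 1)" by (simp add: algebra_simps)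
    have "g x \<le> g y * exp (A * u)" using r xy assms unfolding regular_def u_def by auto
    also have "\<dots> \<le> g y * (1 + u * (exp A - 1))" using e g0[OF xy(2)] by (intro mult_left_mono)
    also have "\<dots> = g y + u * (exp A - 1) * g y" by (simp add: algebra_simps)
    also have "\<dots> \<le> g y + u * (exp A - 1) * \<sigma>"
      using gs[OF xy(2)] u A_pos by (intro add_left_mono mult_left_mono) auto
    finally show ?thesis by (simp add: L_def u_def mult_ac)
  qed
  define P where "P = exp A * \<sigma>"
  have P: "P = \<sigma> + L" by (simp add: P_def L_def algebra_simps)
  define p1 where "p1 x = (if x \<le> a then 0 else if x < b then g x + L * (x - a) else P)" for x
  define q1 where "q1 x = (if x \<le> a then 0 else if x < b then L * (x - a) else P)" for x
  have lin: "0 \<le> L * (x - a)" "L * (x - a) \<le> L" if "x \<in> {a<..<b}" for x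
    using that L0 ab mult_left_mono[of "x - a" 1 L] by auto
  have b1: "0 \<le> p1 x \<and> p1 x \<le> P" "0 \<le> q1 x \<and> q1 x \<le> P" for x
    using lin[of x] g0[of x] gs[of x] s0 L0 by (auto simp: p1_def q1_def P)
  have "mono p1"
  proof (rule monoI)
    fix x y :: real assume xy: "x \<le> y"
    show "p1 x \<le> p1 y"
    proof (cases "x \<le> a \<or> b \<le> y")
      case True thus ?thesis using b1[of x] b1[of y] xy ab by (auto simp: p1_def)
    next
      case False
      hence "x \<in> {a<..<b}" "y \<in> {a<..<b}" using xy by auto
      thus ?thesis using lip[of x y] xy by (auto simp: p1_def algebra_simps)
    qed
  qed
  moreover have "mono q1"
  proof (rule monoI)
    fix x y :: real assume xy: "x \<le> y"
    show "q1 x \<le> q1 y"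
    proof (cases "x \<le> a \<or> b \<le> y")
      case True thus ?thesis using b1[of x] b1[of y] xy ab by (auto simp: q1_def)
    next
      case False thus ?thesis using xy L0 by (auto simp: q1_def intro!: mult_left_mono)
    qed
  qed
  moreover have "indicator {a<..<b} x * g x = p1 x - q1 x" for x
    by (auto simp: p1_def q1_def indicator_def)
  moreover have "mono (\<lambda>x. f x + k x)" if "mono f" "mono k" for f k :: "real \<Rightarrow> real"
    using that by (simp add: mono_def add_mono)
  moreover have "exp A * (\<sigma> + M) = P + exp A * M" by (simp add: P_def distrib_left)
  ultimately show ?case using pq b1
    by (intro exI[of _ "\<lambda>x. p1 x + p x"] exI[of _ "\<lambda>x. q1 x + q x"])
      (simp add: add_mono add_nonneg_nonneg)
qed

text \<open>
  Pieces shorter than \<open>l0\<close> carry at most the mass \<open>l0 * M\<close>. Every longer piece contains one of finitely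
  many grid intervals of length \<open>l1\<close>, and there it is at least its mass divided by \<open>1 + C\<close>.
\<close>

lemma standard_grid:
  assumes l: "0 < l1" "l1 < l0" "l0 \<le> 1" and G: "G = Suc (nat \<lfloor>(1 - l1) / (l0 - l1)\<rfloor>)"
  shows "standard h M \<Longrightarrow> \<exists>c :: nat \<Rightarrow> real. (\<forall>k. 0 \<le> c k) \<and>
     (\<forall>k<G. \<forall>x\<in>{real k * (l0 - l1)<..<real k * (l0 - l1) + l1}. c k \<le> h x) \<and>
     ((LINT x|lborel. h x) - l0 * M) / (1 + C) \<le> (\<Sum>k<G. c k)"
proof (induction rule: standard.induct)
  case zero
  show ?case by (intro exI[of _ "\<lambda>_. 0"]) auto
next
  case (add a b g \<sigma> h M)
  let ?\<eta> = "l0 - l1" let ?f = "\<lambda>x. indicator {a<..<b} x * g x"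
  let ?grid = "\<lambda>k. {real k * ?\<eta><..<real k * ?\<eta> + l1}"
  obtain c where c: "\<And>k. 0 \<le> c k" "\<And>k x. k < G \<Longrightarrow> x \<in> ?grid k \<Longrightarrow> c k \<le> h x"
    "((LINT x|lborel. h x) - l0 * M) / (1 + C) \<le> (\<Sum>k<G. c k)" using add(3) by blast
  have ab: "0 \<le> a" "a < b" "b \<le> 1" "b - a \<le> 2 * \<delta>" and r: "regular {a<..<b} g"
    and gs: "\<And>x. x \<in> {a<..<b} \<Longrightarrow> g x \<le> \<sigma>" using add(1) unfolding piece_def by auto
  have s0: "0 \<le> \<sigma>" by (rule piece_sup_nonneg[OF add(1)])
  have g0: "g x \<ge> 0" if "x \<in> {a<..<b}" for x using r that unfolding regular_def by auto
  have f0: "?f x \<ge> 0" for x using g0[of x] by (auto simp: indicator_def)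
  define w where "w = (LINT x:{a<..<b}|lborel. g x)"
  have "standard (\<lambda>x. ?f x + 0) (\<sigma> + 0)" by (intro standard.intros add)
  hence fi: "integrable lborel ?f" using standard_integrable[of ?f] by simp
  have tot: "(LINT x|lborel. ?f x + h x) = w + (LINT x|lborel. h x)"
    using fi standard_integrable[OF add(2)] by (simp add: w_def set_lebesgue_integral_def)
  have w0: "w \<ge> 0" using f0 unfolding w_def set_lebesgue_integral_def by (intro integral_nonneg_AE) auto
  show ?case
  proof (cases "b - a < l0")
    case True
    have "regular {a<..<b} (\<lambda>_. \<sigma>)" using s0 A_pos by (simp add: regular_def mult_le_cancel_left1)
    hence "set_integrable lborel {a<..<b} (\<lambda>_. \<sigma>)" by (rule regular_integrable) (rule order_refl)
    hence "w \<le> (LINT x:{a<..<b}|lborel. \<sigma>)" unfolding w_def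
      using gs by (intro set_integral_mono regular_integrable[OF r gs]) auto
    also have "\<dots> = \<sigma> * (b - a)" using ab by (simp add: set_lebesgue_integral_def)
    also have "\<dots> \<le> \<sigma> * l0" using True s0 by (intro mult_left_mono) auto
    finally have "(w + (LINT x|lborel. h x) - l0 * (\<sigma> + M)) / (1 + C) \<le> ((LINT x|lborel. h x) - l0 * M) / (1 + C)"
      using C_nonneg by (intro divide_right_mono) (auto simp: algebra_simps)
    hence "(w + (LINT x|lborel. h x) - l0 * (\<sigma> + M)) / (1 + C) \<le> (\<Sum>k<G. c k)" using c(3) by linarith
    moreover have "c k \<le> ?f x + h x" if "k < G" "x \<in> ?grid k" for k x
      using c(2)[OF that] f0[of x] by linarith
    ultimately show ?thesis using c(1) unfolding tot by blast
  next
    case False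
    \<comment> \<open>the first grid point not left of \<open>a\<close> is less than \<open>?\<eta> = l0 - l1\<close> away, so its interval still fits\<close>
    define j where "j = nat \<lceil>a / ?\<eta>\<rceil>"
    have "0 \<le> a / ?\<eta>" using ab l by simp
    hence "real j = of_int \<lceil>a / ?\<eta>\<rceil>" by (simp add: j_def)
    hence j1: "a / ?\<eta> \<le> real j" "real j < a / ?\<eta> + 1"
      using ceiling_correct[of "a / ?\<eta>"] by linarith+
    have j2: "a \<le> real j * ?\<eta>" "real j * ?\<eta> < a + ?\<eta>" using j1 l by (auto simp: field_simps)
    hence j3: "real j * ?\<eta> + l1 \<le> b" using False by simp
    hence "real j \<le> (1 - l1) / ?\<eta>" using ab l by (simp add: pos_le_divide_eq)
    hence jG: "j < G" unfolding G by (simp add: le_nat_iff le_floor_iff less_Suc_eq_le)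
    have sub: "?grid j \<subseteq> {a<..<b}" using j2 j3 by auto
    define v where "v = w / (1 + C)"
    have v0: "v \<ge> 0" using w0 C_nonneg by (simp add: v_def)
    have gv: "v \<le> g x" if x: "x \<in> ?grid j" for x
    proof -
      have x': "x \<in> {a<..<b}" using x sub by blast
      have "w \<le> (1 + C) * g x * (b - a)" unfolding w_def by (rule regular_sup_le_mean(2)[OF r ab(4) x'])
      also have "\<dots> \<le> (1 + C) * g x * 1" using ab C_nonneg g0[OF x'] by (intro mult_left_mono) auto
      finally show ?thesis using C_nonneg by (simp add: v_def field_simps)
    qed
    let ?c = "\<lambda>k. c k + (if k = j then v else 0)"
    have "?c k \<le> ?f x + h x" if k: "k < G" "x \<in> ?grid k" for k x
    proof (cases "k = j")
      case True
      moreover from this have "x \<in> {a<..<b}" using k sub by blast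
      ultimately show ?thesis using gv[of x] c(2)[OF k] k by simp
    next
      case False thus ?thesis using c(2)[OF k] f0[of x] by simp
    qed
    moreover have "(w + (LINT x|lborel. h x) - l0 * (\<sigma> + M)) / (1 + C) \<le> (\<Sum>k<G. ?c k)"
    proof -
      have "w + (LINT x|lborel. h x) - l0 * (\<sigma> + M) \<le> w + ((LINT x|lborel. h x) - l0 * M)"
        using l s0 by (simp add: algebra_simps)
      hence "(w + (LINT x|lborel. h x) - l0 * (\<sigma> + M)) / (1 + C) \<le> (w + ((LINT x|lborel. h x) - l0 * M)) / (1 + C)"
        using C_nonneg by (intro divide_right_mono) auto
      also have "\<dots> = v + ((LINT x|lborel. h x) - l0 * M) / (1 + C)" by (simp add: v_def add_divide_distrib)
      also have "\<dots> \<le> v + (\<Sum>k<G. c k)" using c(3) by simp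
      also have "\<dots> = (\<Sum>k<G. ?c k)" using jG by (simp add: sum.distrib sum.delta)
      finally show ?thesis .
    qed
    ultimately show ?thesis using c(1) v0 unfolding tot
      by (intro exI[of _ ?c]) auto
  qed
qed

section \<open>Spreading of lower bounds\<close>

lemma dT_continuous: "q \<in> Q \<Longrightarrow> continuous_on q dT"
  unfolding continuous_on_def
proof (intro ballI)
  fix y assume q: "q \<in> Q" and y: "y \<in> q"
  have p: "((\<lambda>x. \<bar>x - y\<bar> powr \<alpha>) \<longlongrightarrow> 0) (at y within q)"
    by (rule tendsto_zero_powrI[where b = \<alpha>])
      (use alpha_pos in \<open>auto intro!: tendsto_eq_intros simp: tendsto_rabs_zero_iff\<close>)
  have "((\<lambda>x. dT x - dT y) \<longlongrightarrow> 0) (at y within q)"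
  proof (rule Lim_null_comparison)
    show "\<forall>\<^sub>F x in at y within q. norm (dT x - dT y) \<le> Ch * \<bar>x - y\<bar> powr \<alpha>"
      using dT_Hoelder[OF q _ y] unfolding eventually_at_filter by (intro always_eventually) simp
    show "((\<lambda>x. Ch * \<bar>x - y\<bar> powr \<alpha>) \<longlongrightarrow> 0) (at y within q)"
      using p by (rule tendsto_mult_right_zero)
  qed
  thus "(dT \<longlongrightarrow> dT y) (at y within q)" by (simp add: LIM_zero_iff)
qed

lemma measure_image_le:
  assumes q: "q \<in> Q"
  obtains \<Lambda> where "\<Lambda> > 0" "\<And>B. B \<in> sets borel \<Longrightarrow> B \<subseteq> T ` q \<Longrightarrow>
    measure lborel B \<le> \<Lambda> * measure lborel (q \<inter> T -` B)"
proof -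
  obtain l r where lr: "q = {l<..<r}" "l < r" using Q_interval[OF q] delta_pos by force
  then obtain x0 where x0: "x0 \<in> q" using dense by auto
  define \<Lambda> where "\<Lambda> = \<bar>dT x0\<bar> + Ch"
  have L0: "\<Lambda> > 0" using Ch_pos by (simp add: \<Lambda>_def)
  have bd: "\<bar>dT x\<bar> \<le> \<Lambda>" if x: "x \<in> q" for x
  proof -
    have "\<bar>x - x0\<bar> \<le> 1" using x x0 Q_01[OF q] by (auto simp: subset_iff abs_le_iff) (smt (verit) atLeastAtMost_iff)+
    hence "\<bar>x - x0\<bar> powr \<alpha> \<le> 1" using alpha_pos by (intro powr_le1) auto
    hence "Ch * \<bar>x - x0\<bar> powr \<alpha> \<le> Ch * 1" using Ch_pos by (intro mult_left_mono) auto
    thus ?thesis using dT_Hoelder[OF q x x0] by (simp add: \<Lambda>_def)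
  qed
  have "measure lborel B \<le> \<Lambda> * measure lborel (q \<inter> T -` B)" if B: "B \<in> sets borel" "B \<subseteq> T ` q" for B
  proof -
    let ?S = "q \<inter> T -` B"
    have TS: "T ` ?S = B" using B(2) by auto
    have S: "?S \<in> sets borel" by (rule branch_vimage_borel[OF q B(1)])
    have q01: "q \<subseteq> {0..1}" by (rule Q_01[OF q])
    have Tq: "T ` q \<subseteq> {0..1}" using q Q_subset T_range by blast
    have ci: "set_integrable lborel X (\<lambda>_. k)" if X: "X \<subseteq> {0..1::real}" "X \<in> sets borel" for X and k :: real
      unfolding set_integrable_def real_scaleR_def
      using emeasure_bounded_finite[OF bounded_subset[OF bounded_closed_interval X(1)]] X
      by (intro integrable_mult_left integrable_real_indicator) auto
    have dm: "set_borel_measurable borel ?S (\<lambda>x. \<bar>dT x\<bar>)"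
    proof -
      have "(\<lambda>x. indicator q x *\<^sub>R \<bar>dT x\<bar>) \<in> borel_measurable borel"
        using Q_open[OF q] dT_continuous[OF q] by (intro borel_measurable_continuous_on_indicator continuous_on_rabs) auto
      hence "(\<lambda>x. indicator ?S x * (indicator q x * \<bar>dT x\<bar>)) \<in> borel_measurable borel"
        unfolding real_scaleR_def using S by (rule borel_measurable_times[OF borel_measurable_indicator, rotated])
      also have "(\<lambda>x. indicator ?S x * (indicator q x * \<bar>dT x\<bar>)) = (\<lambda>x. indicator ?S x *\<^sub>R \<bar>dT x\<bar>)"
        by (auto simp: indicator_def)
      finally show ?thesis by (simp add: set_borel_measurable_def)
    qed
    have Bint: "set_integrable lborel B (\<lambda>_. 1::real)" by (rule ci) (use B Tq in auto)
    have di: "set_integrable lborel ?S (\<lambda>x. \<bar>dT x\<bar>)"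
      unfolding set_integrable_def
    proof (rule Bochner_Integration.integrable_bound)
      show "integrable lborel (\<lambda>x. indicator ?S x *\<^sub>R \<Lambda>)" using ci[of ?S \<Lambda>] S q01 by (auto simp: set_integrable_def)
      show "(\<lambda>x. indicator ?S x *\<^sub>R \<bar>dT x\<bar>) \<in> borel_measurable lborel" using dm by (simp add: set_borel_measurable_def)
      show "AE x in lborel. norm (indicator ?S x *\<^sub>R \<bar>dT x\<bar>) \<le> norm (indicator ?S x *\<^sub>R \<Lambda>)"
        using bd by (intro AE_I2) (force simp: indicator_def)
    qed
    have "measure lborel B = (LINT z:T ` ?S|lborel. 1)" using B TS by (simp add: set_lebesgue_integral_def)
    also have "\<dots> = (LINT x:?S|lborel. \<bar>dT x\<bar>)"
      using S TS B T_inj[OF q] T_deriv[OF q] dm Bint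
      by (intro set_integral_image_C1[symmetric, where dT = dT]) (auto intro: inj_on_subset)
    also have "\<dots> \<le> (LINT x:?S|lborel. \<Lambda>)"
      using bd S q01 by (intro set_integral_mono di ci) auto
    also have "\<dots> = \<Lambda> * measure lborel ?S" using S by (simp add: set_lebesgue_integral_def)
    finally show ?thesis .
  qed
  thus ?thesis using that L0 by blast
qed

end

locale conditional_density = small_hole +
  fixes \<rho> :: "real \<Rightarrow> real" and R :: real
  assumes rho_meas: "\<rho> \<in> borel_measurable borel"
    and rho_bounds: "\<And>x. 0 \<le> \<rho> x \<and> \<rho> x \<le> M_star * indicator {0..1} x"
    and R_pos: "R > 0"
    and rho_invariant: "\<And>B. B \<in> sets borel \<Longrightarrow> (LINT x:I \<inter> T -` B|lborel. \<rho> x) = R * (LINT x:B|lborel. \<rho> x)"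
begin

lemma rho_integrable: "integrable lborel \<rho>"
proof (rule Bochner_Integration.integrable_bound)
  show "integrable lborel (\<lambda>x. M_star * indicator {0..1::real} x)"
    by (intro integrable_mult_right integrable_real_indicator) auto
  show "AE x in lborel. norm (\<rho> x) \<le> norm (M_star * indicator {0..1} x)"
  proof (rule AE_I2)
    fix x show "norm (\<rho> x) \<le> norm (M_star * indicator {0..1} x)"
      unfolding real_norm_def using rho_bounds[of x] by linarith
  qed
qed (use rho_meas in simp)

lemma rho_set_integrable: "B \<in> sets borel \<Longrightarrow> set_integrable lborel B \<rho>"
  using rho_integrable by (rule set_integrable_of_integrable)

lemma rho_mono:
  assumes "B \<subseteq> B'" "B \<in> sets borel" "B' \<in> sets borel"
  shows "(LINT x:B|lborel. \<rho> x) \<le> (LINT x:B'|lborel. \<rho> x)"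
proof -
  have "integrable lborel (\<lambda>x. indicator X x *\<^sub>R \<rho> x)" if "X \<in> sets borel" for X
    using rho_set_integrable[OF that] by (simp add: set_integrable_def)
  thus ?thesis using assms rho_bounds unfolding set_lebesgue_integral_def
    by (intro integral_mono) (auto simp: indicator_def)
qed

text \<open>
  The density \<open>\<rho>\<close> is essentially bounded below on \<open>E\<close>, expressed through masses of Borel subsets.
\<close>

definition low :: "real set \<Rightarrow> bool" where
  "low E \<longleftrightarrow> (\<exists>c>0. \<forall>B\<in>sets borel. B \<subseteq> E \<longrightarrow> c * measure lborel B \<le> (LINT x:B|lborel. \<rho> x))"

lemma low_subset: "low E \<Longrightarrow> D \<subseteq> E \<Longrightarrow> low D"
  unfolding low_def by (meson order_trans)

lemma low_finite: "finite E \<Longrightarrow> low E"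
proof -
  assume E: "finite E"
  have "1 * measure lborel B \<le> (LINT x:B|lborel. \<rho> x)" if "B \<subseteq> E" for B
  proof -
    have "finite B" using E that by (rule rev_finite_subset)
    hence "measure lborel B = 0" by (simp add: measure_def emeasure_lborel_countable countable_finite)
    moreover have "(LINT x:B|lborel. \<rho> x) \<ge> 0"
      unfolding set_lebesgue_integral_def using rho_bounds by (intro integral_nonneg_AE) (auto simp: indicator_def)
    ultimately show ?thesis by simp
  qed
  thus "low E" unfolding low_def by (intro exI[of _ 1]) auto
qed

lemma low_Un:
  assumes D: "low D" "D \<in> sets borel" "D \<subseteq> {0..1}" and E: "low E" "E \<subseteq> {0..1}"
  shows "low (D \<union> E)"
proof -
  obtain c where c: "c > 0" "\<And>B. B \<in> sets borel \<Longrightarrow> B \<subseteq> D \<Longrightarrow> c * measure lborel B \<le> (LINT x:B|lborel. \<rho> x)"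
    using D unfolding low_def by blast
  obtain d where d: "d > 0" "\<And>B. B \<in> sets borel \<Longrightarrow> B \<subseteq> E \<Longrightarrow> d * measure lborel B \<le> (LINT x:B|lborel. \<rho> x)"
    using E unfolding low_def by blast
  have "min c d * measure lborel B \<le> (LINT x:B|lborel. \<rho> x)" if B: "B \<in> sets borel" "B \<subseteq> D \<union> E" for B
  proof -
    have b: "B \<inter> D \<in> sets borel" "B - D \<in> sets borel" using B D by auto
    have fin: "emeasure lborel X < \<infinity>" if "X \<subseteq> {0..1::real}" for X
      by (rule emeasure_bounded_finite) (rule bounded_subset[OF bounded_closed_interval that])
    have f: "emeasure lborel (B \<inter> D) \<noteq> \<infinity>" "emeasure lborel (B - D) \<noteq> \<infinity>"
      using fin[of "B \<inter> D"] fin[of "B - D"] B D E by (auto simp: less_top)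
    have "measure lborel B = measure lborel (B \<inter> D) + measure lborel (B - D)"
      using measure_Union[OF f, of] b by (simp add: Int_Diff_Un Int_Diff_disjoint)
    hence "min c d * measure lborel B = min c d * measure lborel (B \<inter> D) + min c d * measure lborel (B - D)"
      by (simp add: distrib_left)
    also have "\<dots> \<le> c * measure lborel (B \<inter> D) + d * measure lborel (B - D)"
      by (intro add_mono mult_right_mono) auto
    also have "\<dots> \<le> (LINT x:B \<inter> D|lborel. \<rho> x) + (LINT x:B - D|lborel. \<rho> x)"
      using b B by (intro add_mono c d) auto
    also have "\<dots> = (LINT x:(B \<inter> D) \<union> (B - D)|lborel. \<rho> x)"
      using b by (intro set_integral_Un[symmetric] rho_set_integrable) auto
    finally show ?thesis by (simp add: Int_Diff_Un)
  qed
  thus ?thesis unfolding low_def using c(1) d(1) by (intro exI[of _ "min c d"]) auto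
qed

end

context holed_map
begin

lemma branch_image_borel:
  assumes q: "q \<in> Q" and B: "B \<in> sets borel" "B \<subseteq> q"
  shows "T ` B \<in> sets borel"
proof -
  let ?inv = "the_inv_into q T"
  obtain l r where lr: "q = {l<..<r}" "l < r" using Q_interval[OF q] delta_pos by force
  obtain c d where cd: "T ` q = {c<..<d}" using T_image_interval[OF q, of l r] lr by (metis order_refl)
  have inv: "?inv (T x) = x" if "x \<in> q" for x using the_inv_into_f_f[OF T_inj[OF q] that] .
  have "(1/\<mu>)-lipschitz_on (T ` q) ?inv"
  proof (rule lipschitz_onI)
    fix y z assume "y \<in> T ` q" "z \<in> T ` q"
    then obtain u v where uv: "u \<in> q" "y = T u" "v \<in> q" "z = T v" by blast
    have "\<mu> * \<bar>u - v\<bar> \<le> \<bar>T u - T v\<bar>" by (rule T_expands[OF q uv(1,3)])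
    hence "\<bar>u - v\<bar> \<le> 1 / \<mu> * \<bar>T u - T v\<bar>" using mu_gt by (simp add: field_simps)
    thus "dist (?inv y) (?inv z) \<le> 1 / \<mu> * dist y z" using inv uv by (simp add: dist_real_def)
  qed (use mu_gt in simp)
  hence "continuous_on (T ` q) ?inv" by (rule lipschitz_on_continuous_on)
  hence "?inv \<in> borel_measurable (restrict_space borel (T ` q))"
    by (rule borel_measurable_continuous_on_restrict)
  hence "?inv -` B \<inter> space (restrict_space borel (T ` q)) \<in> sets (restrict_space borel (T ` q))"
    using B(1) by (rule measurable_sets)
  hence "T ` q \<inter> ?inv -` B \<in> sets borel"
    using cd by (auto simp: sets_restrict_space_iff space_restrict_space Int_commute)
  moreover have "T ` q \<inter> ?inv -` B = T ` B" using B(2) inv by (auto simp: image_iff)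
  ultimately show ?thesis by simp
qed

lemma image_branches: "B \<subseteq> I \<Longrightarrow> T ` B = (\<Union>q\<in>Q. T ` (B \<inter> q)) \<union> T ` (B \<inter> (I - \<Union>Q))"
  by blast

lemma image_borel:
  assumes B: "B \<in> sets borel" "B \<subseteq> I" shows "T ` B \<in> sets borel"
proof -
  have "T ` (B \<inter> q) \<in> sets borel" if "q \<in> Q" for q
    using B Q_open[OF that] by (intro branch_image_borel[OF that]) auto
  moreover have "finite (T ` (B \<inter> (I - \<Union>Q)))" using I_minus_Q by simp
  ultimately show ?thesis using image_branches[OF B(2)] Q_finite
    by (metis (no_types, lifting) borel_closed finite_imp_closed sets.Un sets.finite_UN)
qed

lemma T_image_01: "E \<subseteq> I \<Longrightarrow> T ` E \<subseteq> {0..1}"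
  using T_range by blast

end

context conditional_density
begin

lemma low_UN:
  assumes "finite F" "\<And>i. i \<in> F \<Longrightarrow> low (E i) \<and> E i \<in> sets borel \<and> E i \<subseteq> {0..1}"
  shows "low (\<Union>i\<in>F. E i)"
  using assms
proof (induction rule: finite_induct)
  case empty show ?case by (simp add: low_finite)
next
  case (insert i F)
  have "low (E i \<union> (\<Union>i\<in>F. E i))" using insert by (intro low_Un) auto
  thus ?case by simp
qed

text \<open>
  By invariance \<open>R\<close> times the mass of \<open>B\<close> is at least the mass of its preimage in \<open>E\<close>, and the derivative
  is bounded on a branch, so this preimage is not much smaller than \<open>B\<close>.
\<close>

lemma low_branch_image:
  assumes E: "low E" and q: "q \<in> Q" shows "low (T ` (E \<inter> q))"
proof -
  obtain \<Lambda> where L: "\<Lambda> > 0" "\<And>B. B \<in> sets borel \<Longrightarrow> B \<subseteq> T ` q \<Longrightarrow>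
    measure lborel B \<le> \<Lambda> * measure lborel (q \<inter> T -` B)" using measure_image_le[OF q] by blast
  obtain c where c: "c > 0" "\<And>B. B \<in> sets borel \<Longrightarrow> B \<subseteq> E \<Longrightarrow> c * measure lborel B \<le> (LINT x:B|lborel. \<rho> x)"
    using E unfolding low_def by blast
  have "c / (R * \<Lambda>) * measure lborel B \<le> (LINT x:B|lborel. \<rho> x)" if B: "B \<in> sets borel" "B \<subseteq> T ` (E \<inter> q)" for B
  proof -
    let ?S = "q \<inter> T -` B"
    have S: "?S \<in> sets borel" by (rule branch_vimage_borel[OF q B(1)])
    have "?S \<subseteq> E" using B(2) T_inj[OF q] by (auto dest!: subsetD simp: inj_on_def)
    hence "c * measure lborel ?S \<le> (LINT x:?S|lborel. \<rho> x)" using S c by simp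
    also have "\<dots> \<le> (LINT x:I \<inter> T -` B|lborel. \<rho> x)"
      using q Q_subset S vimage_borel[OF B(1)] by (intro rho_mono) auto
    also have "\<dots> = R * (LINT x:B|lborel. \<rho> x)" by (rule rho_invariant[OF B(1)])
    finally have 1: "c * measure lborel ?S \<le> R * (LINT x:B|lborel. \<rho> x)" .
    have "measure lborel B \<le> \<Lambda> * measure lborel ?S" using B by (intro L) auto
    hence "c * measure lborel B \<le> c * (\<Lambda> * measure lborel ?S)" using c by (intro mult_left_mono) auto
    also have "\<dots> = \<Lambda> * (c * measure lborel ?S)" by simp
    also have "\<dots> \<le> \<Lambda> * (R * (LINT x:B|lborel. \<rho> x))" using 1 L by (intro mult_left_mono) auto
    finally show ?thesis using R_pos L(1) by (simp add: field_simps)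
  qed
  thus ?thesis unfolding low_def using c(1) L(1) R_pos by (intro exI[of _ "c / (R * \<Lambda>)"]) auto
qed

lemma low_image:
  assumes E: "low E" "E \<in> sets borel" "E \<subseteq> I" shows "low (T ` E)"
proof -
  have b: "T ` (E \<inter> q) \<in> sets borel \<and> T ` (E \<inter> q) \<subseteq> {0..1}" if "q \<in> Q" for q
    using E Q_open[OF that] T_image_01[OF E(3)] by (intro conjI branch_image_borel[OF that]) auto
  have "low ((\<Union>q\<in>Q. T ` (E \<inter> q)) \<union> T ` (E \<inter> (I - \<Union>Q)))"
    using b T_image_01[OF E(3)] I_minus_Q Q_finite E
    by (intro low_Un low_UN low_finite sets.finite_UN) (auto intro: low_branch_image)
  thus ?thesis using image_branches[OF E(3)] by simp
qed

text \<open>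
  The sets are exactly the images of \<open>E\<close> under the iterates of the map with hole. Each arises from its
  predecessor by applying \<open>T\<close> and intersecting with \<open>I\<close>, which keeps both measurability and the
  lower bound.
\<close>

lemma low_orbit:
  assumes E: "low E" "E \<in> sets borel" "E \<subseteq> I"
  shows "low ((T ^^ i) ` {x\<in>E. \<forall>j\<le>i. (T ^^ j) x \<in> I}) \<and>
     (T ^^ i) ` {x\<in>E. \<forall>j\<le>i. (T ^^ j) x \<in> I} \<in> sets borel \<and>
     (T ^^ i) ` {x\<in>E. \<forall>j\<le>i. (T ^^ j) x \<in> I} \<subseteq> I"
proof (induction i)
  case 0
  have "{x\<in>E. x \<in> I} = E" using E by auto
  thus ?case using E by simp
next
  case (Suc i)
  let ?O = "\<lambda>i. (T ^^ i) ` {x\<in>E. \<forall>j\<le>i. (T ^^ j) x \<in> I}"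
  have eq: "?O (Suc i) = T ` ?O i \<inter> I"
  proof
    show "?O (Suc i) \<subseteq> T ` ?O i \<inter> I" by (auto simp: le_Suc_eq)
    show "T ` ?O i \<inter> I \<subseteq> ?O (Suc i)"
    proof
      fix y assume "y \<in> T ` ?O i \<inter> I"
      then obtain x where x: "x \<in> E" "\<forall>j\<le>i. (T ^^ j) x \<in> I" "y = T ((T ^^ i) x)" "y \<in> I" by blast
      hence "\<forall>j\<le>Suc i. (T ^^ j) x \<in> I" by (auto simp: le_Suc_eq)
      thus "y \<in> ?O (Suc i)" using x by (intro image_eqI[of _ _ x]) auto
    qed
  qed
  have "low (T ` ?O i)" "T ` ?O i \<in> sets borel" using Suc low_image image_borel by blast+
  thus ?case unfolding eq using I_borel by (auto intro: low_subset)
qed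

text \<open>
  If the interval contains no branch, it meets at most two of them, and together these contain all of
  it except what lies in the hole. The larger of the two parts is expanded by \<open>\<mu>\<close>.
\<close>

lemma low_interval_grows:
  assumes low: "low {a<..<b}" and ab: "0 \<le> a" "b \<le> 1" "measure lborel ({0..1} - I) < b - a"
  shows "(\<exists>q\<in>Q. low q) \<or> (\<exists>c d. low {c<..<d} \<and> 0 \<le> c \<and> d \<le> 1 \<and>
     \<mu> / 2 * (b - a - measure lborel ({0..1} - I)) \<le> d - c)"
proof (cases "\<exists>q\<in>Q. q \<subseteq> {a<..<b}")
  case True thus ?thesis using low low_subset by blast
next
  case False
  let ?H = "measure lborel ({0..1} - I)"
  let ?S = "{q \<in> Q. q \<inter> {a<..<b} \<noteq> {} \<and> \<not> q \<subseteq> {a<..<b}}"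
  \<comment> \<open>one of the at most two parts is at least this long\<close>
  define t where "t = (b - a - ?H) / 2"
  have t: "t > 0" using ab by (simp add: t_def)
  have ab': "a < b" using ab(3) measure_nonneg[of lborel "{0..1} - I"] by linarith
  have fin: "emeasure lborel X \<noteq> \<infinity>" if "X \<subseteq> {0..1::real}" for X
    using emeasure_bounded_finite[OF bounded_subset[OF bounded_closed_interval that]] by simp
  have sub: "{a<..<b} \<subseteq> {0..1}" using ab by auto
  have ii: "integrable lborel (indicator {a<..<b} :: real \<Rightarrow> real)"
    using fin[OF sub] by (intro integrable_real_indicator) (auto simp: less_top)
  have mI: "(LINT x:X|lborel. indicator {a<..<b} x) = measure lborel (X \<inter> {a<..<b})" if "X \<in> sets borel" for X
    using that by (simp add: set_lebesgue_integral_def indicator_inter_arith[symmetric])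
  have "b - a = measure lborel (({a<..<b} \<inter> I) \<union> ({a<..<b} - I))" using ab' by (simp add: Int_Diff_Un)
  also have "\<dots> = measure lborel ({a<..<b} \<inter> I) + measure lborel ({a<..<b} - I)"
    using I_borel sub by (intro measure_Union fin) auto
  also have "measure lborel ({a<..<b} - I) \<le> ?H"
    using I_borel sub fin[of "{0..1} - I"]
    by (intro measure_mono_fmeasurable) (auto simp: fmeasurable_def less_top)
  finally have "2 * t \<le> measure lborel ({a<..<b} \<inter> I)" by (simp add: t_def)
  also have "\<dots> = (LINT x:I \<inter> T -` UNIV|lborel. indicator {a<..<b} x)"
    using mI[OF I_borel] by (simp add: Int_commute)
  also have "\<dots> = (\<Sum>q\<in>Q. LINT x:q \<inter> T -` UNIV|lborel. indicator {a<..<b} x)"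
    using ii by (intro set_integral_branches[symmetric]) auto
  also have "\<dots> = (\<Sum>q\<in>Q. measure lborel (q \<inter> {a<..<b}))"
    using mI Q_open by (intro sum.cong) auto
  also have "\<dots> = (\<Sum>q\<in>?S. measure lborel (q \<inter> {a<..<b}))"
    using False Q_finite by (intro sum.mono_neutral_right) auto
  finally have sum: "2 * t \<le> (\<Sum>q\<in>?S. measure lborel (q \<inter> {a<..<b}))" .
  have "\<exists>q\<in>?S. t \<le> measure lborel (q \<inter> {a<..<b})"
  proof (rule ccontr)
    assume n: "\<not> ?thesis"
    have fS: "finite ?S" using Q_finite by simp
    have ne: "?S \<noteq> {}"
    proof
      assume "?S = {}"
      with sum have "2 * t \<le> (\<Sum>q\<in>{}. measure lborel (q \<inter> {a<..<b}))" by (simp only:)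
      thus False using t by simp
    qed
    have "(\<Sum>q\<in>?S. measure lborel (q \<inter> {a<..<b})) < (\<Sum>q\<in>?S. t)"
      using n by (intro sum_strict_mono fS ne) auto
    also have "\<dots> = real (card ?S) * t" by simp
    also have "\<dots> \<le> 2 * t" using straddling_branches[OF ab'] t by (intro mult_right_mono) auto
    finally show False using sum by simp
  qed
  then obtain q where q: "q \<in> Q" "t \<le> measure lborel (q \<inter> {a<..<b})" by blast
  obtain l r where lr: "q = {l<..<r}" using Q_interval[OF q(1)] by blast
  define a' where "a' = max l a"
  define b' where "b' = min r b"
  have J: "q \<inter> {a<..<b} = {a'<..<b'}" by (auto simp: lr a'_def b'_def)
  have "{a'<..<b'} \<noteq> {}" using q(2) t unfolding J by (metis measure_empty not_le)
  hence lt: "a' < b'" by (meson greaterThanLessThan_empty not_le)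
  have len: "t \<le> b' - a'" using q(2) lt unfolding J by simp
  obtain c d where cd: "T ` {a'<..<b'} = {c<..<d}" "0 \<le> c" "c < d" "d \<le> 1" "\<mu> * (b' - a') \<le> d - c"
    using T_image_interval[OF q(1), of a' b'] J lt by blast
  have "low (T ` ({a<..<b} \<inter> q))" by (rule low_branch_image[OF low q(1)])
  hence "low {c<..<d}" using J cd(1) by (simp add: Int_commute)
  moreover have "\<mu> * t \<le> \<mu> * (b' - a')" using len mu_gt by (intro mult_left_mono) auto
  hence "\<mu> / 2 * (b - a - ?H) \<le> d - c" using cd(5) by (simp add: t_def)
  ultimately show ?thesis using cd by blast
qed

text \<open>
  The length \<open>l = m(H) / (1 - s\<^sup>2)\<close> is the fixed point of \<open>x \<mapsto> \<mu> / 2 * (x - m(H))\<close>. A length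
  above \<open>l\<close> therefore moves away from it by the factor \<open>\<mu> / 2 > 1\<close> at each step, which cannot go on
  inside \<open>[0,1]\<close>.
\<close>

lemma low_branch_exists:
  assumes low: "low {a<..<b}" and ab: "0 \<le> a" "b \<le> 1"
    and long: "measure lborel ({0..1} - I) / (1 - s\<^sup>2) < b - a"
  shows "\<exists>q\<in>Q. low q"
proof (rule ccontr)
  assume n: "\<not> ?thesis"
  let ?H = "measure lborel ({0..1} - I)"
  define l where "l = ?H / (1 - s\<^sup>2)"
  have s2: "0 < 1 - s\<^sup>2" "1 - s\<^sup>2 \<le> 1" using s by (simp_all add: abs_square_less_1)
  have lH: "l = ?H + 2 / \<mu> * l" unfolding s(3) using s2 by (simp add: l_def field_simps)
  have l0: "l \<ge> 0" using s2 by (simp add: l_def)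
  have Hl: "?H \<le> l" using lH l0 mu_gt by (smt (verit) divide_nonneg_pos mult_nonneg_nonneg)
  define e where "e = b - a - l"
  have e: "e > 0" using long by (simp add: e_def l_def)
  have "\<exists>c d. low {c<..<d} \<and> 0 \<le> c \<and> d \<le> 1 \<and> l + (\<mu> / 2) ^ n * e \<le> d - c" for n
  proof (induction n)
    case 0 show ?case using low ab by (intro exI[of _ a] exI[of _ b]) (simp add: e_def)
  next
    case (Suc n)
    then obtain c d where cd: "low {c<..<d}" "0 \<le> c" "d \<le> 1" "l + (\<mu> / 2) ^ n * e \<le> d - c" by blast
    have "(\<mu> / 2) ^ n * e > 0" using e mu_gt by simp
    hence "?H < d - c" using cd(4) Hl by linarith
    then obtain c' d' where cd': "low {c'<..<d'}" "0 \<le> c'" "d' \<le> 1" "\<mu> / 2 * (d - c - ?H) \<le> d' - c'"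
      using low_interval_grows[OF cd(1-3)] \<open>\<not> (\<exists>q\<in>Q. low q)\<close> by blast
    have "\<mu> / 2 * (l + (\<mu> / 2) ^ n * e - ?H) \<le> \<mu> / 2 * (d - c - ?H)"
      using cd(4) mu_gt by (intro mult_left_mono) auto
    moreover have "\<mu> / 2 * (l - ?H) = l"
    proof -
      have "l - ?H = 2 / \<mu> * l" using lH by linarith
      thus ?thesis using mu_gt by simp
    qed
    hence "\<mu> / 2 * (l + (\<mu> / 2) ^ n * e - ?H) = l + (\<mu> / 2) ^ Suc n * e"
      by (simp add: algebra_simps)
    ultimately show ?case using cd' by (intro exI[of _ c'] exI[of _ d']) auto
  qed
  moreover obtain n where "(\<mu> / 2) ^ n > 1 / e" using mu_gt real_arch_pow[of "\<mu> / 2" "1 / e"] by auto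
  ultimately obtain c d where cd: "0 \<le> c" "d \<le> 1" "l + (\<mu> / 2) ^ n * e \<le> d - c" by blast
  have "(\<mu> / 2) ^ n * e > 1" using \<open>(\<mu> / 2) ^ n > 1 / e\<close> e by (simp add: field_simps)
  thus False using cd l0 by linarith
qed

lemma low_imp_bounded_below:
  assumes "low I" shows "\<exists>c>0. AE x in lborel. x \<in> I \<longrightarrow> c \<le> \<rho> x"
proof -
  obtain c where c: "c > 0" "\<And>B. B \<in> sets borel \<Longrightarrow> B \<subseteq> I \<Longrightarrow> c * measure lborel B \<le> (LINT x:B|lborel. \<rho> x)"
    using assms unfolding low_def by blast
  let ?f = "\<lambda>x. indicator I x * \<rho> x - c * indicator I x"
  have Ifin: "emeasure lborel X < \<infinity>" if X: "X \<subseteq> I" for X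
    by (rule emeasure_bounded_finite) (rule bounded_subset[OF bounded_closed_interval, OF subset_trans[OF X I_subset]])
  have i1: "integrable lborel (\<lambda>x. indicator I x * \<rho> x)"
    using rho_set_integrable[OF I_borel] by (simp add: set_integrable_def)
  have i2: "integrable lborel (\<lambda>x. c * indicator I x :: real)"
    using Ifin[of I] I_borel by (intro integrable_mult_right integrable_real_indicator) auto
  have "AE x in lborel. ?f x \<ge> 0"
  proof (rule sigma_finite_measure.density_nonneg[OF sigma_finite_lborel])
    show "integrable lborel ?f" using i1 i2 by (rule Bochner_Integration.integrable_diff)
    fix B :: "real set" assume B: "B \<in> sets lborel"
    have "(LINT x:B|lborel. ?f x) = (LINT x:B|lborel. indicator I x * \<rho> x) - (LINT x:B|lborel. c * indicator I x)"
      using B by (intro set_integral_diff set_integrable_of_integrable i1 i2) auto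
    also have "(LINT x:B|lborel. indicator I x * \<rho> x) = (LINT x:B \<inter> I|lborel. \<rho> x)" by (rule set_integral_restrict)
    also have "(LINT x:B|lborel. c * indicator I x) = c * measure lborel (B \<inter> I)"
      using B I_borel by (simp add: set_lebesgue_integral_def indicator_inter_arith[symmetric])
    also have "(LINT x:B \<inter> I|lborel. \<rho> x) - c * measure lborel (B \<inter> I) \<ge> 0"
      using c(2)[of "B \<inter> I"] B I_borel by simp
    finally show "0 \<le> (LINT x:B|lborel. ?f x)" .
  qed
  hence "AE x in lborel. x \<in> I \<longrightarrow> c \<le> \<rho> x" by (rule eventually_mono) (auto simp: indicator_def)
  thus ?thesis using c(1) by blast
qed

end

section \<open>Passage to the limit\<close>

context small_hole
begin

text \<open>
  For \<open>\<alpha> = 1\<close> the two monotone parts of the densities are bounded by \<open>exp A * M_star\<close> and Helly selection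
  applies to each. The truncation in the conclusion puts the bounds of the densities at every
  point, also at the countably many points where the parts do not converge.
\<close>

lemma standard_subsequence:
  assumes u: "\<And>n::nat. standard (u n) (M n)" "\<And>n. M n \<le> M_star"
  shows "\<exists>r \<rho>. strict_mono (r :: nat \<Rightarrow> nat) \<and> \<rho> \<in> borel_measurable borel \<and>
    (\<forall>x. 0 \<le> \<rho> x \<and> \<rho> x \<le> M_star * indicator {0..1} x) \<and>
    (\<forall>B\<in>sets borel. (\<lambda>n. LINT x:B|lborel. u (r n) x) \<longlonglongrightarrow> (LINT x:B|lborel. \<rho> x)) \<and>
    (\<alpha> = 1 \<longrightarrow> (\<exists>p q. mono p \<and> mono q \<and> (\<forall>x\<in>{0..1}. \<rho> x = max 0 (min M_star (p x - q x)))))"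
proof -
  have um: "u n \<in> borel_measurable borel" for n using standard_bounds[OF u(1)] by blast
  have ub: "0 \<le> u n x \<and> u n x \<le> M_star * indicator {0..1} x" for n x
    using standard_bounds[OF u(1)[of n]] u(2)[of n] by (auto simp: indicator_def split: if_splits intro: order_trans)
  show ?thesis
  proof (cases "\<alpha> = 1")
    case False
    obtain r \<rho> where "strict_mono (r :: nat \<Rightarrow> nat)" "\<rho> \<in> borel_measurable borel"
      "\<And>x. 0 \<le> \<rho> x \<and> \<rho> x \<le> M_star * indicator {0..1} x"
      "\<And>A. A \<in> sets borel \<Longrightarrow> (\<lambda>n. LINT x:A|lborel. u (r n) x) \<longlonglongrightarrow> (LINT x:A|lborel. \<rho> x)"
      using bounded_densities_subsequence[of u M_star, OF um ub] by blast
    thus ?thesis using False by blast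
  next
    case True
    define K where "K = exp A * M_star"
    define G where "G n p q \<longleftrightarrow> mono p \<and> mono q \<and>
      (\<forall>x. 0 \<le> p x \<and> p x \<le> K \<and> 0 \<le> q x \<and> q x \<le> K \<and> u n x = p x - q x)" for n p q
    have "\<exists>p q. G n p q" for n
    proof -
      have "exp A * M n \<le> K" unfolding K_def using u(2) by (intro mult_left_mono) auto
      thus ?thesis using standard_difference_of_mono[OF True u(1)[of n]] unfolding G_def by (meson order_trans)
    qed
    then obtain p q where "\<And>n. G n (p n) (q n)" by metis
    hence pq: "mono (p n)" "mono (q n)" "0 \<le> p n x \<and> p n x \<le> K" "0 \<le> q n x \<and> q n x \<le> K" "u n x = p n x - q n x" for n x
      unfolding G_def by blast+
    obtain r1 P where P: "strict_mono (r1 :: nat \<Rightarrow> nat)" "mono P"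
      "countable {x. \<not> (\<lambda>n. p (r1 n) x) \<longlonglongrightarrow> P x}"
      using mono_subsequence_convergent[of p K, OF pq(1,3)] by blast
    obtain r2 W where W: "strict_mono (r2 :: nat \<Rightarrow> nat)" "mono W"
      "countable {x. \<not> (\<lambda>n. q (r1 (r2 n)) x) \<longlonglongrightarrow> W x}"
      using mono_subsequence_convergent[of "\<lambda>n. q (r1 n)" K, OF pq(2,4)] by blast
    define r where "r n = r1 (r2 n)" for n
    define D where "D = {x. \<not> (\<lambda>n. p (r1 n) x) \<longlonglongrightarrow> P x} \<union> {x. \<not> (\<lambda>n. q (r1 (r2 n)) x) \<longlonglongrightarrow> W x}"
    have r: "strict_mono r" using P(1) W(1) by (simp add: r_def strict_mono_def)
    define \<rho> where "\<rho> x = indicator {0..1} x * max 0 (min M_star (P x - W x))" for x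
    have lim: "(\<lambda>n. u (r n) x) \<longlonglongrightarrow> \<rho> x" if "x \<notin> D" for x
    proof -
      have "(\<lambda>n. p (r1 n) x) \<longlonglongrightarrow> P x" using that by (simp add: D_def)
      hence "(\<lambda>n. p (r n) x) \<longlonglongrightarrow> P x" using LIMSEQ_subseq_LIMSEQ[OF _ W(1)] by (fastforce simp: r_def o_def)
      moreover have "(\<lambda>n. q (r n) x) \<longlonglongrightarrow> W x" using that by (simp add: D_def r_def)
      ultimately have l: "(\<lambda>n. u (r n) x) \<longlonglongrightarrow> P x - W x" unfolding pq(5) by (rule tendsto_diff)
      show ?thesis
      proof (cases "x \<in> {0..1}")
        case True
        have "0 \<le> P x - W x" using ub by (intro tendsto_lowerbound[OF l]) auto
        moreover have "P x - W x \<le> M_star" using ub[of _ x] True by (intro tendsto_upperbound[OF l]) auto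
        ultimately show ?thesis using l True by (simp add: \<rho>_def)
      next
        case False
        hence "u (r n) x = 0" for n using ub[of "r n" x] by simp
        thus ?thesis using False by (simp add: \<rho>_def)
      qed
    qed
    have "countable D" using P(3) W(3) by (simp add: D_def)
    hence "AE x in lborel. x \<notin> D" by (intro AE_not_in countable_imp_null_set_lborel)
    hence ae: "AE x in lborel. (\<lambda>n. u (r n) x) \<longlonglongrightarrow> \<rho> x" by (rule eventually_mono) (rule lim)
    have \<rho>m: "\<rho> \<in> borel_measurable borel"
      unfolding \<rho>_def using borel_measurable_mono[OF P(2)] borel_measurable_mono[OF W(2)] by measurable
    have conv: "(\<lambda>n. LINT x:B|lborel. u (r n) x) \<longlonglongrightarrow> (LINT x:B|lborel. \<rho> x)" if B: "B \<in> sets borel" for B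
      unfolding set_lebesgue_integral_def
    proof (rule integral_dominated_convergence[where w = "\<lambda>x. M_star * indicator {0..1} x"])
      show "integrable lborel (\<lambda>x. M_star * indicator {0..1::real} x)"
        by (intro integrable_mult_right integrable_real_indicator) auto
      show "AE x in lborel. (\<lambda>n. indicator B x *\<^sub>R u (r n) x) \<longlonglongrightarrow> indicator B x *\<^sub>R \<rho> x"
        using ae by (rule eventually_mono) (intro tendsto_intros)
      show "AE x in lborel. norm (indicator B x *\<^sub>R u (r n) x) \<le> M_star * indicator {0..1} x" for n
      proof (rule AE_I2)
        fix x show "norm (indicator B x *\<^sub>R u (r n) x) \<le> M_star * indicator {0..1} x"
          using ub[of "r n" x] M_star_ge_1 by (cases "x \<in> B") auto
      qed
    qed (use B um \<rho>m in \<open>auto intro!: borel_measurable_times borel_measurable_indicator\<close>)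
    have "0 \<le> \<rho> x \<and> \<rho> x \<le> M_star * indicator {0..1} x" for x
      using M_star_ge_1 by (auto simp: \<rho>_def indicator_def)
    moreover have "\<forall>x\<in>{0..1}. \<rho> x = max 0 (min M_star (P x - W x))" by (simp add: \<rho>_def)
    ultimately show ?thesis using r \<rho>m conv P(2) W(2) by blast
  qed
qed

text \<open>
  Since \<open>m(H) / (1 - s\<^sup>2) < 1 / M_star\<close>, there is room for two lengths \<open>l1 < l0\<close> in between: \<open>l0\<close>
  guarantees a share of mass on pieces of at least that length, and the grid intervals of length \<open>l1\<close> in
  them are still long enough to grow. One grid interval serves infinitely many of the approximating
  densities, so its lower bound survives in the limit.
\<close>

theorem conditional_density_exists:
  "\<exists>\<rho> R. conditional_density T dT I Q \<alpha> Ch \<mu> \<delta> \<rho> R \<and> (LINT x|lborel. \<rho> x) = 1 \<and>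
     (\<alpha> = 1 \<longrightarrow> (\<exists>p q. mono p \<and> mono q \<and> (\<forall>x\<in>{0..1}. \<rho> x = max 0 (min M_star (p x - q x))))) \<and>
     (\<exists>q\<in>Q. conditional_density.low \<rho> q)"
proof -
  let ?H = "measure lborel ({0..1} - I)"
  define X where "X = ?H / (1 - s\<^sup>2)"
  have s2: "0 < 1 - s\<^sup>2" using s by (simp add: abs_square_less_1)
  have X: "0 \<le> X" "X < 1 / M_star"
  proof -
    show "0 \<le> X" using s2 by (simp add: X_def)
    have "?H * M_star \<le> (1 - s) * (1 - s)" using hole_M_star by (simp add: power2_eq_square)
    also have "\<dots> < (1 - s) * (1 + s)" using s by (intro mult_strict_left_mono) auto
    also have "\<dots> = 1 - s\<^sup>2" by (simp add: power2_eq_square algebra_simps)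
    finally show "X < 1 / M_star" using s2 M_star_ge_1 by (simp add: X_def field_simps)
  qed
  \<comment> \<open>\<open>l1\<close> and \<open>l0\<close> divide the gap between the threshold \<open>X\<close> and \<open>1 / M_star\<close> into thirds\<close>
  define l1 where "l1 = X + (1 / M_star - X) / 3"
  define l0 where "l0 = X + 2 * (1 / M_star - X) / 3"
  have l: "X < l1" "l1 < l0" "l0 < 1 / M_star" using X(2) by (auto simp: l1_def l0_def field_simps)
  have "1 / M_star \<le> 1" using M_star_ge_1 by simp
  hence l01: "0 < l1" "l0 \<le> 1" "l1 \<le> 1" using l X by linarith+
  define G where "G = Suc (nat \<lfloor>(1 - l1) / (l0 - l1)\<rfloor>)"
  let ?grid = "\<lambda>k. {real k * (l0 - l1)<..<real k * (l0 - l1) + l1}"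
  define \<kappa> where "\<kappa> = (1 - l0 * M_star) / (1 + C) / real G"
  have G0: "real G > 0" by (simp add: G_def)
  have "l0 * M_star < 1" using l(3) M_star_ge_1 by (simp add: field_simps)
  hence kpos: "\<kappa> > 0" using C_nonneg G0 unfolding \<kappa>_def by (intro divide_pos_pos) auto
  have grid: "\<exists>k<G. \<forall>x\<in>?grid k. \<kappa> \<le> h x" if h: "standard h M" "M \<le> M_star" "(LINT x|lborel. h x) = 1" for h M
  proof (rule ccontr)
    assume n: "\<not> ?thesis"
    obtain c where c: "\<And>k x. k < G \<Longrightarrow> x \<in> ?grid k \<Longrightarrow> c k \<le> h x"
      "((LINT x|lborel. h x) - l0 * M) / (1 + C) \<le> (\<Sum>k<G. c k)"
      using standard_grid[OF l01(1) l(2) l01(2) G_def h(1)] by blast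
    have "c k < \<kappa>" if "k < G" for k using n c(1)[OF that] that by (meson not_le order_trans)
    hence "(\<Sum>k<G. c k) < (\<Sum>k<G. \<kappa>)" by (intro sum_strict_mono) (auto simp: G_def)
    also have "\<dots> = (1 - l0 * M_star) / (1 + C)" using G0 by (simp add: \<kappa>_def)
    also have "\<dots> \<le> (1 - l0 * M) / (1 + C)"
      using h(2) l01 l C_nonneg by (intro divide_right_mono) (auto intro!: mult_left_mono)
    finally show False using c(2) h(3) by simp
  qed
  obtain R where R: "R > 0" "\<And>e. e > 0 \<Longrightarrow> \<exists>u M. standard u M \<and> M \<le> M_star \<and> (LINT x|lborel. u x) = 1 \<and>
     (\<forall>B\<in>sets borel. \<bar>(LINT x:I \<inter> T -` B|lborel. u x) - R * (LINT x:B|lborel. u x)\<bar> \<le> e)"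
    using almost_invariant_densities by blast
  define Z where "Z n u M \<longleftrightarrow> standard u M \<and> M \<le> M_star \<and> (LINT x|lborel. u x) = 1 \<and>
     (\<forall>B\<in>sets borel. \<bar>(LINT x:I \<inter> T -` B|lborel. u x) - R * (LINT x:B|lborel. u x)\<bar> \<le> inverse (real (Suc n)))" for n u M
  have "\<exists>u M. Z n u M" for n using R(2)[of "inverse (real (Suc n))"] by (simp add: Z_def)
  then obtain u M where "\<And>n. Z n (u n) (M n)" by metis
  hence u: "\<And>n. standard (u n) (M n)" "\<And>n. M n \<le> M_star" "\<And>n. (LINT x|lborel. u n x) = 1"
    "\<And>n B. B \<in> sets borel \<Longrightarrow> \<bar>(LINT x:I \<inter> T -` B|lborel. u n x) - R * (LINT x:B|lborel. u n x)\<bar> \<le> inverse (real (Suc n))"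
    unfolding Z_def by blast+
  obtain r \<rho> where r: "strict_mono (r :: nat \<Rightarrow> nat)" and \<rho>: "\<rho> \<in> borel_measurable borel"
    "\<And>x. 0 \<le> \<rho> x \<and> \<rho> x \<le> M_star * indicator {0..1} x"
    and conv: "\<And>B. B \<in> sets borel \<Longrightarrow> (\<lambda>n. LINT x:B|lborel. u (r n) x) \<longlonglongrightarrow> (LINT x:B|lborel. \<rho> x)"
    and bv: "\<alpha> = 1 \<longrightarrow> (\<exists>p q. mono p \<and> mono q \<and> (\<forall>x\<in>{0..1}. \<rho> x = max 0 (min M_star (p x - q x))))"
    using standard_subsequence[of u M, OF u(1,2)] by blast
  have inv: "(LINT x:I \<inter> T -` B|lborel. \<rho> x) = R * (LINT x:B|lborel. \<rho> x)" if B: "B \<in> sets borel" for B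
  proof -
    let ?d = "\<lambda>n. (LINT x:I \<inter> T -` B|lborel. u (r n) x) - R * (LINT x:B|lborel. u (r n) x)"
    have "?d \<longlonglongrightarrow> (LINT x:I \<inter> T -` B|lborel. \<rho> x) - R * (LINT x:B|lborel. \<rho> x)"
      by (intro tendsto_intros conv B vimage_borel)
    moreover have "?d \<longlonglongrightarrow> 0"
    proof (rule Lim_null_comparison)
      show "\<forall>\<^sub>F n in sequentially. norm (?d n) \<le> inverse (real (Suc (r n)))"
        using u(4)[OF B] by (intro always_eventually) simp
      show "(\<lambda>n. inverse (real (Suc (r n)))) \<longlonglongrightarrow> 0"
        using LIMSEQ_subseq_LIMSEQ[OF LIMSEQ_inverse_real_of_nat r] by (simp add: o_def)
    qed
    ultimately have "(LINT x:I \<inter> T -` B|lborel. \<rho> x) - R * (LINT x:B|lborel. \<rho> x) = 0"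
      by (rule LIMSEQ_unique)
    thus ?thesis by simp
  qed
  interpret cd: conditional_density T dT I Q \<alpha> Ch \<mu> \<delta> \<rho> R
    by unfold_locales (use \<rho> R inv in auto)
  have one: "(LINT x|lborel. \<rho> x) = 1"
  proof -
    have "(\<lambda>n. 1) \<longlonglongrightarrow> (LINT x|lborel. \<rho> x)" using conv[of UNIV] u(3) by (simp add: set_lebesgue_integral_def)
    thus ?thesis by (simp add: LIMSEQ_const_iff)
  qed
  have "\<exists>k<G. cd.low (?grid k)"
  proof -
    have "\<exists>\<^sub>F n in sequentially. \<exists>k\<in>{..<G}. \<forall>x\<in>?grid k. \<kappa> \<le> u (r n) x"
      using grid[OF u(1-3)] by (intro eventually_frequently) (auto simp: Bex_def)
    then obtain k where k: "k < G" "\<exists>\<^sub>F n in sequentially. \<forall>x\<in>?grid k. \<kappa> \<le> u (r n) x"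
      by (auto simp: frequently_bex_finite_distrib)
    have "\<kappa> * measure lborel B \<le> (LINT x:B|lborel. \<rho> x)" if B: "B \<in> sets borel" "B \<subseteq> ?grid k" for B
    proof (rule ccontr)
      assume "\<not> ?thesis"
      hence ev: "\<forall>\<^sub>F n in sequentially. (LINT x:B|lborel. u (r n) x) < \<kappa> * measure lborel B"
        by (intro order_tendstoD(2)[OF conv[OF B(1)]]) simp
      obtain n where n: "\<forall>x\<in>?grid k. \<kappa> \<le> u (r n) x" "(LINT x:B|lborel. u (r n) x) < \<kappa> * measure lborel B"
        using frequently_ex[OF frequently_eventually_frequently[OF k(2) ev]] by blast
      have fin: "emeasure lborel B < \<infinity>"
        by (rule emeasure_bounded_finite) (rule bounded_subset[OF bounded_Ioo B(2)])
      have "\<kappa> * measure lborel B = (LINT x:B|lborel. \<kappa>)" using B by (simp add: set_lebesgue_integral_def)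
      also have "\<dots> \<le> (LINT x:B|lborel. u (r n) x)"
      proof (rule set_integral_mono)
        show "set_integrable lborel B (\<lambda>_. \<kappa>)" unfolding set_integrable_def real_scaleR_def
          using fin B by (intro integrable_mult_left integrable_real_indicator) auto
        show "set_integrable lborel B (u (r n))" by (rule set_integrable_of_integrable[OF standard_integrable[OF u(1)] B(1)])
      qed (use n(1) B(2) in auto)
      finally show False using n(2) by simp
    qed
    thus ?thesis using k(1) kpos unfolding cd.low_def by blast
  qed
  then obtain k where k: "k < G" "cd.low (?grid k)" by blast
  have "real k \<le> (1 - l1) / (l0 - l1)"
  proof -
    have "0 \<le> (1 - l1) / (l0 - l1)" using l l01 by simp
    moreover have "k \<le> nat \<lfloor>(1 - l1) / (l0 - l1)\<rfloor>" using k(1) by (simp add: G_def)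
    ultimately show ?thesis by (simp add: le_nat_iff le_floor_iff)
  qed
  hence "real k * (l0 - l1) + l1 \<le> 1" using l by (simp add: field_simps)
  hence "\<exists>q\<in>Q. cd.low q"
    using k(2) l by (intro cd.low_branch_exists[of "real k * (l0 - l1)" "real k * (l0 - l1) + l1"]) (auto simp: X_def)
  thus ?thesis using cd.conditional_density_axioms one bv by blast
qed

end

section \<open>The partition of the surviving set\<close>

text \<open>
  Removing an interval from an interval leaves at most two intervals, so the difference is a finite
  union of intervals, and every component contains one of them.
\<close>

lemma finite_components_minus_intervals:
  fixes X :: "real set" and Y :: "nat \<Rightarrow> real set"
  assumes "is_interval X" "finite N" "\<And>l. l \<in> N \<Longrightarrow> is_interval (Y l)"
  shows "finite (components (X - (\<Union>l\<in>N. Y l)))"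
proof -
  have split: "V - W = {x\<in>V. \<forall>y\<in>W. x < y} \<union> {x\<in>V. \<forall>y\<in>W. y < x}"
    and int: "is_interval {x\<in>V. \<forall>y\<in>W. x < y}" "is_interval {x\<in>V. \<forall>y\<in>W. y < x}"
    if VW: "is_interval V" "is_interval W" for V W :: "real set"
  proof -
    show "V - W = {x\<in>V. \<forall>y\<in>W. x < y} \<union> {x\<in>V. \<forall>y\<in>W. y < x}"
    proof (intro set_eqI iffI)
      fix x assume x: "x \<in> V - W"
      have "\<not> (y \<le> x \<and> x \<le> z)" if "y \<in> W" "z \<in> W" for y z
        using VW(2) x that unfolding is_interval_1 by blast
      hence "(\<forall>y\<in>W. x < y) \<or> (\<forall>y\<in>W. y < x)" by (meson not_le)
      thus "x \<in> {x\<in>V. \<forall>y\<in>W. x < y} \<union> {x\<in>V. \<forall>y\<in>W. y < x}" using x by blast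
    qed auto
    show "is_interval {x\<in>V. \<forall>y\<in>W. x < y}" "is_interval {x\<in>V. \<forall>y\<in>W. y < x}"
      using VW(1) unfolding is_interval_1 by (fastforce)+
  qed
  have "\<exists>F. finite F \<and> (\<forall>V\<in>F. is_interval V) \<and> X - (\<Union>l\<in>N. Y l) = \<Union>F"
    using assms(2,3)
  proof (induction N rule: finite_induct)
    case empty show ?case using assms(1) by (intro exI[of _ "{X}"]) auto
  next
    case (insert l N)
    then obtain F where F: "finite F" "\<And>V. V \<in> F \<Longrightarrow> is_interval V" "X - (\<Union>l\<in>N. Y l) = \<Union>F" by auto
    let ?W = "Y l"
    let ?F = "(\<lambda>V. {x\<in>V. \<forall>y\<in>?W. x < y}) ` F \<union> (\<lambda>V. {x\<in>V. \<forall>y\<in>?W. y < x}) ` F"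
    have W: "is_interval ?W" using insert by simp
    have "X - (\<Union>l\<in>insert l N. Y l) = (\<Union>V\<in>F. V - ?W)" using F(3) by auto
    also have "\<dots> = (\<Union>V\<in>F. {x\<in>V. \<forall>y\<in>?W. x < y} \<union> {x\<in>V. \<forall>y\<in>?W. y < x})"
      using split[OF F(2) W] by (intro SUP_cong) auto
    also have "\<dots> = \<Union>?F" by auto
    finally have "X - (\<Union>l\<in>insert l N. Y l) = \<Union>?F" .
    moreover have "finite ?F" using F(1) by auto
    moreover have "\<forall>V\<in>?F. is_interval V" using int[OF F(2) W] by auto
    ultimately show ?case by (intro exI[of _ ?F]) blast
  qed
  then obtain F where F: "finite F" "\<And>V. V \<in> F \<Longrightarrow> is_interval V" "X - (\<Union>l\<in>N. Y l) = \<Union>F" by blast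
  let ?c = "\<lambda>V. connected_component_set (\<Union>F) (SOME x. x \<in> V)"
  have "components (\<Union>F) \<subseteq> ?c ` F"
  proof
    fix c assume "c \<in> components (\<Union>F)"
    then obtain x where x: "x \<in> \<Union>F" "c = connected_component_set (\<Union>F) x" by (auto simp: components_iff)
    then obtain V where V: "V \<in> F" "x \<in> V" by auto
    hence "(SOME x. x \<in> V) \<in> V" by (metis someI)
    moreover have "V \<subseteq> connected_component_set (\<Union>F) x"
      using V F(2) by (intro connected_component_maximal is_interval_connected) auto
    ultimately have "c = ?c V" using x(2) by (metis connected_component_eq subsetD)
    thus "c \<in> ?c ` F" using V by auto
  qed
  thus ?thesis unfolding F(3) using F(1) finite_surj by blast
qed

lemma bounded_interval_endpoints:
  fixes J :: "real set"
  assumes J: "is_interval J" "bounded J" "0 < measure lborel J"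
  obtains a b where "interior J = {a<..<b}" "{a<..<b} \<subseteq> J" "J \<subseteq> {a..b}" "a < b" "measure lborel J = b - a"
proof -
  have ne: "J \<noteq> {}" using J(3) by auto
  have bb: "bdd_above J" "bdd_below J" using J(2) by (auto simp: bounded_imp_bdd_above bounded_imp_bdd_below)
  define a where "a = Inf J"
  define b where "b = Sup J"
  have sub: "J \<subseteq> {a..b}" using bb by (auto simp: a_def b_def cInf_lower cSup_upper)
  have sup: "{a<..<b} \<subseteq> J"
  proof
    fix x assume "x \<in> {a<..<b}"
    then obtain y z where "y \<in> J" "y < x" "z \<in> J" "x < z"
      using bb ne by (auto simp: a_def b_def less_cSup_iff cInf_less_iff)
    thus "x \<in> J" using J(1) unfolding is_interval_1 by (meson less_imp_le)
  qed
  have Jb: "J \<in> sets borel" using J(1) by (simp add: is_interval_connected_1 real_interval_borel_measurable)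
  have fin: "X \<in> fmeasurable lborel" if "bounded X" "X \<in> sets borel" for X :: "real set"
    using emeasure_bounded_finite[OF that(1)] that(2) by (intro fmeasurableI) auto
  have 1: "measure lborel J \<le> measure lborel {a..b}" using sub Jb by (intro measure_mono_fmeasurable fin) auto
  have ab: "a < b"
  proof (rule ccontr)
    assume "\<not> a < b"
    hence "measure lborel {a..b} = 0" by (cases "a = b") auto
    thus False using 1 J(3) by simp
  qed
  have 2: "measure lborel {a<..<b} \<le> measure lborel J" using sup Jb J(2) by (intro measure_mono_fmeasurable fin) auto
  have "measure lborel J = b - a" using 1 2 ab by simp
  moreover have "interior J = {a<..<b}"
  proof
    show "interior J \<subseteq> {a<..<b}" using interior_mono[OF sub] by (simp add: interior_atLeastAtMost_real)
    show "{a<..<b} \<subseteq> interior J" using sup by (intro interior_maximal) auto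
  qed
  ultimately show ?thesis using that sup sub ab by blast
qed

text \<open>
  The hypothesis on \<open>f\<close> allows for truncation and scaling of \<open>p - q\<close>; the sum is bounded by the
  telescoping sum of the increasing function \<open>p + q\<close>.
\<close>

lemma bounded_variation_on_unit_interval:
  fixes p q :: "real \<Rightarrow> real"
  assumes pq: "mono p" "mono q" and S: "S \<subseteq> {0..1}" and K: "K \<ge> 0"
    and f: "\<And>x y. x \<in> S \<Longrightarrow> y \<in> S \<Longrightarrow> \<bar>f x - f y\<bar> \<le> K * \<bar>(p x - q x) - (p y - q y)\<bar>"
  shows "bounded_variation_on S f"
  unfolding bounded_variation_on_def
proof (intro exI[of _ "K * ((p 1 - p 0) + (q 1 - q 0))"] allI impI)
  fix n and x :: "nat \<Rightarrow> real" assume x: "(\<forall>i\<le>n. x i \<in> S) \<and> (\<forall>i<n. x i \<le> x (Suc i))"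
  have "(\<Sum>i<n. \<bar>f (x (Suc i)) - f (x i)\<bar>) \<le> (\<Sum>i<n. K * ((p (x (Suc i)) + q (x (Suc i))) - (p (x i) + q (x i))))"
  proof (rule sum_mono)
    fix i assume i: "i \<in> {..<n}"
    have le: "x i \<le> x (Suc i)" and S': "x i \<in> S" "x (Suc i) \<in> S" using x i by auto
    have "\<bar>f (x (Suc i)) - f (x i)\<bar> \<le> K * \<bar>(p (x (Suc i)) - q (x (Suc i))) - (p (x i) - q (x i))\<bar>"
      by (rule f[OF S'(2,1)])
    also have "\<dots> \<le> K * ((p (x (Suc i)) + q (x (Suc i))) - (p (x i) + q (x i)))"
      using monoD[OF pq(1) le] monoD[OF pq(2) le] K by (intro mult_left_mono) auto
    finally show "\<bar>f (x (Suc i)) - f (x i)\<bar> \<le> \<dots>" .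
  qed
  also have "\<dots> = K * ((p (x n) + q (x n)) - (p (x 0) + q (x 0)))"
    unfolding sum_distrib_left[symmetric] by (subst sum_lessThan_telescope) simp
  also have "\<dots> \<le> K * ((p 1 - p 0) + (q 1 - q 0))"
  proof -
    have "x 0 \<in> {0..1}" "x n \<in> {0..1}" using x S by auto
    hence "p 0 \<le> p (x 0)" "q 0 \<le> q (x 0)" "p (x n) \<le> p 1" "q (x n) \<le> q 1"
      using pq by (auto intro: monoD)
    thus ?thesis using K by (intro mult_left_mono) auto
  qed
  finally show "(\<Sum>i<n. \<bar>f (x (Suc i)) - f (x i)\<bar>) \<le> K * ((p 1 - p 0) + (q 1 - q 0))" .
qed

lemma is_hole_subset: "is_hole H \<Longrightarrow> H \<subseteq> {0..1}"
  unfolding is_hole_def by (auto dest: openin_imp_subset)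

lemma hole_partition_finite:
  assumes H: "is_hole H" and T: "piecewise_monotone_map That Khat Ihat"
  shows "finite (hole_partition Khat Ihat H)"
proof -
  obtain L Hs where Hs: "H = (\<Union>l\<in>{1..L::nat}. Hs l)" "\<And>l. l \<in> {1..L} \<Longrightarrow> is_interval (Hs l)"
    using H unfolding is_hole_def by blast
  have "finite (components (Ihat k \<inter> hole_complement H))" if k: "k \<in> {1..Khat}" for k
  proof -
    have "Ihat k \<subseteq> {0..1}" "is_interval (Ihat k)" using T k unfolding piecewise_monotone_map_def by blast+
    moreover from this have "Ihat k \<inter> hole_complement H = Ihat k - (\<Union>l\<in>{1..L}. Hs l)"
      unfolding hole_complement_def Hs(1) by auto
    ultimately show ?thesis using finite_components_minus_intervals[of "Ihat k" "{1..L}" Hs] Hs(2) by auto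
  qed
  thus ?thesis unfolding hole_partition_def by auto
qed

lemma hole_partition_Union:
  assumes "piecewise_monotone_map That Khat Ihat"
  shows "\<Union>(hole_partition Khat Ihat H) = hole_complement H"
proof -
  have "\<Union>(hole_partition Khat Ihat H) = (\<Union>k\<in>{1..Khat}. Ihat k \<inter> hole_complement H)"
    unfolding hole_partition_def using Union_components by blast
  also have "\<dots> = (\<Union>k\<in>{1..Khat}. Ihat k) \<inter> hole_complement H" by auto
  also have "\<dots> = hole_complement H"
    using assms unfolding piecewise_monotone_map_def hole_complement_def by auto
  finally show ?thesis .
qed

lemma hole_partition_disjoint:
  assumes "piecewise_monotone_map That Khat Ihat"
    and J: "J \<in> hole_partition Khat Ihat H" "J' \<in> hole_partition Khat Ihat H" "J \<noteq> J'"
  shows "J \<inter> J' = {}"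
proof -
  obtain k k' where k: "k \<in> {1..Khat}" "J \<in> components (Ihat k \<inter> hole_complement H)"
      "k' \<in> {1..Khat}" "J' \<in> components (Ihat k' \<inter> hole_complement H)"
    using J unfolding hole_partition_def by blast
  show ?thesis
  proof (cases "k = k'")
    case True thus ?thesis using k J(3) components_nonoverlap by blast
  next
    case False
    hence "Ihat k \<inter> Ihat k' = {}"
      using assms k unfolding piecewise_monotone_map_def disjoint_family_on_def by blast
    thus ?thesis using in_components_subset[OF k(2)] in_components_subset[OF k(4)] by blast
  qed
qed

text \<open>
  The number \<open>a\<close> of (A1) satisfies \<open>sqrt (2 / \<mu>) \<le> a < 1\<close>, so (A1) remains true with \<open>a\<close> replaced
  by \<open>sqrt (2 / \<mu>)\<close>.
\<close>

lemma small_hole_of_condition_A1: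
  assumes T: "expanding_map That dT Khat Ihat \<alpha> Chat \<mu>" and H: "is_hole H"
    and A1: "condition_A1 Khat Ihat H \<alpha> Chat \<mu> \<delta>"
  shows "small_hole That dT (hole_complement H) (interior ` hole_partition Khat Ihat H) \<alpha> Chat \<mu> \<delta>"
    and "\<And>J. J \<in> hole_partition Khat Ihat H \<Longrightarrow> is_interval J \<and> J \<subseteq> hole_complement H \<and> finite (J - interior J)"
proof -
  let ?P = "hole_partition Khat Ihat H" and ?I = "hole_complement H"
  let ?s = "sqrt (2 / \<mu>)" and ?C = "(exp (Chat / (\<mu> * (\<mu> powr \<alpha> - 1))) - 1) * (2 * \<delta>) powr \<alpha>"
  have pm: "piecewise_monotone_map That Khat Ihat" using T unfolding expanding_map_def by blast
  have par: "\<alpha> > 0" "Chat > 0" "\<mu> > 2" using T unfolding expanding_map_def by blast+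
  have d: "\<delta> > 0" "\<delta> \<le> min_length Khat Ihat H"
    using A1 unfolding condition_A1_def Let_def by (auto split: if_splits)
  have I01: "?I \<subseteq> {0..1}" unfolding hole_complement_def by auto
  have ends: "is_interval J \<and> J \<subseteq> ?I \<and> (\<exists>k\<in>{1..Khat}. J \<subseteq> Ihat k) \<and> (\<exists>a b. interior J = {a<..<b} \<and>
      {a<..<b} \<subseteq> J \<and> J \<subseteq> {a..b} \<and> a < b \<and> \<delta> \<le> b - a)" if J: "J \<in> ?P" for J
  proof -
    obtain k where k: "k \<in> {1..Khat}" "J \<in> components (Ihat k \<inter> ?I)"
      using J unfolding hole_partition_def by blast
    have sub: "J \<subseteq> Ihat k" "J \<subseteq> ?I" using in_components_subset[OF k(2)] by auto
    have int: "is_interval J" using in_components_connected[OF k(2)] by (simp add: is_interval_connected_1)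
    have "measure lborel J \<ge> min_length Khat Ihat H"
      unfolding min_length_def using hole_partition_finite[OF H pm] J by (intro Min_le) auto
    hence m: "\<delta> \<le> measure lborel J" using d by linarith
    have "bounded J" using sub I01 by (meson bounded_closed_interval bounded_subset)
    then obtain a b where "interior J = {a<..<b}" "{a<..<b} \<subseteq> J" "J \<subseteq> {a..b}" "a < b" "measure lborel J = b - a"
      using bounded_interval_endpoints[OF int] m d(1) by (metis less_le_trans)
    thus ?thesis using int sub m k(1) by metis
  qed
  have fin: "finite (J - interior J)" if J: "J \<in> ?P" for J
  proof -
    obtain a b where "interior J = {a<..<b}" "J \<subseteq> {a..b}" using ends[OF J] by blast
    hence "J - interior J \<subseteq> {a, b}" by auto
    thus ?thesis by (rule finite_subset) simp
  qed
  show "is_interval J \<and> J \<subseteq> ?I \<and> finite (J - interior J)" if "J \<in> ?P" for J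
    using ends[OF that] fin[OF that] by blast
  have hm: "holed_map That dT ?I (interior ` ?P) \<alpha> Chat \<mu> \<delta>"
  proof unfold_locales
    show "\<alpha> > 0" "Chat > 0" "\<mu> > 2" "\<delta> > 0" by fact+
    show "finite (interior ` ?P)" using hole_partition_finite[OF H pm] by simp
    have "?I \<noteq> {}" using H is_hole_subset[OF H] unfolding is_hole_def hole_complement_def by blast
    hence "?P \<noteq> {}" using hole_partition_Union[OF pm, of H] by auto
    thus "interior ` ?P \<noteq> {}" by simp
    show "disjoint (interior ` ?P)"
    proof (rule disjointI)
      fix q q' assume "q \<in> interior ` ?P" "q' \<in> interior ` ?P" "q \<noteq> q'"
      then obtain J J' where "J \<in> ?P" "J' \<in> ?P" "J \<noteq> J'" "q = interior J" "q' = interior J'" by blast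
      thus "q \<inter> q' = {}" using hole_partition_disjoint[OF pm, of J H J'] interior_subset by blast
    qed
    show "\<exists>a b. q = {a<..<b} \<and> \<delta> \<le> b - a" if "q \<in> interior ` ?P" for q using that ends by blast
    show "\<Union> (interior ` ?P) \<subseteq> ?I" using ends interior_subset by blast
    have "?I - \<Union> (interior ` ?P) \<subseteq> (\<Union>J\<in>?P. J - interior J)"
      using hole_partition_Union[OF pm, of H] by auto
    thus "finite (?I - \<Union> (interior ` ?P))"
      by (rule finite_subset) (use fin hole_partition_finite[OF H pm] in auto)
    show "?I \<subseteq> {0..1}" by fact
    show "That x \<in> {0..1}" if "x \<in> ?I" for x using pm I01 that unfolding piecewise_monotone_map_def by blast
    fix q assume "q \<in> interior ` ?P"
    then obtain J where J: "J \<in> ?P" "q = interior J" by blast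
    then obtain k where k: "k \<in> {1..Khat}" "J \<subseteq> Ihat k" using ends by blast
    have qk: "q \<subseteq> Ihat k" "open q" using J k interior_subset by auto
    show "(That has_real_derivative dT x) (at x)" if "x \<in> q" for x
    proof -
      have "(That has_real_derivative dT x) (at x within Ihat k)"
        using T k that qk unfolding expanding_map_def by blast
      hence "(That has_real_derivative dT x) (at x within q)" using qk(1) by (rule has_field_derivative_subset)
      thus ?thesis by (simp only: at_within_open[OF that qk(2)])
    qed
    show "\<bar>dT x\<bar> \<ge> \<mu>" if "x \<in> q" for x using T k that qk unfolding expanding_map_def by blast
    show "\<bar>dT x - dT y\<bar> \<le> Chat * \<bar>x - y\<bar> powr \<alpha>" if "x \<in> q" "y \<in> q" for x y
      using T k that qk unfolding expanding_map_def by blast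
  qed
  show "small_hole That dT ?I (interior ` ?P) \<alpha> Chat \<mu> \<delta>"
  proof (intro small_hole.intro small_hole_axioms.intro hm)
    have C: "holed_map.C \<alpha> Chat \<mu> \<delta> = ?C" by (simp add: holed_map.C_def[OF hm] holed_map.A_def[OF hm])
    have C0: "?C \<ge> 0" using holed_map.C_nonneg[OF hm] C by simp
    have s1: "?s < 1" using par by simp
    define r where "r = 2 powr \<alpha> * (1 + ?C) / \<mu> powr \<alpha>"
    define a where "a = (if \<alpha> = 1 then max ?s (2 / \<mu>) else max ?s r)"
    have "\<alpha> \<noteq> 1 \<longrightarrow> r < 1" and a3: "measure lborel H \<le> (1 - a)\<^sup>2 * \<mu> * \<delta>\<^sup>2 * (1 - ?s) / (1 + ?C)"
      using A1 unfolding condition_A1_def Let_def a_def r_def by (simp_all split: if_splits)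
    hence a: "?s \<le> a" "a < 1" "measure lborel H \<le> (1 - a)\<^sup>2 * \<mu> * \<delta>\<^sup>2 * (1 - ?s) / (1 + ?C)"
      using par s1 a3 by (auto simp: a_def)
    have "(1 - a)\<^sup>2 * \<mu> * \<delta>\<^sup>2 * (1 - ?s) / (1 + ?C) \<le> (1 - ?s)\<^sup>2 * \<mu> * \<delta>\<^sup>2 * (1 - ?s) / (1 + ?C)"
      using a par s1 C0 by (intro divide_right_mono mult_right_mono power_mono) auto
    moreover have "{0..1} - ?I = H" using is_hole_subset[OF H] unfolding hole_complement_def by auto
    ultimately show "measure lborel ({0..1} - ?I)
        \<le> (1 - ?s)\<^sup>2 * \<mu> * \<delta>\<^sup>2 * (1 - ?s) / (1 + holed_map.C \<alpha> Chat \<mu> \<delta>)"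
      using a(3) C by simp
  qed
qed

section \<open>Conditionally invariant densities\<close>

text \<open>
  The density is \<open>\<rho> / R\<close> on \<open>I\<close>, since \<open>I\<close> has mass \<open>R\<close>. Under transitivity it is replaced by
  \<open>max c \<rho> / R\<close> for an essential lower bound \<open>c\<close> of \<open>\<rho>\<close>, which changes it on a null set only and turns
  the essential bound into a bound at every point without increasing the variation.
\<close>

theorem theorem3p2:
  fixes That dT :: "real \<Rightarrow> real" and Khat :: nat and Ihat :: "nat \<Rightarrow> real set"
    and H :: "real set" and \<alpha> Chat \<mu> \<delta> :: real
  assumes "expanding_map That dT Khat Ihat \<alpha> Chat \<mu>"
    and "is_hole H"
    and "condition_A1 Khat Ihat H \<alpha> Chat \<mu> \<delta>"
  shows "\<exists>\<nu> \<rho>. conditionally_invariant That H \<nu> \<and> eigenvalue That H \<nu> > 0 \<and>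
           absolutely_continuous (restrict_space lborel (hole_complement H)) \<nu> \<and>
           is_density_on (hole_complement H) \<nu> \<rho> \<and>
           bdd_above (\<rho> ` hole_complement H) \<and>
           (\<alpha> = 1 \<longrightarrow> bounded_variation_on (hole_complement H) \<rho>) \<and>
           (transitivity_property That Khat Ihat H \<longrightarrow>
              (\<exists>c>0. \<forall>x\<in>hole_complement H. \<rho> x \<ge> c))"
proof -
  let ?P = "hole_partition Khat Ihat H" and ?I = "hole_complement H"
  let ?Q = "interior ` ?P"
  interpret small_hole That dT ?I ?Q \<alpha> Chat \<mu> \<delta> by (rule small_hole_of_condition_A1(1)[OF assms])
  obtain \<rho> R where cd: "conditional_density That dT ?I ?Q \<alpha> Chat \<mu> \<delta> \<rho> R" and one: "(LINT x|lborel. \<rho> x) = 1"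
    and bv: "\<alpha> = 1 \<Longrightarrow> \<exists>p q. mono p \<and> mono q \<and> (\<forall>x\<in>{0..1}. \<rho> x = max 0 (min M_star (p x - q x)))"
    and lowq: "\<exists>q\<in>?Q. conditional_density.low \<rho> q"
    using conditional_density_exists by blast
  interpret conditional_density That dT ?I ?Q \<alpha> Chat \<mu> \<delta> \<rho> R by (rule cd)
  let ?tr = "transitivity_property That Khat Ihat H"
  have surv: "surviving That H i = {x. \<forall>j\<le>i. (That ^^ j) x \<in> ?I}" for i
    unfolding surviving_def by auto
  have bounded_below: "\<exists>c>0. AE x in lborel. x \<in> ?I \<longrightarrow> c \<le> \<rho> x" if tr: ?tr
  proof -
    obtain J where J: "J \<in> ?P" "low (interior J)" using lowq by blast
    note JP = small_hole_of_condition_A1(2)[OF assms J(1)]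
    have "low (interior J \<union> (J - interior J))"
      using JP I_subset interior_subset[of J] by (intro low_Un J low_finite) auto
    hence lJ: "low J" using interior_subset[of J] by (simp add: Un_absorb1)
    have bJ: "J \<in> sets borel" using JP by (simp add: is_interval_connected_1 real_interval_borel_measurable)
    obtain n where n: "J \<union> (\<Union>i\<in>{1..n}. hole_image That H i J) = ?I"
      using tr J(1) unfolding transitivity_property_def by blast
    have im: "hole_image That H i J = (That ^^ i) ` {x\<in>J. \<forall>j\<le>i. (That ^^ j) x \<in> ?I}" for i
      unfolding hole_image_def surv by (simp add: Int_def)
    have "low (hole_image That H i J) \<and> hole_image That H i J \<in> sets borel \<and> hole_image That H i J \<subseteq> {0..1}" for i
      unfolding im using low_orbit[OF lJ bJ] JP I_subset by blast
    hence "low (J \<union> (\<Union>i\<in>{1..n}. hole_image That H i J))"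
      using JP I_subset bJ lJ by (intro low_Un low_UN) (auto simp: subset_iff)
    thus ?thesis unfolding n by (rule low_imp_bounded_below)
  qed
  obtain c where c: "c \<ge> 0" "?tr \<longrightarrow> c > 0" "AE x in lborel. x \<in> ?I \<longrightarrow> c \<le> \<rho> x"
  proof (cases ?tr)
    case True thus ?thesis using bounded_below that by (metis less_imp_le)
  next
    case False thus ?thesis using that[of 0] rho_bounds by simp
  qed
  define f where "f x = max c (\<rho> x) / R" for x
  define \<nu> where "\<nu> = density (restrict_space lborel ?I) (\<lambda>x. ennreal (f x))"
  have fm: "f \<in> borel_measurable borel" unfolding f_def using rho_meas by measurable
  have f0: "f x \<ge> 0" for x using c(1) R_pos by (simp add: f_def)
  have sets\<nu>: "sets \<nu> = sets (restrict_space borel ?I)"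
    unfolding \<nu>_def by (simp cong: sets_restrict_space_cong)
  have Isets: "?I \<inter> space lborel \<in> sets lborel" using I_borel by simp
  have em: "emeasure \<nu> A = ennreal ((LINT x:A|lborel. \<rho> x) / R)" if A: "A \<in> sets borel" "A \<subseteq> ?I" for A
  proof -
    have A': "A \<in> sets (restrict_space lborel ?I)" using A I_borel by (simp add: sets_restrict_space_iff)
    have fm': "(\<lambda>x. ennreal (f x)) \<in> borel_measurable (restrict_space lborel ?I)"
      using fm by (intro measurable_compose[OF _ measurable_ennreal] measurable_restrict_space1) simp
    have "emeasure \<nu> A = (\<integral>\<^sup>+x. ennreal (f x) * indicator A x \<partial>restrict_space lborel ?I)"
      unfolding \<nu>_def using A' fm' by (subst emeasure_density) auto
    also have "\<dots> = (\<integral>\<^sup>+x. ennreal (f x) * indicator A x * indicator ?I x \<partial>lborel)"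
      by (rule nn_integral_restrict_space[OF Isets])
    also have "\<dots> = (\<integral>\<^sup>+x. ennreal (indicator A x * \<rho> x / R) \<partial>lborel)"
      using c(3) A(2) by (intro nn_integral_cong_AE) (auto elim!: eventually_mono simp: f_def max_def indicator_def)
    also have "\<dots> = ennreal (LINT x|lborel. indicator A x * \<rho> x / R)"
      using rho_set_integrable[OF A(1)] rho_bounds R_pos
      by (intro nn_integral_eq_integral) (auto simp: set_integrable_def)
    also have "(LINT x|lborel. indicator A x * \<rho> x / R) = (LINT x:A|lborel. \<rho> x) / R"
      by (simp add: set_lebesgue_integral_def)
    finally show ?thesis .
  qed
  have me: "measure \<nu> A = (LINT x:A|lborel. \<rho> x) / R" if A: "A \<in> sets borel" "A \<subseteq> ?I" for A
  proof -
    have "0 \<le> (LINT x:A|lborel. \<rho> x)" unfolding set_lebesgue_integral_def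
      using rho_bounds by (intro integral_nonneg_AE) (auto simp: indicator_def)
    thus ?thesis using em[OF A] R_pos by (simp add: measure_def)
  qed
  have RI: "(LINT x:?I|lborel. \<rho> x) = R"
    using rho_invariant[of UNIV] one by (simp add: set_lebesgue_integral_def)
  have hv: "hole_vimage That H A = ?I \<inter> That -` A" if "A \<subseteq> ?I" for A
    using that unfolding hole_vimage_def surv by (auto simp: le_Suc_eq)
  have mv: "measure \<nu> (hole_vimage That H A) = (LINT x:A|lborel. \<rho> x)" if A: "A \<in> sets borel" "A \<subseteq> ?I" for A
    using me[OF vimage_borel[OF A(1)]] rho_invariant[OF A(1)] R_pos hv[OF A(2)] by simp
  have eig: "eigenvalue That H \<nu> = R"
    unfolding eigenvalue_def using mv[OF I_borel] RI by simp
  have ci: "conditionally_invariant That H \<nu>"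
    unfolding conditionally_invariant_def
  proof (intro conjI ballI impI)
    show "prob_space \<nu>"
    proof (rule prob_spaceI)
      have "space \<nu> = ?I" by (simp add: \<nu>_def space_restrict_space)
      thus "emeasure \<nu> (space \<nu>) = 1" using em[OF I_borel] RI R_pos by simp
    qed
    show "measure \<nu> (hole_vimage That H A) = eigenvalue That H \<nu> * measure \<nu> A"
      if "A \<in> sets borel" "A \<subseteq> ?I" for A
      using mv[OF that] me[OF that] eig R_pos by simp
  qed (rule sets\<nu>)
  have ac: "absolutely_continuous (restrict_space lborel ?I) \<nu>"
    unfolding \<nu>_def using fm
    by (intro absolutely_continuousI_density measurable_compose[OF _ measurable_ennreal] measurable_restrict_space1) simp
  have den: "is_density_on ?I \<nu> f"
    unfolding is_density_on_def using f0 fm by (auto simp: \<nu>_def intro: measurable_restrict_space1)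
  have bdd: "bdd_above (f ` ?I)"
  proof (rule bdd_aboveI2)
    fix x
    have "\<rho> x \<le> M_star" using rho_bounds[of x] M_star_ge_1 by (cases "x \<in> {0..1}") auto
    thus "f x \<le> max c M_star / R"
      using R_pos unfolding f_def by (intro divide_right_mono max.mono) auto
  qed
  have bvf: "bounded_variation_on ?I f" if a1: "\<alpha> = 1"
  proof -
    obtain p q where pq: "mono p" "mono q" "\<And>x. x \<in> {0..1} \<Longrightarrow> \<rho> x = max 0 (min M_star (p x - q x))"
      using bv[OF a1] by blast
    show ?thesis
    proof (rule bounded_variation_on_unit_interval[OF pq(1,2) I_subset, of "1 / R"])
      show "0 \<le> 1 / R" using R_pos by simp
      fix x y assume xy: "x \<in> ?I" "y \<in> ?I"
      have r: "\<rho> x = max 0 (min M_star (p x - q x))" "\<rho> y = max 0 (min M_star (p y - q y))"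
        using xy I_subset by (auto intro!: pq(3))
      have "\<bar>max c (\<rho> x) - max c (\<rho> y)\<bar> \<le> \<bar>(p x - q x) - (p y - q y)\<bar>" unfolding r by linarith
      thus "\<bar>f x - f y\<bar> \<le> 1 / R * \<bar>(p x - q x) - (p y - q y)\<bar>"
        using R_pos unfolding f_def by (simp add: diff_divide_distrib[symmetric] divide_right_mono)
    qed
  qed
  have low: "\<exists>c>0. \<forall>x\<in>?I. f x \<ge> c" if ?tr
    using c(2) that R_pos by (intro exI[of _ "c / R"]) (auto simp: f_def divide_right_mono)
  show ?thesis using ci eig R_pos ac den bdd bvf low by (intro exI[of _ \<nu>] exI[of _ f]) simp
qed

end
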